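(* Let $R\subseteq T$ be an extension of rings with $T=R[\alpha_1,\ldots,\alpha_n]$ for some $\alpha_1,\ldots,\alpha_n\in T$. Assume that $T$ has only finitely many maximal subrings. Then the following statements hold: (1) $R$ is zero-dimensional if and only if $T$ is zero-dimensional. (2) $R$ is semilocal (resp. artinian) if and only if $T$ is semilocal (resp. artinian). Moreover, in any of these cases (i.e. whenever $R$, equivalently $T$, is zero-dimensional, or semilocal, or artinian), $T$ is a finitely generated $R$-module and for each prime ideal $P$ of $R$ the ring $R/P$ has only finitely many maximal subrings. Furthermore, in case (2) (i.e. when $R$, equivalently $T$, is semilocal or artinian), $R/N(R)$ has only finitely many maximal subrings up to isomorphism.
   Context: All rings are commutative with $1\neq 0$ and subrings and ring extensions are unital. A proper subring $S$ of a ring $R$ is a maximal subring of $R$ if it is maximal with respect to inclusion among all proper subrings of $R$. A ring (not necessarily noetherian) is semilocal if it has only finitely many maximal ideals. $N(R)$ denotes the nilradical of $R$. Zero-dimensional means Krull dimension zero. "Up to isomorphism" means that the maximal subrings fall into finitely many ring-isomorphism classes. *)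

theory Defs
  imports "HOL-Algebra.Algebra" "HOL-Library.Extended_Nat"
begin

text \<open>A subring \<open>S\<close> of a ring \<open>R\<close> is a subset of its carrier; regarded as a ring in its own
  right it is the record \<open>R\<lparr>carrier := S\<rparr>\<close>.  The library's \<open>subring\<close> contains \<open>\<one>\<close>.\<close>

definition maximal_subring :: "'a set \<Rightarrow> ('a, 'b) ring_scheme \<Rightarrow> bool" where
  "maximal_subring S R \<longleftrightarrow>
     subring S R \<and> S \<noteq> carrier R \<and>
     (\<forall>S'. subring S' R \<longrightarrow> S' \<noteq> carrier R \<longrightarrow> S \<subseteq> S' \<longrightarrow> S' = S)"

definition maximal_subrings :: "('a, 'b) ring_scheme \<Rightarrow> 'a set set" where
  "maximal_subrings R = {S. maximal_subring S R}"

definition subring_iso_rel :: "('a, 'b) ring_scheme \<Rightarrow> ('a set \<times> 'a set) set" where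
  "subring_iso_rel R = {(S, S'). subring S R \<and> subring S' R \<and>
     R\<lparr>carrier := S\<rparr> \<simeq> R\<lparr>carrier := S'\<rparr>}"

definition finitely_many_maximal_subrings_up_to_iso :: "('a, 'b) ring_scheme \<Rightarrow> bool" where
  "finitely_many_maximal_subrings_up_to_iso R \<longleftrightarrow>
     finite (maximal_subrings R // subring_iso_rel R)"

text \<open>The supremum of the lengths \<open>n\<close> of chains \<open>P 0 \<subset> P 1 \<subset> \<dots> \<subset> P n\<close> of prime ideals.
  Since \<open>Sup {} = 0\<close> in \<^typ>\<open>enat\<close>, the zero ring gets dimension 0 as well; it is excluded
  wherever the dimension is used.\<close>

definition krull_dim :: "('a, 'b) ring_scheme \<Rightarrow> enat" where
  "krull_dim R = Sup {enat n | n. \<exists>P :: nat \<Rightarrow> 'a set.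
     (\<forall>i\<le>n. primeideal (P i) R) \<and> (\<forall>i<n. P i \<subset> P (Suc i))}"

definition zero_dimensional :: "('a, 'b) ring_scheme \<Rightarrow> bool" where
  "zero_dimensional R \<longleftrightarrow> krull_dim R = 0"

definition semilocal :: "('a, 'b) ring_scheme \<Rightarrow> bool" where
  "semilocal R \<longleftrightarrow> finite {M. maximalideal M R}"

definition artinian :: "('a, 'b) ring_scheme \<Rightarrow> bool" where
  "artinian R \<longleftrightarrow>
     (\<forall>I :: nat \<Rightarrow> 'a set. (\<forall>n. ideal (I n) R) \<longrightarrow> (\<forall>n. I (Suc n) \<subseteq> I n) \<longrightarrow>
        (\<exists>n. \<forall>m\<ge>n. I m = I n))"

definition nilradical :: "('a, 'b) ring_scheme \<Rightarrow> 'a set" where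
  "nilradical R = {x \<in> carrier R. \<exists>n::nat. x [^]\<^bsub>R\<^esub> n = \<zero>\<^bsub>R\<^esub>}"

text \<open>\<open>T\<close> is a finitely generated module over its subring \<open>R\<close>.  The library's \<open>Span R us\<close> is
  \<open>R u\<^sub>1 + \<dots> + R u\<^sub>m\<close>; it is defined for an arbitrary set \<open>R\<close> of scalars.\<close>

definition fg_module_over :: "'a set \<Rightarrow> ('a, 'b) ring_scheme \<Rightarrow> bool" where
  "fg_module_over R T \<longleftrightarrow>
     (\<exists>us. set us \<subseteq> carrier T \<and> ring.Span T R us = carrier T)"

end

theory Submission
  imports Defs "HOL-Decision_Procs.Algebra_Aux"
begin

text \<open>Key fact: a semilocal domain \<open>A\<close> with only finitely many maximal subrings is algebraic over a
  finite field, hence a field in which every nonzero element is a root of unity.  Otherwise \<open>A\<close>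
  contains infinitely many pairwise comaximal elements that are primes of \<open>\<int>\<close>, or values
  \<open>w\<^sub>n(x)\<close> at a transcendental \<open>x\<close> of the polynomials \<open>w\<^sub>0 = x\<close>, \<open>w\<^sub>n\<^sub>+\<^sub>1 = w\<^sub>n\<^sup>2 - w\<^sub>n + 1\<close>.  As \<open>A\<close>
  is semilocal, infinitely many of them are units, and each such unit \<open>w\<close> gives a valuation-like
  subring \<open>S\<close> with \<open>1/w \<notin> S\<close> and \<open>A = S[1/w]\<close>, hence a maximal subring avoiding \<open>1/w\<close>; comaximality
  makes these maximal subrings distinct.

  Moreover only finitely many maximal ideals of \<open>T\<close> lie over a given ideal of \<open>R\<close>, so in each of
  the cases of the theorem every quotient \<open>T/P\<close> by a prime ideal is semilocal, and therefore a
  field algebraic over a finite field.  It follows that every \<open>x \<in> T\<close> is a root of a product of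
  polynomials \<open>X\<^sup>a - X\<^sup>b\<close> with \<open>a > b\<close>.  This property passes to \<open>R\<close>, makes all prime ideals
  maximal, and makes \<open>T\<close> integral, hence finite, over \<open>R\<close>; all the equivalences follow.
  For a prime \<open>P\<close> of \<open>R\<close>, the maximal subrings of \<open>R/P\<close> are compared with those of a residue field
  of \<open>T\<close> by means of the degrees of elements over the prime field.\<close>

section \<open>Ideals and submodules\<close>

text \<open>Two maximal subrings are told apart by a relation g u + h w = 1: a maximal subring that
  avoids 1/u contains 1/w as soon as it contains u, w, g and h. All subrings built from one
  transcendental x must therefore contain Z[x]. This explains the choice of the w_n: each is monic
  in x, so x is integral over Z[w_n], and the ring S made for w_n is closed under integral elements.
  The recursion, that of Sylvester's sequence, makes every w_j equal to 1 modulo each earlier w_i. S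
  comes from Chevalley's extension argument, carried out inside A rather than in its fraction field.
  Localisation at a prime of the base ring is replaced by a multiplicative set of admissible leading
  coefficients, and A = S[1/w] holds because A is algebraic over the base ring, which is Z or a ring
  C[w] with C maximal. A subring of a field algebraic over a finite field is cut out by prime powers
  that must not divide degrees. Only finitely many of these divide a common period of the
  generators; the others lead to maximal subrings of the big field.\<close>

definition submod :: "('a, 'b) ring_scheme \<Rightarrow> 'a set \<Rightarrow> 'a set \<Rightarrow> bool" where
  "submod R K W \<longleftrightarrow> W \<subseteq> carrier R \<and> \<zero>\<^bsub>R\<^esub> \<in> W \<and> (\<forall>x\<in>W. \<forall>y\<in>W. x \<oplus>\<^bsub>R\<^esub> y \<in> W) \<and>
     (\<forall>k\<in>K. \<forall>x\<in>W. k \<otimes>\<^bsub>R\<^esub> x \<in> W)"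

lemma submodI:
  assumes "W \<subseteq> carrier R" "\<zero>\<^bsub>R\<^esub> \<in> W" "\<And>x y. x \<in> W \<Longrightarrow> y \<in> W \<Longrightarrow> x \<oplus>\<^bsub>R\<^esub> y \<in> W"
    "\<And>k x. k \<in> K \<Longrightarrow> x \<in> W \<Longrightarrow> k \<otimes>\<^bsub>R\<^esub> x \<in> W"
  shows "submod R K W"
  using assms unfolding submod_def by blast

lemma submodD:
  assumes "submod R K W"
  shows "W \<subseteq> carrier R" "\<zero>\<^bsub>R\<^esub> \<in> W" "\<And>x y. x \<in> W \<Longrightarrow> y \<in> W \<Longrightarrow> x \<oplus>\<^bsub>R\<^esub> y \<in> W"
    "\<And>k x. k \<in> K \<Longrightarrow> x \<in> W \<Longrightarrow> k \<otimes>\<^bsub>R\<^esub> x \<in> W" "\<And>x. x \<in> W \<Longrightarrow> x \<in> carrier R"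
  using assms unfolding submod_def by blast+

lemma submod_mono: "submod R K W \<Longrightarrow> K' \<subseteq> K \<Longrightarrow> submod R K' W"
  unfolding submod_def by blast

lemma submod_Int: "submod R K W \<Longrightarrow> submod R K W' \<Longrightarrow> submod R K (W \<inter> W')"
  unfolding submod_def by blast

text \<open>\<open>submod\<close> has no clause for negatives: they come from the scalar -1, so that
  the same definition covers additive monoids (\<open>K = {}\<close>).\<close>

lemma (in cring) submod_uminus:
  assumes "subring K R" "submod R K W" "x \<in> W"
  shows "\<ominus> x \<in> W"
proof -
  have "\<ominus> \<one> \<in> K" using subringE[OF assms(1)] by blast
  then have "\<ominus> \<one> \<otimes> x \<in> W" using submodD(4)[OF assms(2)] assms(3) by blast
  then show ?thesis using submodD(5)[OF assms(2,3)] by (simp add: l_minus)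
qed

lemma (in cring) submod_minus:
  assumes "subring K R" "submod R K W" "x \<in> W" "y \<in> W"
  shows "x \<ominus> y \<in> W"
  using submodD(3)[OF assms(2)] submod_uminus[OF assms(1,2)] assms(3,4) by (simp add: minus_eq)

lemma (in cring) subring_minus:
  assumes "subring K R" "x \<in> K" "y \<in> K" shows "x \<ominus> y \<in> K"
  using subringE[OF assms(1)] assms(2,3) by (simp add: minus_eq)

lemma (in cring) subring_cring: "subring K R \<Longrightarrow> cring (R\<lparr>carrier := K\<rparr>)"
  using subcringI' subcring_iff subringE(1) by blast

text \<open>Turns ideals of the updated record into \<open>K\<close>-submodules of the ambient ring,
  so that later arguments about ideals of a subring are computed in \<open>R\<close>.\<close>

lemma (in cring) ideal_subring_iff:
  assumes K: "subring K R"
  shows "ideal J (R\<lparr>carrier := K\<rparr>) \<longleftrightarrow> J \<subseteq> K \<and> submod R K J"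
proof
  assume J: "ideal J (R\<lparr>carrier := K\<rparr>)"
  interpret J: ideal J "R\<lparr>carrier := K\<rparr>" by fact
  have "J \<subseteq> K" using J.a_subset by simp
  moreover have "submod R K J"
  proof (rule submodI)
    show "J \<subseteq> carrier R" using J.a_subset subringE(1)[OF K] by auto
    show "\<zero> \<in> J" using additive_subgroup.zero_closed[OF J.additive_subgroup_axioms] by simp
    show "x \<oplus> y \<in> J" if "x \<in> J" "y \<in> J" for x y
      using additive_subgroup.a_closed[OF J.additive_subgroup_axioms that] by simp
    show "k \<otimes> x \<in> J" if "k \<in> K" "x \<in> J" for k x
      using J.I_l_closed[of x k] that by simp
  qed
  ultimately show "J \<subseteq> K \<and> submod R K J" by blast
next
  assume J: "J \<subseteq> K \<and> submod R K J"
  interpret K: cring "R\<lparr>carrier := K\<rparr>" using subring_cring[OF K] .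
  have neg: "\<ominus>\<^bsub>R\<lparr>carrier := K\<rparr>\<^esub> x \<in> J" if "x \<in> J" for x
  proof -
    have x: "x \<in> K" using that J by blast
    have "\<ominus>\<^bsub>R\<lparr>carrier := K\<rparr>\<^esub> x = \<ominus>\<^bsub>R\<lparr>carrier := K\<rparr>\<^esub> \<one>\<^bsub>R\<lparr>carrier := K\<rparr>\<^esub> \<otimes>\<^bsub>R\<lparr>carrier := K\<rparr>\<^esub> x"
      using x K.l_minus[of "\<one>\<^bsub>R\<lparr>carrier := K\<rparr>\<^esub>" x] K.l_one[of x] subringE(3)[OF K] by simp
    also have "\<dots> \<in> J" using submodD(4)[OF conjunct2[OF J] _ that] K.a_inv_closed[OF K.one_closed] by simp
    finally show ?thesis .
  qed
  show "ideal J (R\<lparr>carrier := K\<rparr>)"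
  proof (rule idealI)
    show "ring (R\<lparr>carrier := K\<rparr>)" by (rule K.ring_axioms)
    show "subgroup J (add_monoid (R\<lparr>carrier := K\<rparr>))"
      apply (rule K.add.subgroupI)
      using J neg submodD[OF conjunct2[OF J]] by (auto simp: a_inv_def)
    fix a x assume ax: "a \<in> J" "x \<in> carrier (R\<lparr>carrier := K\<rparr>)"
    then have c: "a \<in> carrier R" "x \<in> carrier R" and m: "x \<otimes> a \<in> J"
      using J subringE(1)[OF K] submodD(4)[OF conjunct2[OF J]] by auto
    show "x \<otimes>\<^bsub>R\<lparr>carrier := K\<rparr>\<^esub> a \<in> J" using m by simp
    show "a \<otimes>\<^bsub>R\<lparr>carrier := K\<rparr>\<^esub> x \<in> J" using m m_comm[OF c] by simp
  qed
qed

lemma (in cring) ideal_iff_submod: "ideal J R \<longleftrightarrow> submod R (carrier R) J"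
proof -
  have "R\<lparr>carrier := carrier R\<rparr> = R" by simp
  then show ?thesis using ideal_subring_iff[OF carrier_is_subring, of J] submodD(1)[of R "carrier R" J] by auto
qed

lemma (in cring) idealD:
  assumes "ideal J R"
  shows "J \<subseteq> carrier R" "\<And>x. x \<in> J \<Longrightarrow> x \<in> carrier R" "\<zero> \<in> J" "\<And>x y. x \<in> J \<Longrightarrow> y \<in> J \<Longrightarrow> x \<oplus> y \<in> J"
    "\<And>r x. r \<in> carrier R \<Longrightarrow> x \<in> J \<Longrightarrow> r \<otimes> x \<in> J" "\<And>r x. r \<in> carrier R \<Longrightarrow> x \<in> J \<Longrightarrow> x \<otimes> r \<in> J"
    "\<And>x. x \<in> J \<Longrightarrow> \<ominus> x \<in> J" "\<And>x y. x \<in> J \<Longrightarrow> y \<in> J \<Longrightarrow> x \<ominus> y \<in> J"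
proof -
  have S: "submod R (carrier R) J" using assms ideal_iff_submod by blast
  show "J \<subseteq> carrier R" "\<And>x. x \<in> J \<Longrightarrow> x \<in> carrier R" "\<zero> \<in> J" "\<And>x y. x \<in> J \<Longrightarrow> y \<in> J \<Longrightarrow> x \<oplus> y \<in> J"
    "\<And>r x. r \<in> carrier R \<Longrightarrow> x \<in> J \<Longrightarrow> r \<otimes> x \<in> J" using submodD[OF S] by blast+
  show "\<And>r x. r \<in> carrier R \<Longrightarrow> x \<in> J \<Longrightarrow> x \<otimes> r \<in> J" using ideal.I_r_closed[OF assms] by blast
  show "\<And>x. x \<in> J \<Longrightarrow> \<ominus> x \<in> J" using submod_uminus[OF carrier_is_subring S] .
  show "\<And>x y. x \<in> J \<Longrightarrow> y \<in> J \<Longrightarrow> x \<ominus> y \<in> J" using submod_minus[OF carrier_is_subring S] .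
qed

lemma (in cring) ideal_restrict:
  assumes "ideal J R" "subring K R"
  shows "ideal (J \<inter> K) (R\<lparr>carrier := K\<rparr>)"
proof -
  have "submod R K J" using assms(1) ideal_iff_submod submod_mono subringE(1)[OF assms(2)] by blast
  moreover have "submod R K K" using subringE[OF assms(2)] by (intro submodI)
  ultimately show ?thesis using ideal_subring_iff[OF assms(2)] submod_Int by blast
qed

lemma (in cring) primeideal_restrict:
  assumes "primeideal P R" "subring K R"
  shows "primeideal (P \<inter> K) (R\<lparr>carrier := K\<rparr>)"
proof -
  interpret P: primeideal P R by fact
  have K: "K \<subseteq> carrier R" using subringE(1)[OF assms(2)] .
  show ?thesis
  proof (rule primeidealI)
    show "ideal (P \<inter> K) (R\<lparr>carrier := K\<rparr>)" using ideal_restrict P.is_ideal assms(2) by blast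
    show "cring (R\<lparr>carrier := K\<rparr>)" using subring_cring assms(2) by blast
    show "carrier (R\<lparr>carrier := K\<rparr>) \<noteq> P \<inter> K"
      using P.I_notcarr P.one_imp_carrier subringE(3)[OF assms(2)] by auto
    fix a b assume ab: "a \<in> carrier (R\<lparr>carrier := K\<rparr>)" "b \<in> carrier (R\<lparr>carrier := K\<rparr>)"
       "a \<otimes>\<^bsub>R\<lparr>carrier := K\<rparr>\<^esub> b \<in> P \<inter> K"
    then have "a \<in> K" "b \<in> K" "a \<otimes> b \<in> P" by simp_all
    then show "a \<in> P \<inter> K \<or> b \<in> P \<inter> K"
      using P.I_prime[of a b] K by blast
  qed
qed

text \<open>Zorn's lemma with an arbitrary set \<open>N\<close>: \<open>{\<one>}\<close> leads to
  maximal ideals, a multiplicative set to primes, and \<open>insert v (carrier R - W)\<close> to an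
  ideal maximal among those inside \<open>W\<close> that miss \<open>v\<close>.\<close>

lemma (in ring) exists_ideal_maximal_disjoint:
  assumes "ideal I R" "I \<inter> N = {}"
  obtains J where "ideal J R" "I \<subseteq> J" "J \<inter> N = {}"
    "\<And>K. ideal K R \<Longrightarrow> J \<subseteq> K \<Longrightarrow> K \<inter> N = {} \<Longrightarrow> K = J"
proof -
  let ?A = "{J. ideal J R \<and> I \<subseteq> J \<and> J \<inter> N = {}}"
  have "\<exists>M\<in>?A. \<forall>Y\<in>?A. M \<subseteq> Y \<longrightarrow> Y = M"
  proof (rule subset_Zorn_nonempty)
    show "?A \<noteq> {}" using assms by blast
    fix C assume C: "C \<noteq> {}" "subset.chain ?A C"
    then have "subset.chain {I. ideal I R} C" unfolding pred_on.chain_def by blast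
    then have "ideal (\<Union>C) R" using chain_Union_is_ideal[of C] C(1) by simp
    then show "\<Union>C \<in> ?A" using C unfolding pred_on.chain_def by blast
  qed
  then show ?thesis using that by auto
qed

lemma (in cring) sum_ideal_elem:
  assumes "ideal J R" "x \<in> carrier R"
  shows "ideal {j \<oplus> r \<otimes> x | j r. j \<in> J \<and> r \<in> carrier R} R" (is "ideal ?K R")
    and "J \<subseteq> {j \<oplus> r \<otimes> x | j r. j \<in> J \<and> r \<in> carrier R}"
    and "x \<in> {j \<oplus> r \<otimes> x | j r. j \<in> J \<and> r \<in> carrier R}"
proof -
  interpret J: ideal J R by fact
  have Jc: "\<And>j. j \<in> J \<Longrightarrow> j \<in> carrier R" using J.a_subset by blast
  have "submod R (carrier R) ?K"
  proof (rule submodI)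
    show "?K \<subseteq> carrier R" using Jc assms(2) by blast
    show "\<zero> \<in> ?K" using assms(2) idealD(3)[OF assms(1)] by (intro CollectI exI[of _ "\<zero>"]) auto
  next
    fix a b assume "a \<in> ?K" "b \<in> ?K"
    then obtain j r j' r' where *: "a = j \<oplus> r \<otimes> x" "b = j' \<oplus> r' \<otimes> x" "j \<in> J" "j' \<in> J"
      "r \<in> carrier R" "r' \<in> carrier R" by blast
    have "a \<oplus> b = (j \<oplus> j') \<oplus> (r \<oplus> r') \<otimes> x" unfolding *
      using Jc[OF *(3)] Jc[OF *(4)] *(5,6) assms(2) by algebra
    then show "a \<oplus> b \<in> ?K" using * idealD(4)[OF assms(1)] by blast
  next
    fix k a assume k: "k \<in> carrier R" and "a \<in> ?K"
    then obtain j r where *: "a = j \<oplus> r \<otimes> x" "j \<in> J" "r \<in> carrier R" by blast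
    have "k \<otimes> a = k \<otimes> j \<oplus> (k \<otimes> r) \<otimes> x" unfolding *
      using Jc[OF *(2)] *(3) assms(2) k by algebra
    then show "k \<otimes> a \<in> ?K" using * J.I_l_closed k by blast
  qed
  then show "ideal ?K R" using ideal_iff_submod by blast
  show "J \<subseteq> ?K"
  proof
    fix j assume "j \<in> J"
    then have "j = j \<oplus> \<zero> \<otimes> x" using assms(2) Jc by simp
    then show "j \<in> ?K" using \<open>j \<in> J\<close> by blast
  qed
  have "x = \<zero> \<oplus> \<one> \<otimes> x" using assms(2) by simp
  then show "x \<in> ?K" using idealD(3)[OF assms(1)] by blast
qed

text \<open>If \<open>a\<close> and \<open>b\<close> lie outside \<open>P\<close>, the larger ideals
  P + Ra and P + Rb meet \<open>N\<close>; the product of the two elements found there is in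
  \<open>N\<close>, and modulo \<open>P\<close> it is a multiple of a b.\<close>

lemma (in cring) exists_primeideal_disjoint:
  assumes "ideal I R" "I \<inter> N = {}" "N \<subseteq> carrier R" "\<one> \<in> N"
    "\<And>x y. x \<in> N \<Longrightarrow> y \<in> N \<Longrightarrow> x \<otimes> y \<in> N"
  obtains P where "primeideal P R" "I \<subseteq> P" "P \<inter> N = {}"
    "\<And>K. ideal K R \<Longrightarrow> P \<subseteq> K \<Longrightarrow> K \<inter> N = {} \<Longrightarrow> K = P"
proof -
  obtain P where P: "ideal P R" "I \<subseteq> P" "P \<inter> N = {}"
    "\<And>K. ideal K R \<Longrightarrow> P \<subseteq> K \<Longrightarrow> K \<inter> N = {} \<Longrightarrow> K = P"
    using exists_ideal_maximal_disjoint[OF assms(1,2)] by blast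
  interpret P: ideal P R by fact
  have "primeideal P R"
  proof (rule primeidealI[OF P(1) is_cring])
    show "carrier R \<noteq> P" using P(3) assms(3,4) by blast
    fix a b assume ab: "a \<in> carrier R" "b \<in> carrier R" "a \<otimes> b \<in> P"
    have meet: "\<exists>j\<in>P. \<exists>r\<in>carrier R. j \<oplus> r \<otimes> x \<in> N" if "x \<in> carrier R" "x \<notin> P" for x
      using P(4)[OF sum_ideal_elem(1)[OF P(1) that(1)] sum_ideal_elem(2)[OF P(1) that(1)]]
        sum_ideal_elem(3)[OF P(1) that(1)] that(2) by blast
    show "a \<in> P \<or> b \<in> P"
    proof (rule ccontr)
      assume "\<not> (a \<in> P \<or> b \<in> P)"
      then obtain j r j' r' where *: "j \<in> P" "r \<in> carrier R" "j \<oplus> r \<otimes> a \<in> N"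
        "j' \<in> P" "r' \<in> carrier R" "j' \<oplus> r' \<otimes> b \<in> N" using meet ab by metis
      have c: "j \<in> carrier R" "j' \<in> carrier R" using * P.a_subset by auto
      have "(j \<oplus> r \<otimes> a) \<otimes> (j' \<oplus> r' \<otimes> b) = (j' \<oplus> r' \<otimes> b) \<otimes> j \<oplus> ((r \<otimes> a) \<otimes> j' \<oplus> (r \<otimes> r') \<otimes> (a \<otimes> b))"
        using c *(2,5) ab by algebra
      also have "\<dots> \<in> P"
        using idealD(4)[OF P(1) idealD(5)[OF P(1), of "j' \<oplus> r' \<otimes> b" j]
            idealD(4)[OF P(1) idealD(5)[OF P(1), of "r \<otimes> a" j'] idealD(5)[OF P(1), of "r \<otimes> r'" "a \<otimes> b"]]]
          *(1,2,4,5) c ab by simp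
      finally show False using * assms(5) P(3) by blast
    qed
  qed
  then show ?thesis using P that by blast
qed

lemma (in cring) exists_maximalideal:
  assumes "ideal I R" "\<one> \<notin> I"
  obtains M where "maximalideal M R" "I \<subseteq> M"
proof -
  obtain J where J: "ideal J R" "I \<subseteq> J" "J \<inter> {\<one>} = {}"
    "\<And>K. ideal K R \<Longrightarrow> J \<subseteq> K \<Longrightarrow> K \<inter> {\<one>} = {} \<Longrightarrow> K = J"
    using exists_ideal_maximal_disjoint[OF assms(1), of "{\<one>}"] assms(2) by auto
  have "maximalideal J R"
  proof (rule maximalidealI[OF J(1)])
    show "carrier R \<noteq> J" using J(3) by auto
    show "\<And>K. ideal K R \<Longrightarrow> J \<subseteq> K \<Longrightarrow> K \<subseteq> carrier R \<Longrightarrow> K = J \<or> K = carrier R"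
      using J(4) ideal.one_imp_carrier by blast
  qed
  then show ?thesis using that J by blast
qed

lemma (in cring) maximalideal_inverse:
  assumes "maximalideal M R" "x \<in> carrier R" "x \<notin> M"
  shows "\<exists>r\<in>carrier R. \<one> \<ominus> r \<otimes> x \<in> M"
proof -
  interpret M: maximalideal M R by fact
  define K where "K = {j \<oplus> r \<otimes> x | j r. j \<in> M \<and> r \<in> carrier R}"
  have K: "ideal K R" "M \<subseteq> K" "x \<in> K"
    unfolding K_def using sum_ideal_elem[OF M.is_ideal assms(2)] .
  have "K = M \<or> K = carrier R" using M.I_maximal[OF K(1,2) idealD(1)[OF K(1)]] .
  then have "K = carrier R" using K(3) assms(3) by metis
  then have "\<one> \<in> K" by simp
  then obtain j r where *: "j \<oplus> r \<otimes> x = \<one>" "j \<in> M" "r \<in> carrier R" unfolding K_def by force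
  have "j \<in> carrier R" using * idealD(2)[OF M.is_ideal] by simp
  then have "(j \<oplus> r \<otimes> x) \<ominus> r \<otimes> x = j" using *(3) assms(2) by algebra
  then have "\<one> \<ominus> r \<otimes> x = j" unfolding *(1) .
  then show ?thesis using * by auto
qed

lemma (in cring) maximalideal_comaximal:
  assumes "maximalideal M R" "ideal I R" "\<not> I \<subseteq> M"
  obtains m where "m \<in> M" "\<one> \<ominus> m \<in> I"
proof -
  interpret M: maximalideal M R by fact
  interpret I: ideal I R by fact
  obtain x where x: "x \<in> I" "x \<notin> M" using assms(3) by blast
  then have xc: "x \<in> carrier R" using I.a_subset by blast
  obtain r where r: "r \<in> carrier R" "\<one> \<ominus> r \<otimes> x \<in> M"
    using maximalideal_inverse[OF assms(1) xc x(2)] by blast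
  have "\<one> \<ominus> (\<one> \<ominus> r \<otimes> x) = r \<otimes> x" using r(1) xc by algebra
  then have "\<one> \<ominus> (\<one> \<ominus> r \<otimes> x) \<in> I" using I.I_l_closed x(1) r(1) by simp
  then show ?thesis using that r(2) by blast
qed

lemma (in cring) maximalideal_subset_eq:
  assumes "maximalideal M R" "maximalideal M' R" "M \<subseteq> M'"
  shows "M = M'"
proof -
  interpret M: maximalideal M R by fact
  interpret M': maximalideal M' R by fact
  show ?thesis using M.I_maximal[OF M'.is_ideal assms(3) M'.a_subset] M'.I_notcarr by blast
qed


section \<open>Maximal subrings\<close>

lemma (in ring) generate_ring_mono:
  assumes "A \<subseteq> B" "B \<subseteq> carrier R"
  shows "generate_ring R A \<subseteq> generate_ring R B"
  using generate_ring_min_subring1[of A "generate_ring R B"] generate_ring_is_subring[OF assms(2)]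
    assms generate_ring.incl[of _ B R] by blast

lemma (in ring) subring_Union_chain:
  assumes "C \<noteq> {}" "subset.chain A C" "\<And>S. S \<in> C \<Longrightarrow> subring S R"
  shows "subring (\<Union>C) R"
proof -
  have two: "\<exists>S\<in>C. x \<in> S \<and> y \<in> S" if "x \<in> \<Union>C" "y \<in> \<Union>C" for x y
    using that assms(2) unfolding pred_on.chain_def by blast
  show ?thesis
  proof (rule subringI)
    show "\<Union>C \<subseteq> carrier R" using subringE(1) assms(3) by blast
    show "\<one> \<in> \<Union>C" using subringE(3) assms(1,3) by blast
    show "\<ominus> h \<in> \<Union>C" if "h \<in> \<Union>C" for h
      using that subringE(5)[OF assms(3)] by auto
    fix h1 h2 assume "h1 \<in> \<Union>C" "h2 \<in> \<Union>C"
    then obtain S where S: "S \<in> C" "h1 \<in> S" "h2 \<in> S" using two by blast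
    show "h1 \<otimes> h2 \<in> \<Union>C" "h1 \<oplus> h2 \<in> \<Union>C"
      using subringE(6,7)[OF assms(3)[OF S(1)] S(2,3)] S(1) by blast+
  qed
qed

text \<open>A subring above \<open>S\<close> is proper exactly when it misses some element of
  \<open>F\<close>. As \<open>F\<close> is finite, this survives unions of chains, and Zorn's lemma
  applies.\<close>

lemma (in ring) exists_maximal_subring:
  assumes S: "subring S R" "S \<noteq> carrier R"
    and F: "finite F" "carrier R = generate_ring R (S \<union> F)"
  obtains M where "maximal_subring M R" "S \<subseteq> M"
proof -
  have Fc: "S \<union> F \<subseteq> carrier R" using F(2) generate_ring.incl[of _ "S \<union> F" R] by blast
  have full: "S' = carrier R" if "subring S' R" "S \<subseteq> S'" "F \<subseteq> S'" for S'
    using generate_ring_min_subring1[OF Fc that(1)] that subringE(1)[OF that(1)] F(2) by blast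
  let ?A = "{S'. subring S' R \<and> S \<subseteq> S' \<and> \<not> F \<subseteq> S'}"
  have "\<exists>M\<in>?A. \<forall>Y\<in>?A. M \<subseteq> Y \<longrightarrow> Y = M"
  proof (rule subset_Zorn_nonempty)
    show "?A \<noteq> {}" using S full by blast
    fix C assume C: "C \<noteq> {}" "subset.chain ?A C"
    then have A: "S' \<in> ?A" if "S' \<in> C" for S' using that unfolding pred_on.chain_def by blast
    have "subring (\<Union>C) R" using subring_Union_chain[OF C] A by blast
    moreover have "\<not> F \<subseteq> \<Union>C"
    proof
      assume "F \<subseteq> \<Union>C"
      from finite_subset_Union_chain[OF F(1) this C] show False using A by blast
    qed
    ultimately show "\<Union>C \<in> ?A" using A C(1) by blast
  qed
  then obtain M where M: "M \<in> ?A" "\<forall>Y\<in>?A. M \<subseteq> Y \<longrightarrow> Y = M" by (rule bexE)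
  have "maximal_subring M R"
    unfolding maximal_subring_def
  proof (intro conjI allI impI)
    show "subring M R" "M \<noteq> carrier R" using M(1) Fc by blast+
    fix S' assume "subring S' R" "S' \<noteq> carrier R" "M \<subseteq> S'"
    moreover have "S' \<in> ?A" using calculation M(1) full[of S'] by auto
    ultimately show "S' = M" using M(2) by simp
  qed
  then show ?thesis using that M(1) by blast
qed

lemma (in ring) maximal_subring_generate:
  assumes "maximal_subring M R" "x \<in> carrier R" "x \<notin> M"
  shows "generate_ring R (insert x M) = carrier R"
proof (rule ccontr)
  have c: "insert x M \<subseteq> carrier R"
    using assms subringE(1) unfolding maximal_subring_def by auto
  assume "generate_ring R (insert x M) \<noteq> carrier R"
  then have "generate_ring R (insert x M) = M"
    using assms(1) generate_ring_is_subring[OF c] generate_ring.incl[of _ "insert x M" R]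
    unfolding maximal_subring_def by blast
  then show False using generate_ring.incl[of x "insert x M" R] assms(3) by simp
qed

lemma (in cring) subring_sum_ideal:
  assumes "subring K R" "ideal I R"
  shows "subring {k \<oplus> i | k i. k \<in> K \<and> i \<in> I} R"
    and "K \<subseteq> {k \<oplus> i | k i. k \<in> K \<and> i \<in> I}" "I \<subseteq> {k \<oplus> i | k i. k \<in> K \<and> i \<in> I}"
proof -
  let ?S = "{k \<oplus> i | k i. k \<in> K \<and> i \<in> I}"
  note K = subringE[OF assms(1)] and I = idealD[OF assms(2)]
  have Kc: "\<And>k. k \<in> K \<Longrightarrow> k \<in> carrier R" using K(1) by blast
  show "K \<subseteq> ?S"
  proof
    fix k assume "k \<in> K"
    then have "k = k \<oplus> \<zero>" using Kc by simp
    then show "k \<in> ?S" using \<open>k \<in> K\<close> I(3) by blast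
  qed
  show "I \<subseteq> ?S"
  proof
    fix i assume "i \<in> I"
    then have "i = \<zero> \<oplus> i" using I(2) by simp
    then show "i \<in> ?S" using \<open>i \<in> I\<close> K(2) by blast
  qed
  show "subring ?S R"
  proof (rule subringI)
    show "?S \<subseteq> carrier R" using Kc I(2) by blast
    show "\<one> \<in> ?S" using \<open>K \<subseteq> ?S\<close> K(3) by blast
  next
    fix h assume "h \<in> ?S"
    then obtain k i where h: "h = k \<oplus> i" "k \<in> K" "i \<in> I" by blast
    have "\<ominus> h = \<ominus> k \<oplus> \<ominus> i" unfolding h(1) using Kc[OF h(2)] I(2)[OF h(3)] by (simp add: minus_add)
    then show "\<ominus> h \<in> ?S" using K(5)[OF h(2)] I(7)[OF h(3)] by blast
  next
    fix h h' assume "h \<in> ?S" "h' \<in> ?S"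
    then obtain k i k' i' where h: "h = k \<oplus> i" "k \<in> K" "i \<in> I" "h' = k' \<oplus> i'" "k' \<in> K" "i' \<in> I" by blast
    note c = Kc[OF h(2)] I(2)[OF h(3)] Kc[OF h(5)] I(2)[OF h(6)]
    have "h \<oplus> h' = (k \<oplus> k') \<oplus> (i \<oplus> i')"
      unfolding h(1,4) using c by algebra
    then show "h \<oplus> h' \<in> ?S" using K(7)[OF h(2,5)] I(4)[OF h(3,6)] by blast
    have "h \<otimes> h' = (k \<otimes> k') \<oplus> (k \<otimes> i' \<oplus> (k' \<oplus> i') \<otimes> i)"
      unfolding h(1,4) using c by algebra
    moreover have "k \<otimes> i' \<oplus> (k' \<oplus> i') \<otimes> i \<in> I"
      using I(4)[OF I(5)[OF c(1) h(6)] I(5)[of "k' \<oplus> i'" i]] h(3) c by simp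
    ultimately show "h \<otimes> h' \<in> ?S" using K(6)[OF h(2,5)] by blast
  qed
qed

lemma (in cring) sum_ideals_full:
  assumes "ideal I R" "ideal J R" "\<And>N. maximalideal N R \<Longrightarrow> \<not> (I \<subseteq> N \<and> J \<subseteq> N)"
  obtains i j where "i \<in> I" "j \<in> J" "i \<oplus> j = \<one>"
proof -
  note I = idealD[OF assms(1)] and J = idealD[OF assms(2)]
  have id: "ideal (I <+>\<^bsub>R\<^esub> J) R" using add_ideals assms(1,2) .
  have IJ: "I \<subseteq> I <+>\<^bsub>R\<^esub> J" "J \<subseteq> I <+>\<^bsub>R\<^esub> J"
  proof -
    show "I \<subseteq> I <+>\<^bsub>R\<^esub> J"
    proof
      fix x assume x: "x \<in> I"
      then have "x = x \<oplus> \<zero>" using I(2) by simp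
      then show "x \<in> I <+>\<^bsub>R\<^esub> J" unfolding set_add_def' using x J(3) by blast
    qed
    show "J \<subseteq> I <+>\<^bsub>R\<^esub> J"
    proof
      fix x assume x: "x \<in> J"
      then have "x = \<zero> \<oplus> x" using J(2) by simp
      then show "x \<in> I <+>\<^bsub>R\<^esub> J" unfolding set_add_def' using x I(3) by blast
    qed
  qed
  have "\<one> \<in> I <+>\<^bsub>R\<^esub> J"
  proof (rule ccontr)
    assume "\<one> \<notin> I <+>\<^bsub>R\<^esub> J"
    then obtain N where "maximalideal N R" "I <+>\<^bsub>R\<^esub> J \<subseteq> N" using exists_maximalideal[OF id] by blast
    then show False using IJ assms(3) by blast
  qed
  then obtain i j where "i \<in> I" "j \<in> J" "\<one> = i \<oplus> j" unfolding set_add_def' by blast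
  then show ?thesis using that by metis
qed

lemma (in cring) maximalideal_contains_Int:
  assumes "maximalideal M R" "maximalideal M' R" "maximalideal N R" "M \<inter> M' \<subseteq> N"
  shows "N = M \<or> N = M'"
proof (rule ccontr)
  assume *: "\<not> (N = M \<or> N = M')"
  have i: "ideal M R" "ideal M' R" using assms(1,2) maximalideal.is_maximalideal maximalideal.axioms(1) by blast+
  have "\<not> M \<subseteq> N" "\<not> M' \<subseteq> N" using * maximalideal_subset_eq assms by blast+
  then obtain x y where xy: "x \<in> M" "x \<notin> N" "y \<in> M'" "y \<notin> N" by blast
  interpret N: primeideal N R using maximalideal_prime assms(3) .
  have "x \<in> carrier R" "y \<in> carrier R" using xy idealD(2) i by blast+
  moreover have "x \<otimes> y \<in> M \<inter> M'" using xy idealD(5,6) i \<open>x \<in> carrier R\<close> \<open>y \<in> carrier R\<close> by blast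
  ultimately show False using N.I_prime[of x y] xy assms(4) by blast
qed

text \<open>If two distinct maximal ideals \<open>M\<close>, \<open>M'\<close> have the same contraction to \<open>K\<close>, then
  \<open>K + M \<inter> M'\<close> is a proper subring; disjoint pairs give comaximal ideals, so no maximal
  subring can serve two of them.\<close>

lemma (in cring) infinite_maximal_subrings:
  assumes K: "subring K R" and F: "finite F" "carrier R = generate_ring R (K \<union> F)"
    and inf: "infinite \<M>" and max: "\<And>M. M \<in> \<M> \<Longrightarrow> maximalideal M R"
    and Q: "\<And>M. M \<in> \<M> \<Longrightarrow> M \<inter> K = Q"
  shows "infinite (maximal_subrings R)"
proof -
  obtain f :: "nat \<Rightarrow> 'a set" where f: "inj f" "range f \<subseteq> \<M>"
    using infinite_countable_subset[OF inf] by blast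
  have fm: "maximalideal (f i) R" for i using f(2) max by blast
  have fi: "ideal (f i) R" for i using fm maximalideal.axioms(1) by blast
  have KFc: "K \<union> F \<subseteq> carrier R" using F(2) generate_ring.incl[of _ "K \<union> F" R] by blast
  have ex: "\<exists>S. maximal_subring S R \<and> f i \<inter> f j \<subseteq> S" if "i \<noteq> j" for i j
  proof -
    have ij: "ideal (f i \<inter> f j) R" using i_intersect fi by blast
    define S where "S = {k \<oplus> m | k m. k \<in> K \<and> m \<in> f i \<inter> f j}"
    have S: "subring S R" "K \<subseteq> S" "f i \<inter> f j \<subseteq> S"
      unfolding S_def using subring_sum_ideal[OF K ij] .
    \<comment> \<open>Otherwise take \<open>m\<close> in \<open>f i\<close> with 1 - m in
      \<open>f j\<close> and write m = k + l. Then \<open>k\<close> is in \<open>f i\<close> and in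
      \<open>K\<close>, hence in the common contraction and in \<open>f j\<close>; so
      \<open>m\<close>, and with it 1, lies in \<open>f j\<close>.\<close>
    have "S \<noteq> carrier R"
    proof
      assume eq: "S = carrier R"
      have "\<not> f j \<subseteq> f i" using maximalideal_subset_eq[OF fm fm, of j i] f(1) that by (auto dest: injD)
      then obtain m where m: "m \<in> f i" "\<one> \<ominus> m \<in> f j"
        using maximalideal_comaximal[OF fm[of i] fi[of j]] by blast
      have "m \<in> S" using eq m(1) idealD(2)[OF fi] by blast
      then obtain k l where kl: "m = k \<oplus> l" "k \<in> K" "l \<in> f i" "l \<in> f j" unfolding S_def by blast
      have c: "k \<in> carrier R" "l \<in> carrier R" "m \<in> carrier R"
        using kl subringE(1)[OF K] idealD(2)[OF fi] m by blast+
      have "k = m \<ominus> l" unfolding kl(1) using c(1,2) by algebra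
      then have "k \<in> f i" using idealD(8)[OF fi m(1) kl(3)] by simp
      then have "k \<in> f j" using Q[of "f i"] Q[of "f j"] f(2) kl(2) by blast
      then have "m \<in> f j" using idealD(4)[OF fi] kl by blast
      then have "(\<one> \<ominus> m) \<oplus> m \<in> f j" using idealD(4)[OF fi m(2)] by blast
      moreover have "(\<one> \<ominus> m) \<oplus> m = \<one>" using c(3) by algebra
      ultimately show False
        using ideal.one_imp_carrier[OF fi[of j]] maximalideal.I_notcarr[OF fm[of j]] by simp
    qed
    moreover have "carrier R = generate_ring R (S \<union> F)"
      using generate_ring_mono[of "K \<union> F" "S \<union> F"] generate_ring_incl[of "S \<union> F"]
        S(2) subringE(1)[OF S(1)] KFc F(2) by auto
    ultimately obtain N where "maximal_subring N R" "S \<subseteq> N"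
      using exists_maximal_subring[OF S(1) _ F(1)] by metis
    then show ?thesis using S(3) by (intro exI[of _ N]) auto
  qed
  \<comment> \<open>The sequence is cut into disjoint pairs, so that different indices give
    comaximal intersections.\<close>
  have "\<forall>i::nat. \<exists>S. maximal_subring S R \<and> f (2 * i) \<inter> f (2 * i + 1) \<subseteq> S"
    using ex by (metis n_not_Suc_n Suc_eq_plus1)
  then obtain g where g: "\<And>i::nat. maximal_subring (g i) R" "\<And>i. f (2 * i) \<inter> f (2 * i + 1) \<subseteq> g i"
    by metis
  have "inj g"
  proof (rule injI, rule ccontr)
    fix a b assume gab: "g a = g b" and ab: "a \<noteq> b"
    have neq: "{2 * a, 2 * a + 1} \<inter> {2 * b, 2 * b + 1} = {}" using ab by auto
    have "\<not> (f (2*a) \<inter> f (2*a+1) \<subseteq> N \<and> f (2*b) \<inter> f (2*b+1) \<subseteq> N)" if N: "maximalideal N R" for N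
    proof
      assume "f (2*a) \<inter> f (2*a+1) \<subseteq> N \<and> f (2*b) \<inter> f (2*b+1) \<subseteq> N"
      then have "N = f (2*a) \<or> N = f (2*a+1)" "N = f (2*b) \<or> N = f (2*b+1)"
        using maximalideal_contains_Int[OF fm fm N] by blast+
      then obtain s t where "s \<in> {2*a,2*a+1}" "t \<in> {2*b,2*b+1}" "f s = f t" by blast
      then show False using f(1) neq by (metis IntI emptyE injD)
    qed
    then obtain i j where ij: "i \<in> f (2*a) \<inter> f (2*a+1)" "j \<in> f (2*b) \<inter> f (2*b+1)" "i \<oplus> j = \<one>"
      using sum_ideals_full[OF i_intersect[OF fi fi] i_intersect[OF fi fi]] by metis
    have g': "subring (g a) R" "g a \<noteq> carrier R" using g(1)[of a] unfolding maximal_subring_def by auto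
    \<comment> \<open>A subring containing both intersections contains x i and x j, hence x = x (i +
      j).\<close>
    have "x \<in> g a" if x: "x \<in> carrier R" for x
    proof -
      have c: "i \<in> carrier R" "j \<in> carrier R" using ij idealD(2)[OF fi] by blast+
      have "x = x \<otimes> i \<oplus> x \<otimes> j" using ij(3) x c by (metis r_distr r_one)
      moreover have "x \<otimes> i \<in> g a"
        using g(2)[of a] idealD(5)[OF fi x] ij(1) by blast
      moreover have "x \<otimes> j \<in> g a"
        using g(2)[of b] idealD(5)[OF fi x] ij(2) gab by blast
      ultimately show ?thesis using subringE(7)[OF g'(1)] by metis
    qed
    then show False using g'(2) subringE(1)[OF g'(1)] by blast
  qed
  then have "infinite (range g)" using finite_imageD infinite_UNIV_nat by blast
  moreover have "range g \<subseteq> maximal_subrings R" using g(1) unfolding maximal_subrings_def by blast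
  ultimately show ?thesis using finite_subset by blast
qed

lemma (in cring) maximalidealI_inverse:
  assumes "ideal M R" "\<one> \<notin> M" "\<And>x. x \<in> carrier R \<Longrightarrow> x \<notin> M \<Longrightarrow> \<exists>r\<in>carrier R. \<one> \<ominus> r \<otimes> x \<in> M"
  shows "maximalideal M R"
proof (rule maximalidealI[OF assms(1)])
  show "carrier R \<noteq> M" using assms(2) by blast
  fix J assume J: "ideal J R" "M \<subseteq> J" "J \<subseteq> carrier R"
  show "J = M \<or> J = carrier R"
  proof (rule disjCI)
    assume "J \<noteq> carrier R"
    show "J = M"
    proof (rule ccontr)
      assume "J \<noteq> M"
      then obtain x where x: "x \<in> J" "x \<notin> M" using J(2) by blast
      have xc: "x \<in> carrier R" using x J(3) by blast
      obtain r where r: "r \<in> carrier R" "\<one> \<ominus> r \<otimes> x \<in> M" using assms(3)[OF xc x(2)] by blast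
      have "(\<one> \<ominus> r \<otimes> x) \<oplus> r \<otimes> x \<in> J"
        using idealD(4)[OF J(1)] idealD(5)[OF J(1) r(1) x(1)] r(2) J(2) by blast
      moreover have "(\<one> \<ominus> r \<otimes> x) \<oplus> r \<otimes> x = \<one>" using r(1) xc by algebra
      ultimately show False using ideal.one_imp_carrier[OF J(1)] \<open>J \<noteq> carrier R\<close> by simp
    qed
  qed
qed

section \<open>Maximal subrings and maximal ideals along surjective homomorphisms\<close>

lemma (in ring_hom_ring) hom_minus: "x \<in> carrier R \<Longrightarrow> y \<in> carrier R \<Longrightarrow> h (x \<ominus>\<^bsub>R\<^esub> y) = h x \<ominus>\<^bsub>S\<^esub> h y"
  by (simp add: R.minus_eq S.minus_eq)

lemma (in ring_hom_ring) vimage_subring: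
  assumes "subring K S" shows "subring {x \<in> carrier R. h x \<in> K} R"
  using subringE[OF assms] by (intro R.subringI) auto

lemma (in ring_hom_ring) vimage_image_subring:
  assumes "subring M R" "{x \<in> carrier R. h x = \<zero>\<^bsub>S\<^esub>} \<subseteq> M"
  shows "{x \<in> carrier R. h x \<in> h ` M} = M"
proof
  show "M \<subseteq> {x \<in> carrier R. h x \<in> h ` M}" using subringE(1)[OF assms(1)] by blast
  show "{x \<in> carrier R. h x \<in> h ` M} \<subseteq> M"
  proof
    fix x assume "x \<in> {x \<in> carrier R. h x \<in> h ` M}"
    then obtain m where m: "x \<in> carrier R" "m \<in> M" "h x = h m" by blast
    have mc: "m \<in> carrier R" using m(2) subringE(1)[OF assms(1)] by blast
    have "h (x \<ominus>\<^bsub>R\<^esub> m) = \<zero>\<^bsub>S\<^esub>" using hom_minus[OF m(1) mc] m(3) mc by (simp add: S.minus_eq S.r_neg)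
    then have "x \<ominus>\<^bsub>R\<^esub> m \<in> M" using assms(2) m(1) mc by blast
    then have "(x \<ominus>\<^bsub>R\<^esub> m) \<oplus>\<^bsub>R\<^esub> m \<in> M" using subringE(7)[OF assms(1)] m(2) by blast
    moreover have "(x \<ominus>\<^bsub>R\<^esub> m) \<oplus>\<^bsub>R\<^esub> m = x" using m(1) mc by (simp add: R.minus_eq R.a_assoc R.l_neg)
    ultimately show "x \<in> M" by simp
  qed
qed

text \<open>A subring containing the kernel is a union of cosets of it, hence the preimage of its
  image; so taking images and preimages preserves maximality.\<close>

lemma (in ring_hom_ring) bij_betw_maximal_subrings:
  assumes surj: "h ` carrier R = carrier S"
  shows "bij_betw (\<lambda>K. {x \<in> carrier R. h x \<in> K}) (maximal_subrings S)
    {M \<in> maximal_subrings R. {x \<in> carrier R. h x = \<zero>\<^bsub>S\<^esub>} \<subseteq> M}"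
proof -
  let ?p = "\<lambda>K. {x \<in> carrier R. h x \<in> K}" and ?k = "{x \<in> carrier R. h x = \<zero>\<^bsub>S\<^esub>}"
  have img: "h ` ?p K = K" if "K \<subseteq> carrier S" for K using surj that by auto
  have sub: "subring (h ` M) S" if "subring M R" for M using img_is_subring[OF that] .
  have ker: "?k \<subseteq> ?p K" if "subring K S" for K using subringE(2)[OF that] by auto
  have "inj_on ?p (maximal_subrings S)"
  proof (rule inj_onI)
    fix K K' assume a: "K \<in> maximal_subrings S" "K' \<in> maximal_subrings S" "?p K = ?p K'"
    then have "subring K S" "subring K' S"
      unfolding maximal_subrings_def maximal_subring_def by simp_all
    then have "K \<subseteq> carrier S" "K' \<subseteq> carrier S"
      using subringE(1)[of K S] subringE(1)[of K' S] by simp_all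
    moreover have "h ` ?p K = h ` ?p K'" by (rule arg_cong[OF a(3)])
    ultimately show "K = K'" by (simp only: img)
  qed
  moreover have "?p ` maximal_subrings S = {M \<in> maximal_subrings R. ?k \<subseteq> M}"
  proof
    show "?p ` maximal_subrings S \<subseteq> {M \<in> maximal_subrings R. ?k \<subseteq> M}"
    proof
      fix M assume "M \<in> ?p ` maximal_subrings S"
      then obtain K where K: "M = ?p K" "subring K S" "K \<noteq> carrier S"
        "\<And>S'. subring S' S \<Longrightarrow> S' \<noteq> carrier S \<Longrightarrow> K \<subseteq> S' \<Longrightarrow> S' = K"
        unfolding maximal_subrings_def maximal_subring_def by blast
      have Kc: "K \<subseteq> carrier S" using subringE(1)[OF K(2)] .
      have "maximal_subring M R" unfolding maximal_subring_def
      proof (intro conjI allI impI)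
        show "subring M R" unfolding K(1) using vimage_subring[OF K(2)] .
        show "M \<noteq> carrier R" using img[OF Kc] surj K(1,3) by metis
        fix S' assume S': "subring S' R" "S' \<noteq> carrier R" "M \<subseteq> S'"
        have p: "?p (h ` S') = S'" using vimage_image_subring[OF S'(1)] S'(3) ker[OF K(2)] K(1) by blast
        have "h ` S' \<noteq> carrier S"
        proof
          assume "h ` S' = carrier S"
          then have "?p (h ` S') = carrier R" by auto
          then show False using p S'(2) by simp
        qed
        moreover have "K \<subseteq> h ` S'" using img[OF Kc] S'(3) K(1) by blast
        ultimately have "h ` S' = K" using K(4) sub[OF S'(1)] by blast
        then show "S' = M" using p K(1) by simp
      qed
      then show "M \<in> {M \<in> maximal_subrings R. ?k \<subseteq> M}"
        using ker[OF K(2)] K(1) unfolding maximal_subrings_def by simp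
    qed
    show "{M \<in> maximal_subrings R. ?k \<subseteq> M} \<subseteq> ?p ` maximal_subrings S"
    proof
      fix M assume "M \<in> {M \<in> maximal_subrings R. ?k \<subseteq> M}"
      then have M: "subring M R" "M \<noteq> carrier R" "?k \<subseteq> M"
        "\<And>S'. subring S' R \<Longrightarrow> S' \<noteq> carrier R \<Longrightarrow> M \<subseteq> S' \<Longrightarrow> S' = M"
        unfolding maximal_subrings_def maximal_subring_def by blast+
      have p: "?p (h ` M) = M" using vimage_image_subring[OF M(1,3)] .
      have "maximal_subring (h ` M) S" unfolding maximal_subring_def
      proof (intro conjI allI impI)
        show "subring (h ` M) S" using sub[OF M(1)] .
        show "h ` M \<noteq> carrier S"
        proof
          assume "h ` M = carrier S"
          then have "?p (h ` M) = carrier R" by auto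
          then show False using p M(2) by simp
        qed
        fix K assume K: "subring K S" "K \<noteq> carrier S" "h ` M \<subseteq> K"
        have i: "h ` ?p K = K" using img subringE(1)[OF K(1)] by blast
        have "?p K \<noteq> carrier R" using i K(2) surj by metis
        moreover have "M \<subseteq> ?p K" using K(3) subringE(1)[OF M(1)] by blast
        ultimately have "?p K = M" using M(4) vimage_subring[OF K(1)] by blast
        then show "K = h ` M" using i by simp
      qed
      then show "M \<in> ?p ` maximal_subrings S" using p unfolding maximal_subrings_def by blast
    qed
  qed
  ultimately show ?thesis unfolding bij_betw_def by blast
qed

lemma (in ring_hom_ring) finite_maximal_subrings_iff:
  assumes "h ` carrier R = carrier S"
  shows "finite (maximal_subrings S) \<longleftrightarrow>
    finite {M \<in> maximal_subrings R. {x \<in> carrier R. h x = \<zero>\<^bsub>S\<^esub>} \<subseteq> M}"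
  using bij_betw_finite[OF bij_betw_maximal_subrings[OF assms]] .

lemma (in ring_hom_cring) vimage_maximalideal:
  assumes surj: "h ` carrier R = carrier S" and N: "maximalideal N S"
  shows "maximalideal {x \<in> carrier R. h x \<in> N} R"
proof -
  have hom_minus: "h (x \<ominus>\<^bsub>R\<^esub> y) = h x \<ominus>\<^bsub>S\<^esub> h y" if "x \<in> carrier R" "y \<in> carrier R" for x y
    using that by (simp add: R.minus_eq S.minus_eq)
  have Ni: "ideal N S" using N maximalideal.axioms(1) by blast
  show ?thesis
  proof (rule R.maximalidealI_inverse)
    show "ideal {x \<in> carrier R. h x \<in> N} R"
      unfolding R.ideal_iff_submod using S.idealD[OF Ni] by (intro submodI) auto
    show "\<one>\<^bsub>R\<^esub> \<notin> {x \<in> carrier R. h x \<in> N}"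
      using ideal.one_imp_carrier[OF Ni] maximalideal.I_notcarr[OF N] by auto
    fix x assume x: "x \<in> carrier R" "x \<notin> {x \<in> carrier R. h x \<in> N}"
    then obtain s where s: "s \<in> carrier S" "\<one>\<^bsub>S\<^esub> \<ominus>\<^bsub>S\<^esub> s \<otimes>\<^bsub>S\<^esub> h x \<in> N"
      using S.maximalideal_inverse[OF N, of "h x"] by auto
    then obtain r where r: "r \<in> carrier R" "s = h r" using surj by blast
    then have "h (\<one>\<^bsub>R\<^esub> \<ominus>\<^bsub>R\<^esub> r \<otimes>\<^bsub>R\<^esub> x) \<in> N" using s x by (simp add: hom_minus)
    then show "\<exists>r\<in>carrier R. \<one>\<^bsub>R\<^esub> \<ominus>\<^bsub>R\<^esub> r \<otimes>\<^bsub>R\<^esub> x \<in> {x \<in> carrier R. h x \<in> N}" using r x by blast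
  qed
qed

text \<open>Finiteness is asked only of the maximal ideals above the kernel, so that this applies to
  a quotient by a prime before \<open>R\<close> itself is known to be semilocal.\<close>

lemma (in ring_hom_cring) semilocal_image:
  assumes surj: "h ` carrier R = carrier S"
    and fin: "finite {M. maximalideal M R \<and> {x \<in> carrier R. h x = \<zero>\<^bsub>S\<^esub>} \<subseteq> M}"
  shows "semilocal S"
proof -
  let ?p = "\<lambda>K. {x \<in> carrier R. h x \<in> K}"
  have "?p ` {N. maximalideal N S} \<subseteq> {M. maximalideal M R \<and> {x \<in> carrier R. h x = \<zero>\<^bsub>S\<^esub>} \<subseteq> M}"
  proof
    fix M assume "M \<in> ?p ` {N. maximalideal N S}"
    then obtain N where N: "maximalideal N S" "M = ?p N" by blast
    have "\<zero>\<^bsub>S\<^esub> \<in> N" using N(1) S.idealD(3) maximalideal.axioms(1) by blast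
    then show "M \<in> {M. maximalideal M R \<and> {x \<in> carrier R. h x = \<zero>\<^bsub>S\<^esub>} \<subseteq> M}"
      using vimage_maximalideal[OF surj N(1)] N(2) by auto
  qed
  moreover have "inj_on ?p {N. maximalideal N S}"
  proof (rule inj_onI)
    fix N N' assume a: "N \<in> {N. maximalideal N S}" "N' \<in> {N. maximalideal N S}" "?p N = ?p N'"
    have img: "h ` ?p K = K" if "K \<in> {N. maximalideal N S}" for K
    proof -
      have "K \<subseteq> carrier S" using that S.idealD(1) maximalideal.axioms(1) by blast
      then show ?thesis using surj by auto
    qed
    show "N = N'" using img[OF a(1)] img[OF a(2)] a(3) by metis
  qed
  ultimately show ?thesis unfolding semilocal_def using finite_imageD finite_subset[OF _ fin] by blast
qed


section \<open>Adjoining an element\<close>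

text \<open>\<open>Span K (pows R x n)\<close> consists of the values at \<open>x\<close> of the
  polynomials of degree below \<open>n\<close> with coefficients in \<open>K\<close>. So
  \<open>x [^] n\<close> in this span says that \<open>x\<close> is integral over the subring
  \<open>K\<close>, and \<open>c \<otimes> x [^] n\<close> in it is an algebraic relation with
  leading coefficient \<open>c\<close>.\<close>

definition pows :: "('a, 'b) ring_scheme \<Rightarrow> 'a \<Rightarrow> nat \<Rightarrow> 'a list" where
  "pows R x n = map (\<lambda>i. x [^]\<^bsub>R\<^esub> i) [0..<n]"

lemma pows_0 [simp]: "pows R x 0 = []"
  and pows_Suc: "pows R x (Suc n) = pows R x n @ [x [^]\<^bsub>R\<^esub> n]"
  by (simp_all add: pows_def)

lemma set_pows: "set (pows R x n) = (\<lambda>i. x [^]\<^bsub>R\<^esub> i) ` {..<n}"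
  by (auto simp: pows_def)

text \<open>Splits off the constant term, where \<open>pows_Suc\<close> splits off the top
  power.\<close>

lemma (in cring) pows_Suc_Cons:
  assumes "x \<in> carrier R"
  shows "pows R x (Suc n) = \<one> # map (\<lambda>e. x \<otimes> e) (pows R x n)"
proof -
  have "[0..<Suc n] = 0 # map Suc [0..<n]"
    by (simp only: upt_conv_Cons[of 0 "Suc n"] map_Suc_upt)
  then show ?thesis using assms
    by (simp add: pows_def comp_def m_comm)
qed

lemma (in cring) pows_carrier: "x \<in> carrier R \<Longrightarrow> set (pows R x n) \<subseteq> carrier R"
  by (auto simp: set_pows)

declare (in ring) Span.simps [simp del]

section \<open>Spans over an arbitrary set of coefficients\<close>

context cring
begin

lemma Span_Nil: "Span K [] = {\<zero>}"
  by (simp add: Span.simps)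

lemma Span_Cons: "Span K (u # us) = {k \<otimes> u \<oplus> y | k y. k \<in> K \<and> y \<in> Span K us}"
proof -
  have "Span K (u # us) = line_extension K u (Span K us)" by (simp add: Span.simps)
  then show ?thesis
    by (intro Set.set_eqI) (simp only: line_extension_mem_iff mem_Collect_eq, blast)
qed

lemma Span_ConsI: "k \<in> K \<Longrightarrow> y \<in> Span K us \<Longrightarrow> k \<otimes> u \<oplus> y \<in> Span K (u # us)"
  unfolding Span_Cons by (intro CollectI exI conjI) auto

lemma Span_ConsE:
  assumes "x \<in> Span K (u # us)"
  obtains k y where "x = k \<otimes> u \<oplus> y" "k \<in> K" "y \<in> Span K us"
  using assms unfolding Span_Cons by auto

lemma Span_min:
  assumes "submod R {} W" "\<And>k u. k \<in> K \<Longrightarrow> u \<in> set us \<Longrightarrow> k \<otimes> u \<in> W"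
  shows "Span K us \<subseteq> W"
  using assms(2)
proof (induction us)
  case Nil
  then show ?case using submodD(2)[OF assms(1)] by (simp add: Span_Nil)
next
  case (Cons u us)
  show ?case
  proof
    fix x assume "x \<in> Span K (u # us)"
    then obtain k y where "x = k \<otimes> u \<oplus> y" "k \<in> K" "y \<in> Span K us" by (rule Span_ConsE)
    then show "x \<in> W" using Cons submodD(3)[OF assms(1)] by auto
  qed
qed

text \<open>The coefficients need not form a ring: for an ideal \<open>I\<close> of
  \<open>S\<close>, \<open>Span I us\<close> is the \<open>S\<close>-module I u_1 + ... + I u_m, as
  needed for Nakayama's lemma.\<close>

lemma submod_Span:
  assumes K: "submod R S K" and S: "S \<subseteq> carrier R" and us: "set us \<subseteq> carrier R"
  shows "submod R S (Span K us)"
  using us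
proof (induction us)
  case Nil
  then show ?case using S by (intro submodI) (auto simp: Span_Nil)
next
  case (Cons u us)
  have IH: "submod R S (Span K us)" and u: "u \<in> carrier R" using Cons by auto
  note K = submodD[OF K] and Y = submodD[OF IH]
  show ?case
  proof (rule submodI)
    show "Span K (u # us) \<subseteq> carrier R"
      using K(5) Y(5) u by (auto elim!: Span_ConsE)
    have "\<zero> \<otimes> u \<oplus> \<zero> \<in> Span K (u # us)" using K(2) Y(2) by (rule Span_ConsI)
    then show "\<zero> \<in> Span K (u # us)" using u by simp
  next
    fix x x' assume "x \<in> Span K (u # us)" "x' \<in> Span K (u # us)"
    then obtain k y k' y' where *: "x = k \<otimes> u \<oplus> y" "k \<in> K" "y \<in> Span K us"
      "x' = k' \<otimes> u \<oplus> y'" "k' \<in> K" "y' \<in> Span K us" by (elim Span_ConsE)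
    have "x \<oplus> x' = (k \<oplus> k') \<otimes> u \<oplus> (y \<oplus> y')" unfolding *(1,4)
      using K(5)[OF *(2)] K(5)[OF *(5)] Y(5)[OF *(3)] Y(5)[OF *(6)] u
      by algebra
    then show "x \<oplus> x' \<in> Span K (u # us)"
      using Span_ConsI K(3)[OF *(2,5)] Y(3)[OF *(3,6)] by simp
  next
    fix s x assume s: "s \<in> S" and "x \<in> Span K (u # us)"
    then obtain k y where *: "x = k \<otimes> u \<oplus> y" "k \<in> K" "y \<in> Span K us" by (elim Span_ConsE)
    have sc: "s \<in> carrier R" using s S by blast
    have "s \<otimes> x = (s \<otimes> k) \<otimes> u \<oplus> s \<otimes> y" unfolding *(1)
      using K(5)[OF *(2)] Y(5)[OF *(3)] u sc by algebra
    then show "s \<otimes> x \<in> Span K (u # us)"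
      using Span_ConsI K(4)[OF s *(2)] Y(4)[OF s *(3)] by simp
  qed
qed

lemma Span_incl:
  assumes "submod R S K" "set us \<subseteq> carrier R" "k \<in> K" "u \<in> set us"
  shows "k \<otimes> u \<in> Span K us"
  using assms(2,4)
proof (induction us)
  case (Cons v us)
  note K = submodD[OF assms(1)]
  have Y: "submod R {} (Span K us)" using submod_Span[of "{}" K us] submod_mono[OF assms(1), of "{}"] Cons by auto
  show ?case
  proof (cases "u \<in> set us")
    case True
    then have "\<zero> \<otimes> v \<oplus> k \<otimes> u \<in> Span K (v # us)" using Cons K(2) by (intro Span_ConsI) auto
    moreover have "v \<in> carrier R" "u \<in> carrier R" "k \<in> carrier R" using Cons.prems True K(5)[OF assms(3)] by auto
    ultimately show ?thesis by simp
  next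
    case False
    then have "u = v" using Cons by simp
    moreover have "k \<otimes> v \<oplus> \<zero> \<in> Span K (v # us)" using assms(3) submodD(2)[OF Y] by (rule Span_ConsI)
    moreover have "v \<in> carrier R" "k \<in> carrier R" using Cons.prems K(5)[OF assms(3)] by auto
    ultimately show ?thesis by simp
  qed
qed simp

lemma submod_self: "subring S R \<Longrightarrow> submod R S S"
  using subringE[of S R] by (intro submodI)

lemma Span_incl_one:
  assumes "subring S R" "set us \<subseteq> carrier R" "u \<in> set us"
  shows "u \<in> Span S us"
  using Span_incl[OF submod_self[OF assms(1)] assms(2) subringE(3)[OF assms(1)] assms(3)] assms(2,3) by auto

lemma Span_mono:
  assumes "submod R S K" "set us' \<subseteq> carrier R" "set us \<subseteq> set us'" "K' \<subseteq> K"
  shows "Span K' us \<subseteq> Span K us'"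
proof (rule Span_min)
  show "submod R {} (Span K us')" using submod_Span[OF submod_mono[OF assms(1), of "{}"] _ assms(2)] by simp
  show "k \<otimes> u \<in> Span K us'" if "k \<in> K'" "u \<in> set us" for k u
    using Span_incl[OF assms(1,2)] assms(3,4) that by blast
qed

lemma submod_vimage_mult:
  assumes "a \<in> carrier R" "submod R {} W"
  shows "submod R {} {y \<in> carrier R. a \<otimes> y \<in> W}"
  using assms submodD[OF assms(2)] by (intro submodI) (auto simp: r_distr)

text \<open>Multiplication by \<open>a\<close> is additive, so membership has to be checked only on
  the terms \<open>k \<otimes> u\<close>.\<close>

lemma Span_mult_image:
  assumes "a \<in> carrier R" "submod R {} W" "K \<subseteq> carrier R" "set us \<subseteq> carrier R"
    "\<And>k u. k \<in> K \<Longrightarrow> u \<in> set us \<Longrightarrow> a \<otimes> (k \<otimes> u) \<in> W" "y \<in> Span K us"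
  shows "a \<otimes> y \<in> W"
proof -
  have "Span K us \<subseteq> {y \<in> carrier R. a \<otimes> y \<in> W}"
    using assms(3-5) by (intro Span_min submod_vimage_mult assms(1,2)) auto
  then show ?thesis using assms(6) by blast
qed

lemma Span_snocE:
  assumes K: "submod R S K" and us: "set us \<subseteq> carrier R" "u \<in> carrier R" and x: "x \<in> Span K (us @ [u])"
  obtains y k where "x = y \<oplus> k \<otimes> u" "y \<in> Span K us" "k \<in> K"
proof -
  have "\<exists>y\<in>Span K us. \<exists>k\<in>K. x = y \<oplus> k \<otimes> u" using us(1) x
  proof (induction us arbitrary: x)
    case Nil
    then obtain k y where "x = k \<otimes> u \<oplus> y" "k \<in> K" "y \<in> Span K []" by (auto elim: Span_ConsE)
    then show ?case using us(2) submodD(5)[OF K] by (intro bexI[of _ y] bexI[of _ k]) (auto simp: Span_Nil)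
  next
    case (Cons v us)
    then obtain k y where *: "x = k \<otimes> v \<oplus> y" "k \<in> K" "y \<in> Span K (us @ [u])" by (auto elim: Span_ConsE)
    obtain y' k' where **: "y' \<in> Span K us" "k' \<in> K" "y = y' \<oplus> k' \<otimes> u" using Cons.IH[OF _ *(3)] Cons.prems by auto
    have "y' \<in> carrier R"
      using submodD(5)[OF submod_Span[OF submod_mono[OF K, of "{}"]]] Cons.prems **(1) by auto
    then have "x = (k \<otimes> v \<oplus> y') \<oplus> k' \<otimes> u" unfolding *(1) **(3)
      using submodD(5)[OF K *(2)] submodD(5)[OF K **(2)] Cons.prems us(2) by (simp add: a_assoc)
    then show ?case using Span_ConsI[OF *(2) **(1)] **(2) by blast
  qed
  then show ?thesis using that by blast
qed

text \<open>An element of a span involves finitely many coefficients, and finitely many members of a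
  chain have a largest one.\<close>

lemma Span_Union_chain:
  assumes "C \<noteq> {}" "subset.chain A C" "\<And>K. K \<in> C \<Longrightarrow> subring K R" "set us \<subseteq> carrier R" "y \<in> Span (\<Union>C) us"
  shows "\<exists>K\<in>C. y \<in> Span K us"
  using assms(4,5)
proof (induction us arbitrary: y)
  case Nil
  then show ?case using assms(1) by (auto simp: Span_Nil)
next
  case (Cons u us)
  from Cons.prems(2) obtain k z where *: "y = k \<otimes> u \<oplus> z" "k \<in> \<Union>C" "z \<in> Span (\<Union>C) us" by (rule Span_ConsE)
  obtain K' where K': "K' \<in> C" "z \<in> Span K' us" using Cons.IH[OF _ *(3)] Cons.prems(1) by auto
  obtain K where "K \<in> C" "k \<in> K" using *(2) by blast
  note K = this K'
  have "K \<subseteq> K' \<or> K' \<subseteq> K" using assms(2) K unfolding pred_on.chain_def by blast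
  then show ?case
  proof
    assume "K \<subseteq> K'"
    then show ?thesis using K *(1) Span_ConsI[of k K' z us u] by blast
  next
    assume "K' \<subseteq> K"
    then have "z \<in> Span K us"
      using Span_mono[OF submod_self[OF assms(3)[OF K(1)]], of us us K'] K Cons.prems by auto
    then show ?thesis using K *(1) Span_ConsI[of k K z us u] by blast
  qed
qed

lemma Span_pows_mono:
  assumes "submod R S K" "x \<in> carrier R" "m \<le> n" "K' \<subseteq> K"
  shows "Span K' (pows R x m) \<subseteq> Span K (pows R x n)"
  using assms pows_carrier by (intro Span_mono) (auto simp: set_pows)

lemma submod_Span_pows:
  assumes "submod R S K" "S \<subseteq> carrier R" "x \<in> carrier R"
  shows "submod R S (Span K (pows R x n))"
  using submod_Span[OF assms(1,2) pows_carrier[OF assms(3)]] .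

lemma Span_pows_mult:
  assumes K: "submod R S K" and x: "x \<in> carrier R" and y: "y \<in> Span K (pows R x n)"
  shows "x [^] m \<otimes> y \<in> Span K (pows R x (m + n))"
proof (rule Span_mult_image[OF _ _ _ pows_carrier[OF x] _ y])
  show "submod R {} (Span K (pows R x (m + n)))"
    using submod_Span_pows[OF submod_mono[OF K, of "{}"] _ x] by simp
  fix k u assume k: "k \<in> K" and "u \<in> set (pows R x n)"
  then obtain i where i: "i < n" "u = x [^] i" by (auto simp: set_pows)
  have "x [^] m \<otimes> (k \<otimes> u) = k \<otimes> x [^] (m + i)"
    using x submodD(5)[OF K k] by (simp add: i(2) nat_pow_mult[symmetric] m_lcomm)
  moreover have "x [^] (m + i) \<in> set (pows R x (m + n))" using i(1) by (auto simp: set_pows)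
  ultimately show "x [^] m \<otimes> (k \<otimes> u) \<in> Span K (pows R x (m + n))"
    using Span_incl[OF K pows_carrier[OF x] k, of "x [^] (m + i)"] by simp
qed (use x submodD(1)[OF K] in auto)

end

text \<open>For a subring \<open>K\<close> this is K[x]; for an ideal \<open>K\<close> of a subring
  \<open>S\<close> it is the extended ideal K S[x].\<close>

definition adj :: "('a, 'b) ring_scheme \<Rightarrow> 'a set \<Rightarrow> 'a \<Rightarrow> 'a set" where
  "adj R K x = (\<Union>n. ring.Span R K (pows R x n))"

section \<open>Polynomial expressions in one element, and Nakayama's lemma\<close>

context cring
begin

lemma adjE:
  assumes "y \<in> adj R K x" obtains n where "y \<in> Span K (pows R x n)"
  using assms unfolding adj_def by blast

lemma adjI: "y \<in> Span K (pows R x n) \<Longrightarrow> y \<in> adj R K x"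
  unfolding adj_def by blast

lemma submod_adj:
  assumes K: "submod R S K" and S: "S \<subseteq> carrier R" and x: "x \<in> carrier R"
  shows "submod R S (adj R K x)"
proof -
  note s = submodD[OF submod_Span_pows[OF K S x]]
  show ?thesis
  proof (rule submodI)
    show "adj R K x \<subseteq> carrier R" using s(5) by (auto elim: adjE)
    show "\<zero> \<in> adj R K x" using s(2) adjI by blast
    show "k \<otimes> y \<in> adj R K x" if "k \<in> S" "y \<in> adj R K x" for k y
      using that s(4) by (auto elim!: adjE intro: adjI)
    fix y z assume "y \<in> adj R K x" "z \<in> adj R K x"
    then obtain m n where "y \<in> Span K (pows R x m)" "z \<in> Span K (pows R x n)" by (auto elim!: adjE)
    then have "y \<in> Span K (pows R x (max m n))" "z \<in> Span K (pows R x (max m n))"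
      using Span_pows_mono[OF K x _ order_refl, of m "max m n"] Span_pows_mono[OF K x _ order_refl, of n "max m n"] by auto
    then show "y \<oplus> z \<in> adj R K x" using s(3) adjI by blast
  qed
qed

lemma adj_monom:
  assumes "submod R S K" "x \<in> carrier R" "k \<in> K" shows "k \<otimes> x [^] (n::nat) \<in> adj R K x"
  by (rule adjI[of _ _ _ "Suc n"], rule Span_incl[OF assms(1) pows_carrier[OF assms(2)] assms(3)])
    (auto simp: set_pows)

lemma adj_min:
  assumes "submod R {} W" "\<And>k n. k \<in> K \<Longrightarrow> k \<otimes> x [^] (n::nat) \<in> W"
  shows "adj R K x \<subseteq> W"
proof
  fix y assume "y \<in> adj R K x"
  then obtain n where "y \<in> Span K (pows R x n)" by (rule adjE)
  moreover have "Span K (pows R x n) \<subseteq> W" using assms(2) by (intro Span_min assms(1)) (auto simp: set_pows)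
  ultimately show "y \<in> W" by blast
qed

text \<open>With \<open>K = S\<close> this makes \<open>adj R S x\<close> a ring; with an ideal
  \<open>K\<close> of \<open>S\<close> it makes \<open>adj R K x\<close> an ideal of that
  ring.\<close>

lemma adj_mult:
  assumes K: "submod R S K" and S: "subring S R" and x: "x \<in> carrier R"
    and y: "y \<in> adj R S x" and z: "z \<in> adj R K x"
  shows "y \<otimes> z \<in> adj R K x"
proof -
  have Sc: "S \<subseteq> carrier R" using subringE(1)[OF S] .
  have A: "submod R {} (adj R K x)" using submod_mono[OF submod_adj[OF K Sc x]] by simp
  have zc: "z \<in> carrier R" and yc: "y \<in> carrier R"
    using submodD(5)[OF submod_adj[OF K Sc x] z] submodD(5)[OF submod_adj[OF submod_self[OF S] Sc x] y] by auto
  have 1: "(s \<otimes> x [^] i) \<otimes> z \<in> adj R K x" if s: "s \<in> S" for s and i :: nat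
  proof -
    have sc: "s \<in> carrier R" using s Sc by blast
    have "adj R K x \<subseteq> {z \<in> carrier R. (s \<otimes> x [^] i) \<otimes> z \<in> adj R K x}"
    proof (rule adj_min[OF submod_vimage_mult[OF _ A]])
      show "s \<otimes> x [^] i \<in> carrier R" using sc x by simp
      fix k and n :: nat assume k: "k \<in> K"
      have kc: "k \<in> carrier R" using submodD(5)[OF K k] .
      have "(s \<otimes> x [^] i) \<otimes> (k \<otimes> x [^] n) = (s \<otimes> k) \<otimes> (x [^] i \<otimes> x [^] n)"
        using sc x kc by (simp add: m_ac)
      then have "(s \<otimes> x [^] i) \<otimes> (k \<otimes> x [^] n) = (s \<otimes> k) \<otimes> x [^] (i + n)" using x by (simp add: nat_pow_mult)
      then show "k \<otimes> x [^] n \<in> {z \<in> carrier R. (s \<otimes> x [^] i) \<otimes> z \<in> adj R K x}"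
        using adj_monom[OF K x submodD(4)[OF K s k]] kc x by simp
    qed
    then show ?thesis using z by blast
  qed
  have "adj R S x \<subseteq> {y \<in> carrier R. z \<otimes> y \<in> adj R K x}"
  proof (rule adj_min[OF submod_vimage_mult[OF zc A]])
    fix s and n :: nat assume s: "s \<in> S"
    then have "s \<otimes> x [^] n \<in> carrier R" using Sc x by auto
    then show "s \<otimes> x [^] n \<in> {y \<in> carrier R. z \<otimes> y \<in> adj R K x}" using 1[OF s, of n] m_comm zc by simp
  qed
  then show ?thesis using y m_comm[OF yc zc] by auto
qed

lemma adj_incl:
  assumes "submod R S K" "x \<in> carrier R" shows "K \<subseteq> adj R K x"
proof
  fix k assume "k \<in> K"
  then show "k \<in> adj R K x" using adj_monom[OF assms, of k 0] submodD(5)[OF assms(1)] by simp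
qed

lemma subring_adj:
  assumes S: "subring S R" and x: "x \<in> carrier R"
  shows "subring (adj R S x) R" "S \<subseteq> adj R S x" "x \<in> adj R S x"
proof -
  have Sc: "S \<subseteq> carrier R" using subringE(1)[OF S] .
  note M = submod_adj[OF submod_self[OF S] Sc x]
  show i: "S \<subseteq> adj R S x" using adj_incl[OF submod_self[OF S] x] .
  show "x \<in> adj R S x" using adj_monom[OF submod_self[OF S] x subringE(3)[OF S], of 1] x by simp
  show "subring (adj R S x) R"
    using i subringE(3)[OF S] submodD[OF M] submod_uminus[OF S M] adj_mult[OF submod_self[OF S] S x]
    by (intro subringI) auto
qed

lemma nat_pow_in_subring:
  assumes "subring S R" "x \<in> S" shows "x [^] (n::nat) \<in> S"
  using subringE(3,6)[OF assms(1)] assms(2) by (induction n) auto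

lemma adj_least:
  assumes "subring B R" "S \<subseteq> B" "x \<in> B" shows "adj R S x \<subseteq> B"
proof (rule adj_min)
  show "submod R {} B" using submod_mono[OF submod_self[OF assms(1)]] by simp
  show "k \<otimes> x [^] (n::nat) \<in> B" if "k \<in> S" for k n
    using subringE(6)[OF assms(1)] nat_pow_in_subring[OF assms(1,3)] that assms(2) by blast
qed

lemma adj_eq_generate_ring:
  assumes "subring S R" "x \<in> carrier R"
  shows "adj R S x = generate_ring R (insert x S)"
proof (rule generate_ringI)
  show "insert x S \<subseteq> carrier R" using assms subringE(1) by blast
  show "subring (adj R S x) R" "insert x S \<subseteq> adj R S x" using subring_adj[OF assms] by auto
  show "\<And>K. subring K R \<Longrightarrow> insert x S \<subseteq> K \<Longrightarrow> adj R S x \<subseteq> K" using adj_least by blast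
qed

text \<open>Nakayama's lemma, by elimination of one generator at a time; \<open>N\<close> plays the role of
  \<open>1 + I\<close>.\<close>

lemma nakayama_kill:
  assumes S: "subring S R" and I: "submod R S I" "I \<subseteq> S"
    and N: "N \<subseteq> S" "\<And>s t. s \<in> N \<Longrightarrow> t \<in> N \<Longrightarrow> s \<otimes> t \<in> N" "\<And>s p. s \<in> N \<Longrightarrow> p \<in> I \<Longrightarrow> s \<ominus> p \<in> N"
    and t: "t \<in> N" and es: "set es \<subseteq> carrier R" "\<And>e. e \<in> set es \<Longrightarrow> t \<otimes> e \<in> Span I es"
  shows "\<exists>s\<in>N. \<forall>e\<in>set es. s \<otimes> e = \<zero>"
  using t es
proof (induction es arbitrary: t)
  case Nil
  then show ?case by auto
next
  case (Cons e es)
  have Sc: "S \<subseteq> carrier R" using subringE(1)[OF S] .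
  have c: "e \<in> carrier R" "set es \<subseteq> carrier R" "t \<in> carrier R" using Cons.prems N(1) Sc by auto
  have sp: "submod R S (Span I es)" using submod_Span[OF I(1) Sc c(2)] .
  have "t \<otimes> e \<in> Span I (e # es)" using Cons.prems by simp
  then obtain p y where py: "t \<otimes> e = p \<otimes> e \<oplus> y" "p \<in> I" "y \<in> Span I es" by (rule Span_ConsE)
  have pc: "p \<in> carrier R" "y \<in> carrier R" using submodD(5)[OF I(1) py(2)] submodD(5)[OF sp py(3)] by auto
  \<comment> \<open>Moving \<open>p \<otimes> e\<close> to the left gives
    \<open>t1 \<otimes> e = y\<close>, an expression in the other generators, so multiplication by
    \<open>t1\<close> removes \<open>e\<close> from the remaining relations.\<close>
  define t1 where "t1 = t \<ominus> p"
  have t1: "t1 \<in> N" "t1 \<in> carrier R" using N(3)[OF Cons.prems(1) py(2)] N(1) Sc unfolding t1_def by auto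
  have "t1 \<otimes> e = t \<otimes> e \<ominus> p \<otimes> e" unfolding t1_def using c pc by algebra
  also have "\<dots> = y" unfolding py(1) using c pc by algebra
  finally have t1e: "t1 \<otimes> e = y" .
  have "(t1 \<otimes> t) \<otimes> e' \<in> Span I es" if e': "e' \<in> set es" for e'
  proof -
    have "t \<otimes> e' \<in> Span I (e # es)" using Cons.prems e' by simp
    then obtain q z where qz: "t \<otimes> e' = q \<otimes> e \<oplus> z" "q \<in> I" "z \<in> Span I es" by (rule Span_ConsE)
    have qc: "q \<in> carrier R" "z \<in> carrier R" "e' \<in> carrier R"
      using submodD(5)[OF I(1) qz(2)] submodD(5)[OF sp qz(3)] c(2) e' by auto
    have "(t1 \<otimes> t) \<otimes> e' = t1 \<otimes> (q \<otimes> e \<oplus> z)" using t1 c qc qz(1) by (simp add: m_assoc)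
    also have "\<dots> = q \<otimes> (t1 \<otimes> e) \<oplus> t1 \<otimes> z" using t1 c qc by algebra
    also have "\<dots> = q \<otimes> y \<oplus> t1 \<otimes> z" using t1e by simp
    also have "\<dots> \<in> Span I es"
      using submodD(3,4)[OF sp] qz py I(2) t1 N(1) by blast
    finally show ?thesis .
  qed
  then obtain s where s: "s \<in> N" "\<forall>e\<in>set es. s \<otimes> e = \<zero>"
    using Cons.IH[OF N(2)[OF t1(1) Cons.prems(1)] c(2)] by blast
  have sc: "s \<in> carrier R" using s(1) N(1) Sc by blast
  \<comment> \<open>\<open>s\<close> kills the other generators, hence their combination
    \<open>y = t1 \<otimes> e\<close>; so \<open>s \<otimes> t1\<close> kills all
    generators.\<close>
  have "s \<otimes> y \<in> {\<zero>}"
  proof (rule Span_mult_image[OF sc _ _ c(2) _ py(3)])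
    show "submod R {} {\<zero>}" by (intro submodI) auto
    show "I \<subseteq> carrier R" using submodD(1)[OF I(1)] .
    fix k u assume "k \<in> I" "u \<in> set es"
    then have "k \<in> carrier R" "u \<in> carrier R" "s \<otimes> u = \<zero>" using submodD(5)[OF I(1)] c(2) s(2) by auto
    then show "s \<otimes> (k \<otimes> u) \<in> {\<zero>}" using m_lcomm[of s k u] sc by simp
  qed
  then have "(s \<otimes> t1) \<otimes> e = \<zero>" using t1e sc t1 c by (simp add: m_assoc)
  moreover have "(s \<otimes> t1) \<otimes> e' = \<zero>" if "e' \<in> set es" for e'
    using s(2) that sc t1(2) c(2) m_comm[of s t1] by (metis m_assoc r_null subsetD)
  ultimately show ?case using N(2)[OF s(1) t1(1)] by (intro bexI[of _ "s \<otimes> t1"]) auto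
qed

end


section \<open>Dominating pairs\<close>

text \<open>The pairs of Chevalley's extension theorem, a subring with an ideal of it. The set
  \<open>N\<close> holds the elements to be kept out of the ideal; disjointness from
  \<open>N\<close> takes the place of localising at a prime.\<close>

definition dominating_pair ::
  "('a, 'b) ring_scheme \<Rightarrow> 'a set \<Rightarrow> 'a set \<Rightarrow> 'a set \<Rightarrow> 'a set \<Rightarrow> 'a set \<Rightarrow> bool" where
  "dominating_pair R D I\<^sub>0 N S I \<longleftrightarrow>
     subring S R \<and> D \<subseteq> S \<and> submod R S I \<and> I \<subseteq> S \<and> I\<^sub>0 \<subseteq> I \<and> I \<inter> N = {}"

text \<open>Pairs \<open>(S, I)\<close> are coded as subsets of \<open>bool \<times> 'a\<close> in order to use Zorn's lemma for set
  inclusion.\<close>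

lemma (in cring) exists_maximal_pair:
  assumes "dominating_pair R D I\<^sub>0 N D I\<^sub>0"
  obtains S I where "dominating_pair R D I\<^sub>0 N S I"
    "\<And>S' I'. dominating_pair R D I\<^sub>0 N S' I' \<Longrightarrow> S \<subseteq> S' \<Longrightarrow> I \<subseteq> I' \<Longrightarrow> S' = S"
proof -
  let ?A = "{Z. dominating_pair R D I\<^sub>0 N (Z `` {True}) (Z `` {False})}"
  have code: "({True} \<times> S \<union> {False} \<times> I) `` {True} = S" "({True} \<times> S \<union> {False} \<times> I) `` {False} = I"
    for S I :: "'a set" by auto
  have "\<exists>M\<in>?A. \<forall>Y\<in>?A. M \<subseteq> Y \<longrightarrow> Y = M"
  proof (rule subset_Zorn_nonempty)
    have "{True} \<times> D \<union> {False} \<times> I\<^sub>0 \<in> ?A" using assms by (simp add: code)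
    then show "?A \<noteq> {}" by blast
    fix C assume C: "C \<noteq> {}" "subset.chain ?A C"
    have dp: "dominating_pair R D I\<^sub>0 N (Z `` {True}) (Z `` {False})" if "Z \<in> C" for Z
      using that C(2) unfolding pred_on.chain_def by auto
    have two: "\<exists>Z\<in>C. p \<in> Z \<and> q \<in> Z" if "p \<in> \<Union>C" "q \<in> \<Union>C" for p q
      using that C(2) unfolding pred_on.chain_def by blast
    have Im: "\<Union>C `` {b} = \<Union>((\<lambda>Z. Z `` {b}) ` C)" for b by auto
    have "subring (\<Union>C `` {True}) R"
      unfolding Im
    proof (rule subring_Union_chain)
      show "(\<lambda>Z. Z `` {True}) ` C \<noteq> {}" using C(1) by blast
      show "subset.chain UNIV ((\<lambda>Z. Z `` {True}) ` C)"
        using C(2) unfolding pred_on.chain_def by blast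
      show "subring S R" if "S \<in> (\<lambda>Z. Z `` {True}) ` C" for S
        using that dp unfolding dominating_pair_def by auto
    qed
    moreover have "submod R (\<Union>C `` {True}) (\<Union>C `` {False})"
    proof (rule submodI)
      have sm: "submod R (Z `` {True}) (Z `` {False})" if "Z \<in> C" for Z
        using dp[OF that] unfolding dominating_pair_def by simp
      show "\<Union>C `` {False} \<subseteq> carrier R" using submodD(1)[OF sm] by auto
      obtain Z where "Z \<in> C" using C(1) by auto
      then show "\<zero>\<^bsub>R\<^esub> \<in> \<Union>C `` {False}" using submodD(2)[OF sm] by auto
      fix x assume x: "x \<in> \<Union>C `` {False}"
      show "x \<oplus> y \<in> \<Union>C `` {False}" if y: "y \<in> \<Union>C `` {False}" for y
      proof -
        obtain Z where "Z \<in> C" "(False, x) \<in> Z" "(False, y) \<in> Z" using two[of "(False, x)" "(False, y)"] x y by auto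
        then show ?thesis using submodD(3)[OF sm, of Z x y] by auto
      qed
      show "k \<otimes> x \<in> \<Union>C `` {False}" if k: "k \<in> \<Union>C `` {True}" for k
      proof -
        obtain Z where "Z \<in> C" "(False, x) \<in> Z" "(True, k) \<in> Z" using two[of "(False, x)" "(True, k)"] x k by auto
        then show ?thesis using submodD(4)[OF sm, of Z k x] by auto
      qed
    qed
    moreover obtain Z where "Z \<in> C" using C(1) by auto
    then have "D \<subseteq> \<Union>C `` {True}" "I\<^sub>0 \<subseteq> \<Union>C `` {False}"
      using dp[of Z] unfolding dominating_pair_def by blast+
    moreover have "\<Union>C `` {False} \<subseteq> \<Union>C `` {True}" "\<Union>C `` {False} \<inter> N = {}"
      using dp unfolding dominating_pair_def by blast+
    ultimately show "\<Union>C \<in> ?A" unfolding dominating_pair_def by simp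
  qed
  then obtain Z where Z: "Z \<in> ?A" "\<forall>Y\<in>?A. Z \<subseteq> Y \<longrightarrow> Y = Z" by (rule bexE)
  show ?thesis
  proof (rule that)
    show "dominating_pair R D I\<^sub>0 N (Z `` {True}) (Z `` {False})" using Z(1) by simp
    fix S' I' assume *: "dominating_pair R D I\<^sub>0 N S' I'" "Z `` {True} \<subseteq> S'" "Z `` {False} \<subseteq> I'"
    let ?Y = "{True} \<times> S' \<union> {False} \<times> I'"
    have "?Y \<in> ?A" using *(1) by (simp add: code)
    moreover have "Z \<subseteq> ?Y"
    proof
      fix z assume "z \<in> Z"
      moreover obtain b x where "z = (b, x)" by (cases z)
      ultimately show "z \<in> ?Y" using *(2,3) by (cases b) auto
    qed
    ultimately have "?Y = Z" using Z(2) by simp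
    then show "S' = Z `` {True}" using code(1)[of S' I'] by simp
  qed
qed

text \<open>The key property of a maximal pair: an element integral over the localisation of \<open>S\<close> at
  \<open>N + I\<close> lies in \<open>S\<close>, since adjoining it would give a larger pair.\<close>

lemma (in cring) maximal_pair_closed:
  assumes pair: "dominating_pair R D I\<^sub>0 N S I"
    and max: "\<And>S' I'. dominating_pair R D I\<^sub>0 N S' I' \<Longrightarrow> S \<subseteq> S' \<Longrightarrow> I \<subseteq> I' \<Longrightarrow> S' = S"
    and N: "N \<subseteq> D" "\<one> \<in> N" "\<And>s t. s \<in> N \<Longrightarrow> t \<in> N \<Longrightarrow> s \<otimes> t \<in> N"
    and a: "a \<in> carrier R" and c: "c \<in> N" "c \<otimes> a [^] (n::nat) \<in> Span S (pows R a n)"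
  shows "a \<in> S"
proof -
  have S: "subring S R" "D \<subseteq> S" and I: "submod R S I" "I \<subseteq> S" "I\<^sub>0 \<subseteq> I" "I \<inter> N = {}"
    using pair unfolding dominating_pair_def by auto
  have Sc: "S \<subseteq> carrier R" using subringE(1)[OF S(1)] .
  \<comment> \<open>N + I is closed under products and under subtracting elements of
    \<open>I\<close>, and misses zero because \<open>I\<close> misses \<open>N\<close>: it is the
    set that \<open>nakayama_kill\<close> asks for.\<close>
  define N' where "N' = {s \<oplus> p | s p. s \<in> N \<and> p \<in> I}"
  have Nc: "s \<in> carrier R" if "s \<in> N" for s using that N(1) S(2) Sc by blast
  have Ic: "p \<in> carrier R" if "p \<in> I" for p using submodD(5)[OF I(1) that] .
  have N'I: "N \<subseteq> N'"
  proof
    fix s assume s: "s \<in> N"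
    then have "s = s \<oplus> \<zero>" using Nc by simp
    then show "s \<in> N'" unfolding N'_def using s submodD(2)[OF I(1)] by blast
  qed
  have N'S: "N' \<subseteq> S" unfolding N'_def using N(1) S(2) I(2) subringE(7)[OF S(1)] by blast
  have N'mult: "s \<otimes> t \<in> N'" if st: "s \<in> N'" "t \<in> N'" for s t
  proof -
    obtain x p where 1: "s = x \<oplus> p" "x \<in> N" "p \<in> I" using st(1) unfolding N'_def by blast
    obtain y q where 2: "t = y \<oplus> q" "y \<in> N" "q \<in> I" using st(2) unfolding N'_def by blast
    note * = 1 2
    have "s \<otimes> t = x \<otimes> y \<oplus> (x \<otimes> q \<oplus> (y \<oplus> q) \<otimes> p)" unfolding *(1,4)
      using Nc[OF *(2)] Nc[OF *(5)] Ic[OF *(3)] Ic[OF *(6)] by algebra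
    moreover have "x \<otimes> q \<oplus> (y \<oplus> q) \<otimes> p \<in> I"
    proof (rule submodD(3)[OF I(1)])
      show "x \<otimes> q \<in> I" using submodD(4)[OF I(1) _ *(6)] *(2) N(1) S(2) by blast
      have "y \<oplus> q \<in> S" using st(2) N'S *(4) by blast
      then show "(y \<oplus> q) \<otimes> p \<in> I" using submodD(4)[OF I(1) _ *(3)] by blast
    qed
    ultimately show ?thesis unfolding N'_def using N(3)[OF *(2,5)] by blast
  qed
  have N'minus: "s \<ominus> p \<in> N'" if sp: "s \<in> N'" "p \<in> I" for s p
  proof -
    obtain x q where *: "s = x \<oplus> q" "x \<in> N" "q \<in> I" using sp(1) unfolding N'_def by blast
    have "s \<ominus> p = x \<oplus> (q \<ominus> p)" unfolding *(1)
      using Nc[OF *(2)] Ic[OF *(3)] Ic[OF sp(2)] by algebra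
    then show ?thesis unfolding N'_def using submod_minus[OF S(1) I(1) *(3) sp(2)] *(2) by blast
  qed
  have N'0: "\<zero> \<notin> N'"
  proof
    assume "\<zero> \<in> N'"
    then obtain x p where *: "\<zero> = x \<oplus> p" "x \<in> N" "p \<in> I" unfolding N'_def by blast
    have "x = \<ominus> p" using sum_zero_eq_neg[OF Nc[OF *(2)] Ic[OF *(3)]] *(1) by simp
    then show False using submod_uminus[OF S(1) I(1) *(3)] *(2) I(4) by blast
  qed
  have cS: "c \<in> S" and cc: "c \<in> carrier R" using c(1) N(1) S(2) Sc by blast+
  have "n \<noteq> 0"
  proof
    assume "n = 0"
    then have "c = \<zero>" using c(2) cc by (simp add: Span_Nil)
    then show False using N'0 N'I c(1) by blast
  qed
  let ?es = "pows R a n"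
  let ?U = "Span I ?es"
  have esc: "set ?es \<subseteq> carrier R" using pows_carrier[OF a] .
  have U: "submod R S ?U" using submod_Span[OF I(1) Sc esc] .
  have U0: "submod R {} ?U" using submod_mono[OF U] by simp
  have IV: "p \<otimes> y \<in> ?U" if p: "p \<in> I" and y: "y \<in> Span S ?es" for p y
  proof (rule Span_mult_image[OF Ic[OF p] U0 Sc esc _ y])
    fix k u assume k: "k \<in> S" and u: "u \<in> set ?es"
    have "p \<otimes> (k \<otimes> u) = (k \<otimes> p) \<otimes> u"
    proof -
      have "p \<in> carrier R" "k \<in> carrier R" "u \<in> carrier R" using Ic[OF p] k Sc u esc by auto
      then show ?thesis by (simp add: m_ac)
    qed
    then show "p \<otimes> (k \<otimes> u) \<in> ?U" using Span_incl[OF I(1) esc submodD(4)[OF I(1) k p] u] by simp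
  qed
  \<comment> \<open>\<open>c \<otimes> a\<close> maps \<open>?U\<close> into itself: it raises the
    exponent of \<open>a\<close> by one, and the given relation rewrites
    \<open>c \<otimes> a [^] n\<close> in lower powers.\<close>
  have step: "(c \<otimes> a) \<otimes> y \<in> ?U" if y: "y \<in> ?U" for y
  proof (rule Span_mult_image[OF _ U0 submodD(1)[OF I(1)] esc _ y])
    show "c \<otimes> a \<in> carrier R" using cc a by simp
    fix p u assume p: "p \<in> I" and "u \<in> set ?es"
    then obtain i where i: "i < n" "u = a [^] i" by (auto simp: set_pows)
    have eq: "(c \<otimes> a) \<otimes> (p \<otimes> u) = p \<otimes> (c \<otimes> a [^] Suc i)"
      using cc a Ic[OF p] i(2) by (simp add: m_ac)
    show "(c \<otimes> a) \<otimes> (p \<otimes> u) \<in> ?U"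
    proof (cases "Suc i < n")
      case True
      then have "a [^] Suc i \<in> set ?es" unfolding set_pows by blast
      then have "c \<otimes> a [^] Suc i \<in> Span S ?es" using Span_incl[OF submod_self[OF S(1)] esc cS] by blast
      then show ?thesis using IV[OF p] eq by simp
    next
      case False
      then have "Suc i = n" using i(1) by simp
      then show ?thesis using IV[OF p c(2)] eq by simp
    qed
  qed
  have steps: "(c \<otimes> a) [^] (j::nat) \<otimes> y \<in> ?U" if y: "y \<in> ?U" for j y
  proof (induction j)
    case 0
    then show ?case using y submodD(5)[OF U y] by simp
  next
    case (Suc j)
    have "(c \<otimes> a) [^] Suc j \<otimes> y = (c \<otimes> a) \<otimes> ((c \<otimes> a) [^] j \<otimes> y)"
      using cc a submodD(5)[OF U y] by (simp add: m_ac)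
    then show ?case using step[OF Suc] by simp
  qed
  have cpow: "c [^] (j::nat) \<in> N" for j using N(2,3) c(1) by (induction j) auto
  \<comment> \<open>The elements that some power of \<open>c\<close> brings into \<open>?U\<close>.
    All of I[a] is of this kind, since \<open>c [^] j \<otimes> (p \<otimes> a [^] j) = (c \<otimes>
    a) [^] j \<otimes> p\<close>.\<close>
  define W where "W = {y \<in> carrier R. \<exists>k::nat. c [^] k \<otimes> y \<in> ?U}"
  have up: "c [^] (k + j :: nat) \<otimes> y \<in> ?U" if "c [^] (k::nat) \<otimes> y \<in> ?U" "y \<in> carrier R" for k j y
  proof -
    have "c [^] (k + j) \<otimes> y = c [^] j \<otimes> (c [^] k \<otimes> y)"
      using cc that(2) by (simp add: nat_pow_mult[symmetric] m_ac)
    then show ?thesis using submodD(4)[OF U _ that(1)] cpow[of j] N(1) S(2) by auto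
  qed
  have adjW: "adj R I a \<subseteq> W"
  proof (rule adj_min)
    show "submod R {} W"
    proof (rule submodI)
      show "W \<subseteq> carrier R" unfolding W_def by blast
      show "\<zero> \<in> W" unfolding W_def using submodD(2)[OF U] by (auto intro!: exI[of _ 0])
      fix y z assume "y \<in> W" "z \<in> W"
      then obtain k l where *: "y \<in> carrier R" "c [^] (k::nat) \<otimes> y \<in> ?U" "z \<in> carrier R" "c [^] (l::nat) \<otimes> z \<in> ?U"
        unfolding W_def by blast
      have "c [^] (k + l) \<otimes> y \<in> ?U" "c [^] (l + k) \<otimes> z \<in> ?U" using up * by auto
      then have "c [^] (k + l) \<otimes> (y \<oplus> z) \<in> ?U"
        using submodD(3)[OF U, of "c [^] (k + l) \<otimes> y" "c [^] (k + l) \<otimes> z"] * cc by (simp add: r_distr add.commute)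
      then show "y \<oplus> z \<in> W" unfolding W_def using * by auto
    qed simp
    fix p and j :: nat assume p: "p \<in> I"
    have "a [^] (0::nat) \<in> set ?es" using \<open>n \<noteq> 0\<close> unfolding set_pows by blast
    then have "p \<in> ?U" using Span_incl[OF I(1) esc p, of \<one>] Ic[OF p] by simp
    then have "(c \<otimes> a) [^] j \<otimes> p \<in> ?U" by (rule steps)
    moreover have "(c \<otimes> a) [^] j \<otimes> p = c [^] j \<otimes> (p \<otimes> a [^] j)"
      using cc a Ic[OF p] by (simp add: nat_pow_distrib m_ac)
    ultimately show "p \<otimes> a [^] j \<in> W" unfolding W_def using Ic[OF p] a by auto
  qed
  \<comment> \<open>For \<open>t\<close> in both sets, some \<open>c [^] k \<otimes> t\<close>
    multiplies all of 1, a, ..., a^(n-1) into \<open>?U\<close>. Nakayama's lemma then yields an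
    element of \<open>N'\<close> that kills 1, so zero would lie in \<open>N'\<close>.\<close>
  have disj: "adj R I a \<inter> N = {}"
  proof (rule ccontr)
    assume "adj R I a \<inter> N \<noteq> {}"
    then obtain t where t: "t \<in> adj R I a" "t \<in> N" by blast
    have "\<exists>k::nat. c [^] k \<otimes> (t \<otimes> e) \<in> ?U" if e: "e \<in> set ?es" for e
    proof -
      have ec: "e \<in> carrier R" using e esc by blast
      have "e \<in> adj R S a" using adjI[OF Span_incl_one[OF S(1) esc e]] .
      then have "e \<otimes> t \<in> adj R I a" using adj_mult[OF I(1) S(1) a _ t(1)] by blast
      then have "t \<otimes> e \<in> W" using adjW m_comm[OF ec Nc[OF t(2)]] by auto
      then show ?thesis unfolding W_def by blast
    qed
    then have "\<forall>e\<in>set ?es. \<exists>k::nat. c [^] k \<otimes> (t \<otimes> e) \<in> ?U" by blast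
    then obtain f where f: "\<And>e. e \<in> set ?es \<Longrightarrow> c [^] (f e :: nat) \<otimes> (t \<otimes> e) \<in> ?U"
      unfolding bchoice_iff by blast
    define k where "k = sum f (set ?es)"
    have "(c [^] k \<otimes> t) \<otimes> e \<in> ?U" if e: "e \<in> set ?es" for e
    proof -
      have ec: "e \<in> carrier R" using e esc by blast
      have "f e \<le> k" unfolding k_def using e by (intro member_le_sum) auto
      then have "c [^] k \<otimes> (t \<otimes> e) \<in> ?U"
        using up[OF f[OF e], of "k - f e"] Nc[OF t(2)] ec by simp
      then show ?thesis using Nc[OF t(2)] ec cc by (simp add: m_assoc)
    qed
    moreover have "c [^] k \<otimes> t \<in> N'" using N(3)[OF cpow t(2)] N'I by blast
    ultimately obtain s where s: "s \<in> N'" "\<forall>e\<in>set ?es. s \<otimes> e = \<zero>"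
      using nakayama_kill[OF S(1) I(1,2) N'S N'mult N'minus _ esc] by blast
    have "a [^] (0::nat) \<in> set ?es" using \<open>n \<noteq> 0\<close> unfolding set_pows by blast
    then have "s \<otimes> \<one> = \<zero>" using s(2) by simp
    then have "s = \<zero>" using s(1) N'S Sc by auto
    then show False using s(1) N'0 by simp
  qed
  note A = subring_adj[OF S(1) a]
  have "dominating_pair R D I\<^sub>0 N (adj R S a) (adj R I a)"
    unfolding dominating_pair_def
  proof (intro conjI)
    show "subring (adj R S a) R" using A(1) .
    show "D \<subseteq> adj R S a" using A(2) S(2) by blast
    have "submod R S (adj R I a)" using submod_adj[OF I(1) Sc a] .
    then show "submod R (adj R S a) (adj R I a)"
      using adj_mult[OF I(1) S(1) a] by (auto simp: submod_def)
    show "adj R I a \<subseteq> adj R S a"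
      using Span_pows_mono[OF submod_self[OF S(1)] a order_refl I(2)] unfolding adj_def by blast
    show "I\<^sub>0 \<subseteq> adj R I a" using adj_incl[OF I(1) a] I(3) by blast
    show "adj R I a \<inter> N = {}" using disj .
  qed
  then have "adj R S a = S" using max A(2) adj_incl[OF I(1) a] by blast
  then show ?thesis using A(3) by simp
qed

text \<open>A relation for \<open>a\<close> over \<open>D\<close> has leading coefficient u^j c with
  \<open>c\<close> in \<open>N\<close>; multiplied by a power of \<open>u\<close>, it becomes a
  relation for u^j a with leading coefficient \<open>c\<close>, so u^j a lies in \<open>S\<close>.
  Hence R = S[v] with \<open>S\<close> proper, and a maximal subring above \<open>S\<close> cannot
  contain \<open>v\<close>.\<close>

lemma (in cring) exists_maximal_subring_avoiding_inverse:
  assumes D: "subring D R" and u: "u \<in> carrier R" "v \<in> carrier R" "u \<otimes> v = \<one>"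
    and I\<^sub>0: "submod R D I\<^sub>0" "I\<^sub>0 \<subseteq> D" "I\<^sub>0 \<inter> N = {}" "u \<in> I\<^sub>0"
    and N: "N \<subseteq> D" "\<one> \<in> N" "\<And>s t. s \<in> N \<Longrightarrow> t \<in> N \<Longrightarrow> s \<otimes> t \<in> N"
    and split: "\<And>d. d \<in> D \<Longrightarrow> d \<noteq> \<zero> \<Longrightarrow> \<exists>(j::nat). \<exists>c\<in>N. d = u [^] j \<otimes> c"
    and alg: "\<And>a. a \<in> carrier R \<Longrightarrow>
      \<exists>(n::nat). \<exists>d\<in>D. d \<noteq> \<zero> \<and> d \<otimes> a [^] n \<in> Span D (pows R a n)"
  obtains S M where "subring S R" "D \<subseteq> S" "S \<subseteq> M" "maximal_subring M R" "v \<notin> M"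
    "\<And>a n. a \<in> carrier R \<Longrightarrow> a [^] (n::nat) \<in> Span S (pows R a n) \<Longrightarrow> a \<in> S"
proof -
  have "dominating_pair R D I\<^sub>0 N D I\<^sub>0" unfolding dominating_pair_def using D I\<^sub>0 by blast
  then obtain S I where SI: "dominating_pair R D I\<^sub>0 N S I"
    "\<And>S' I'. dominating_pair R D I\<^sub>0 N S' I' \<Longrightarrow> S \<subseteq> S' \<Longrightarrow> I \<subseteq> I' \<Longrightarrow> S' = S"
    using exists_maximal_pair by blast
  have S: "subring S R" "D \<subseteq> S" and I: "submod R S I" "I \<subseteq> S" "I\<^sub>0 \<subseteq> I" "I \<inter> N = {}"
    using SI(1) unfolding dominating_pair_def by auto
  have Sc: "S \<subseteq> carrier R" using subringE(1)[OF S(1)] .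
  have Dc: "D \<subseteq> carrier R" using subringE(1)[OF D] .
  have closed: "a \<in> S" if "a \<in> carrier R" "c \<in> N" "c \<otimes> a [^] n \<in> Span S (pows R a n)" for a c and n :: nat
    by (rule maximal_pair_closed[OF SI(1) _ N(1,2) _ that]) (fact SI(2), fact N(3))
  have uS: "u \<in> S" using I\<^sub>0(4) I(2,3) by blast
  \<comment> \<open>\<open>u\<close> lies in the ideal \<open>I\<close>, so \<open>v\<close> in
    \<open>S\<close> would put 1 = v u into \<open>I \<inter> N\<close>.\<close>
  have "v \<notin> S"
  proof
    assume "v \<in> S"
    then have "v \<otimes> u \<in> I" using submodD(4)[OF I(1)] I\<^sub>0(4) I(3) by blast
    then show False using u m_comm[of u v] N(2) I(4) by auto
  qed
  have ex: "\<exists>j::nat. u [^] j \<otimes> a \<in> S" if a: "a \<in> carrier R" for a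
  proof -
    obtain n :: nat and d where d: "d \<in> D" "d \<noteq> \<zero>" "d \<otimes> a [^] n \<in> Span D (pows R a n)"
      using alg[OF a] by blast
    obtain j :: nat and c where c: "c \<in> N" "d = u [^] j \<otimes> c" using split[OF d(1,2)] by blast
    have cc: "c \<in> carrier R" using c(1) N(1) Dc by blast
    have "n \<noteq> 0"
    proof
      assume "n = 0"
      then show False using d Dc by (auto simp: Span_Nil)
    qed
    then obtain m where m: "n = Suc m" using not0_implies_Suc by blast
    \<comment> \<open>The factor u^(j m) with m = n - 1 suffices: a term in a^i with i < n becomes
      u^(j (m - i)) times a multiple of b^i, and the leading term becomes c b^n.\<close>
    define b where "b = u [^] j \<otimes> a"
    have bc: "b \<in> carrier R" unfolding b_def using u a by simp
    have pb: "b [^] i = u [^] (j * i) \<otimes> a [^] i" for i :: nat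
      unfolding b_def using u a by (simp add: nat_pow_distrib nat_pow_pow)
    have "u [^] (j * m) \<otimes> (d \<otimes> a [^] n) \<in> Span S (pows R b n)"
    proof (rule Span_mult_image[OF _ _ Dc pows_carrier[OF a] _ d(3)])
      show "u [^] (j * m) \<in> carrier R" using u by simp
      show "submod R {} (Span S (pows R b n))"
        using submod_Span_pows[OF submod_mono[OF submod_self[OF S(1)], of "{}"] _ bc] by simp
      fix k e assume k: "k \<in> D" and "e \<in> set (pows R a n)"
      then obtain i where i: "i < n" "e = a [^] i" by (auto simp: set_pows)
      then have "j * m = j * (m - i) + j * i" using m by (simp add: distrib_left[symmetric])
      then have "u [^] (j * m) \<otimes> (k \<otimes> e) = (u [^] (j * (m - i)) \<otimes> k) \<otimes> b [^] i"
        unfolding pb i(2) using u a k Dc by (auto simp: nat_pow_mult[symmetric] m_ac)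
      moreover have "u [^] (j * (m - i)) \<otimes> k \<in> S"
        using nat_pow_in_subring[OF S(1) uS] subringE(6)[OF S(1)] k S(2) by blast
      moreover have "b [^] i \<in> set (pows R b n)" using i by (auto simp: set_pows)
      ultimately show "u [^] (j * m) \<otimes> (k \<otimes> e) \<in> Span S (pows R b n)"
        using Span_incl[OF submod_self[OF S(1)] pows_carrier[OF bc]] by simp
    qed
    moreover have "u [^] (j * m) \<otimes> (d \<otimes> a [^] n) = c \<otimes> b [^] n"
    proof -
      have "j * n = j * m + j" using m by simp
      then show ?thesis unfolding pb c(2) using u a cc by (simp add: nat_pow_mult[symmetric] m_ac)
    qed
    ultimately have "b \<in> S" using closed[OF bc c(1), of n] by simp
    then show ?thesis unfolding b_def by blast
  qed
  have gen: "carrier R = generate_ring R (S \<union> {v})"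
  proof
    have Svc: "S \<union> {v} \<subseteq> carrier R" using Sc u by blast
    show "generate_ring R (S \<union> {v}) \<subseteq> carrier R" using generate_ring_incl[OF Svc] .
    note G = generate_ring_is_subring[OF Svc]
    show "carrier R \<subseteq> generate_ring R (S \<union> {v})"
    proof
      fix a assume a: "a \<in> carrier R"
      obtain j :: nat where j: "u [^] j \<otimes> a \<in> S" using ex[OF a] by blast
      have "v [^] j \<otimes> (u [^] j \<otimes> a) = (u \<otimes> v) [^] j \<otimes> a"
        using u(1,2) a by (simp add: nat_pow_distrib m_ac)
      also have "\<dots> = a" using u a by simp
      finally have "a = v [^] j \<otimes> (u [^] j \<otimes> a)" by simp
      moreover have "v [^] j \<in> generate_ring R (S \<union> {v})"
        by (rule nat_pow_in_subring[OF G]) (simp add: generate_ring.incl)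
      moreover have "u [^] j \<otimes> a \<in> generate_ring R (S \<union> {v})" using j by (simp add: generate_ring.incl)
      ultimately show "a \<in> generate_ring R (S \<union> {v})" using subringE(6)[OF G] by metis
    qed
  qed
  have "S \<noteq> carrier R" using \<open>v \<notin> S\<close> u by blast
  then obtain M where M: "maximal_subring M R" "S \<subseteq> M"
    using exists_maximal_subring[OF S(1) _ _ gen] by blast
  have Ms: "subring M R" "M \<noteq> carrier R" using M(1) unfolding maximal_subring_def by auto
  have "v \<notin> M"
  proof
    assume "v \<in> M"
    then have "S \<union> {v} \<subseteq> M" "S \<union> {v} \<subseteq> carrier R" using M(2) Sc u by auto
    then show False using generate_ring_min_subring1[OF _ Ms(1)] gen Ms subringE(1)[OF Ms(1)] by blast
  qed
  show ?thesis
  proof (rule that[OF S M(2,1) \<open>v \<notin> M\<close>])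
    show "a \<in> S" if "a \<in> carrier R" "a [^] n \<in> Span S (pows R a n)" for a and n :: nat
      using closed[OF that(1) N(2), of n] that by (simp add: that(1))
  qed
qed

text \<open>As R = M[v], some e^k w lies in \<open>M\<close>. Multiplying by 1 = g e + h f lowers
  the exponent: e^k w = g (e^(k+1) w) + e^k h. So \<open>M\<close> cannot avoid both
  inverses.\<close>

lemma (in cring) maximal_subring_inverse_mem:
  assumes M: "maximal_subring M R" and e: "e \<in> M" "v \<in> carrier R" "e \<otimes> v = \<one>" "v \<notin> M"
    and f: "f \<in> M" "w \<in> carrier R" "f \<otimes> w = \<one>"
    and gh: "g \<in> M" "h \<in> M" "g \<otimes> e \<oplus> h \<otimes> f = \<one>"
  shows "w \<in> M"
proof -
  have Ms: "subring M R" using M unfolding maximal_subring_def by auto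
  have Mc: "\<And>x. x \<in> M \<Longrightarrow> x \<in> carrier R" using subringE(1)[OF Ms] by blast
  have "carrier R = adj R M v"
    using maximal_subring_generate[OF M e(2,4)] adj_eq_generate_ring[OF Ms e(2)] by simp
  moreover have "adj R M v \<subseteq> {y \<in> carrier R. \<exists>k::nat. e [^] k \<otimes> y \<in> M}"
  proof (rule adj_min)
    show "submod R {} {y \<in> carrier R. \<exists>k::nat. e [^] k \<otimes> y \<in> M}"
    proof (rule submodI)
      show "\<zero> \<in> {y \<in> carrier R. \<exists>k::nat. e [^] k \<otimes> y \<in> M}"
        using subringE(2)[OF Ms] Mc[OF e(1)] by auto
      fix y z assume "y \<in> {y \<in> carrier R. \<exists>k::nat. e [^] k \<otimes> y \<in> M}" "z \<in> {y \<in> carrier R. \<exists>k::nat. e [^] k \<otimes> y \<in> M}"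
      then obtain k l :: nat where *: "y \<in> carrier R" "z \<in> carrier R" "e [^] k \<otimes> y \<in> M" "e [^] l \<otimes> z \<in> M" by blast
      have "e [^] (k + l) \<otimes> (y \<oplus> z) = e [^] l \<otimes> (e [^] k \<otimes> y) \<oplus> e [^] k \<otimes> (e [^] l \<otimes> z)"
        using * Mc[OF e(1)] by (simp add: nat_pow_mult[symmetric] r_distr m_ac)
      also have "\<dots> \<in> M" using subringE(6,7)[OF Ms] *(3,4) nat_pow_in_subring[OF Ms e(1)] by blast
      finally show "y \<oplus> z \<in> {y \<in> carrier R. \<exists>k::nat. e [^] k \<otimes> y \<in> M}"
        using a_closed[OF *(1,2)] by blast
    qed auto
    fix k and n :: nat assume k: "k \<in> M"
    have "e [^] n \<otimes> (k \<otimes> v [^] n) = k \<otimes> (e \<otimes> v) [^] n"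
      using Mc[OF k] Mc[OF e(1)] e(2) by (simp add: nat_pow_distrib m_ac)
    then have "e [^] n \<otimes> (k \<otimes> v [^] n) \<in> M" using e(3) k Mc by simp
    then show "k \<otimes> v [^] n \<in> {y \<in> carrier R. \<exists>k::nat. e [^] k \<otimes> y \<in> M}" using Mc[OF k] e(2) by auto
  qed
  ultimately obtain k :: nat where "e [^] k \<otimes> w \<in> M" using f(2) by blast
  then show ?thesis
  proof (induction k)
    case 0
    then show ?case using f(2) by simp
  next
    case (Suc k)
    note c = Mc[OF e(1)] Mc[OF f(1)] Mc[OF gh(1)] Mc[OF gh(2)] f(2)
    have ek: "e [^] k \<in> carrier R" using c by simp
    have "e [^] k \<otimes> w = e [^] k \<otimes> w \<otimes> (g \<otimes> e \<oplus> h \<otimes> f)" using gh(3) c ek by simp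
    also have "\<dots> = g \<otimes> (e [^] k \<otimes> e \<otimes> w) \<oplus> (e [^] k \<otimes> h) \<otimes> (f \<otimes> w)"
      using c ek by (simp add: r_distr m_ac)
    also have "\<dots> = g \<otimes> (e [^] Suc k \<otimes> w) \<oplus> e [^] k \<otimes> h" using f(3) c ek by simp
    also have "\<dots> \<in> M"
      using subringE(6,7)[OF Ms] Suc.prems gh nat_pow_in_subring[OF Ms e(1)] by blast
    finally show ?case using Suc.IH by blast
  qed
qed

text \<open>Each non-unit \<open>f i\<close> lies in a maximal ideal, and comaximality forbids two
  of them in the same one; so only finitely many are non-units.\<close>

lemma (in cring) infinite_units:
  assumes semi: "semilocal R" and f: "\<And>i::nat. f i \<in> carrier R"
    and co: "\<And>i j. i < j \<Longrightarrow> \<exists>g\<in>carrier R. \<exists>h\<in>carrier R. g \<otimes> f i \<oplus> h \<otimes> f j = \<one>"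
  shows "infinite {i. \<exists>v\<in>carrier R. f i \<otimes> v = \<one>}"
proof -
  let ?B = "{i. \<not> (\<exists>v\<in>carrier R. f i \<otimes> v = \<one>)}"
  have "\<exists>M. maximalideal M R \<and> f i \<in> M" if "i \<in> ?B" for i
  proof -
    have "\<one> \<notin> PIdl (f i)"
    proof
      assume "\<one> \<in> PIdl (f i)"
      then obtain r where "\<one> = r \<otimes> f i" "r \<in> carrier R" unfolding cgenideal_def by blast
      then have "f i \<otimes> r = \<one>" "r \<in> carrier R" using m_comm[of r "f i"] f[of i] by simp_all
      then show False using that by blast
    qed
    then obtain M where "maximalideal M R" "PIdl (f i) \<subseteq> M"
      using exists_maximalideal[OF cgenideal_ideal[OF f]] by blast
    then show ?thesis using cgenideal_self[OF f[of i]] by blast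
  qed
  then have "\<forall>i\<in>?B. \<exists>M. maximalideal M R \<and> f i \<in> M" by blast
  then obtain m where "\<forall>i\<in>?B. maximalideal (m i) R \<and> f i \<in> m i" unfolding bchoice_iff by blast
  then have m: "\<And>i. i \<in> ?B \<Longrightarrow> maximalideal (m i) R" "\<And>i. i \<in> ?B \<Longrightarrow> f i \<in> m i" by blast+
  have less: "m i \<noteq> m j" if ij: "i \<in> ?B" "j \<in> ?B" "i < j" for i j
  proof
    assume eq: "m i = m j"
    have id: "ideal (m i) R" using m(1)[OF ij(1)] maximalideal.axioms(1) by blast
    obtain g h where gh: "g \<in> carrier R" "h \<in> carrier R" "g \<otimes> f i \<oplus> h \<otimes> f j = \<one>" using co[OF ij(3)] by blast
    have "g \<otimes> f i \<oplus> h \<otimes> f j \<in> m i"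
      using idealD(4)[OF id idealD(5)[OF id gh(1) m(2)[OF ij(1)]] idealD(5)[OF id gh(2), of "f j"]] m(2)[OF ij(2)] eq
      by simp
    then have "\<one> \<in> m i" using gh(3) by simp
    then show False using ideal.one_imp_carrier[OF id] maximalideal.I_notcarr[OF m(1)[OF ij(1)]] by simp
  qed
  have "inj_on m ?B"
  proof (rule inj_onI, rule ccontr)
    fix i j assume *: "i \<in> ?B" "j \<in> ?B" "m i = m j" "i \<noteq> j"
    then consider "i < j" | "j < i" by linarith
    then show False using less[OF *(1,2)] less[OF *(2,1)] *(3) by cases auto
  qed
  moreover have "m ` ?B \<subseteq> {M. maximalideal M R}" using m(1) by blast
  ultimately have fin: "finite ?B" using semi unfolding semilocal_def by (meson finite_imageD finite_subset)
  show ?thesis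
  proof
    assume "finite {i. \<exists>v\<in>carrier R. f i \<otimes> v = \<one>}"
    then have "finite (?B \<union> {i. \<exists>v\<in>carrier R. f i \<otimes> v = \<one>})" using fin by (rule finite_UnI[rotated])
    moreover have "?B \<union> {i. \<exists>v\<in>carrier R. f i \<otimes> v = \<one>} = UNIV" by blast
    ultimately show False using infinite_UNIV_nat by metis
  qed
qed

text \<open>\<open>G\<close> contains the coefficients of the comaximality relations and lies in
  every \<open>M\<close>, so that \<open>maximal_subring_inverse_mem\<close> separates the maximal
  subrings of different units.\<close>

lemma (in cring) infinite_maximal_subrings_of_units:
  assumes semi: "semilocal R" and G: "subring G R" and f: "\<And>i::nat. f i \<in> G"
    and co: "\<And>i j. i < j \<Longrightarrow> \<exists>g\<in>G. \<exists>h\<in>G. g \<otimes> f i \<oplus> h \<otimes> f j = \<one>"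
    and ex: "\<And>i v. v \<in> carrier R \<Longrightarrow> f i \<otimes> v = \<one> \<Longrightarrow> \<exists>M. maximal_subring M R \<and> G \<subseteq> M \<and> v \<notin> M"
  shows "infinite (maximal_subrings R)"
proof -
  let ?U = "{i. \<exists>v\<in>carrier R. f i \<otimes> v = \<one>}"
  have Gc: "G \<subseteq> carrier R" using subringE(1)[OF G] .
  have inf: "infinite ?U"
  proof (rule infinite_units[OF semi])
    show "f i \<in> carrier R" for i using f Gc by blast
    show "\<exists>g\<in>carrier R. \<exists>h\<in>carrier R. g \<otimes> f i \<oplus> h \<otimes> f j = \<one>" if "i < j" for i j
      using co[OF that] Gc by blast
  qed
  have "\<forall>i\<in>?U. \<exists>M. maximal_subring M R \<and> G \<subseteq> M \<and> (\<exists>v\<in>carrier R. f i \<otimes> v = \<one> \<and> v \<notin> M)"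
    using ex by blast
  then obtain m where "\<forall>i\<in>?U. maximal_subring (m i) R \<and> G \<subseteq> m i \<and> (\<exists>v\<in>carrier R. f i \<otimes> v = \<one> \<and> v \<notin> m i)"
    unfolding bchoice_iff by blast
  then have m: "\<And>i. i \<in> ?U \<Longrightarrow> maximal_subring (m i) R" "\<And>i. i \<in> ?U \<Longrightarrow> G \<subseteq> m i"
    "\<And>i. i \<in> ?U \<Longrightarrow> \<exists>v\<in>carrier R. f i \<otimes> v = \<one> \<and> v \<notin> m i" by blast+
  have less: "m i \<noteq> m j" if ij: "i \<in> ?U" "j \<in> ?U" "i < j" for i j
  proof
    assume eq: "m i = m j"
    obtain v where v: "v \<in> carrier R" "f i \<otimes> v = \<one>" "v \<notin> m i" using m(3)[OF ij(1)] by blast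
    obtain w where w: "w \<in> carrier R" "f j \<otimes> w = \<one>" "w \<notin> m j" using m(3)[OF ij(2)] by blast
    obtain g h where gh: "g \<in> G" "h \<in> G" "g \<otimes> f i \<oplus> h \<otimes> f j = \<one>" using co[OF ij(3)] by blast
    note s = subsetD[OF m(2)[OF ij(1)]]
    have "w \<in> m i"
      by (rule maximal_subring_inverse_mem[OF m(1)[OF ij(1)] s[OF f] v s[OF f] w(1,2) s[OF gh(1)] s[OF gh(2)] gh(3)])
    then show False using w(3) eq by simp
  qed
  have "inj_on m ?U"
  proof (rule inj_onI, rule ccontr)
    fix i j assume *: "i \<in> ?U" "j \<in> ?U" "m i = m j" "i \<noteq> j"
    then consider "i < j" | "j < i" by linarith
    then show False using less[OF *(1,2)] less[OF *(2,1)] *(3) by cases auto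
  qed
  then have "infinite (m ` ?U)" using inf finite_imageD by blast
  moreover have "m ` ?U \<subseteq> maximal_subrings R" using m(1) unfolding maximal_subrings_def by blast
  ultimately show ?thesis using finite_subset by blast
qed


section \<open>Semilocal domains with finitely many maximal subrings\<close>

definition algebraic_over :: "('a, 'b) ring_scheme \<Rightarrow> 'a set \<Rightarrow> 'a \<Rightarrow> bool" where
  "algebraic_over R K x \<longleftrightarrow>
     (\<exists>n::nat. \<exists>c\<in>K. c \<noteq> \<zero>\<^bsub>R\<^esub> \<and> c \<otimes>\<^bsub>R\<^esub> x [^]\<^bsub>R\<^esub> n \<in> ring.Span R K (pows R x n))"

lemma (in cring) subring_range_of_integer: "subring (range (of_integer R)) R"
proof (rule subringI)
  show "range (of_integer R) \<subseteq> carrier R" by auto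
  show "\<one> \<in> range (of_integer R)" using rangeI[of "of_integer R" 1] by simp
  fix h assume "h \<in> range (of_integer R)"
  then obtain z where z: "h = \<guillemotleft>z\<guillemotright>" by blast
  show "\<ominus> h \<in> range (of_integer R)" using rangeI[of "of_integer R" "- z"] z by simp
  fix h' assume "h' \<in> range (of_integer R)"
  then obtain z' where z': "h' = \<guillemotleft>z'\<guillemotright>" by blast
  show "h \<otimes> h' \<in> range (of_integer R)" using rangeI[of "of_integer R" "z * z'"] z z' by simp
  show "h \<oplus> h' \<in> range (of_integer R)" using rangeI[of "of_integer R" "z + z'"] z z' by simp
qed

lemma (in cring) of_integer_in_subring:
  assumes "subring K R" shows "range (of_integer R) \<subseteq> K"
proof -
  have n: "\<guillemotleft>int n\<guillemotright> \<in> K" for n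
    using subringE(2,3,7)[OF assms] by (induction n) simp_all
  have "\<guillemotleft>z\<guillemotright> \<in> K" for z
    using n[of "nat z"] subringE(5)[OF assms n[of "nat (- z)"]] by (cases "z \<ge> 0") simp_all
  then show ?thesis by blast
qed

text \<open>x^2 - x + 1 is monic, so w^i is x^(2i) plus lower terms; substituted into a relation of
  degree \<open>n\<close> for \<open>w\<close>, this gives one of degree 2n for \<open>x\<close>
  with the same leading coefficient.\<close>

lemma (in cring) algebraic_over_quadratic:
  assumes K: "subring K R" and x: "x \<in> carrier R" and alg: "algebraic_over R K (x \<otimes> x \<ominus> x \<oplus> \<one>)"
  shows "algebraic_over R K x"
proof -
  define w where "w = x \<otimes> x \<ominus> x \<oplus> \<one>"
  have w: "w \<in> carrier R" unfolding w_def using x by simp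
  have Kc: "K \<subseteq> carrier R" using subringE(1)[OF K] .
  note sK = submod_self[OF K]
  have V: "submod R K (Span K (pows R x n))" for n using submod_Span_pows[OF sK Kc x] .
  have incl: "x [^] i \<in> Span K (pows R x n)" if "i < n" for i n :: nat
    using Span_incl_one[OF K pows_carrier[OF x], of "x [^] i" n] that by (auto simp: set_pows)
  have mono: "Span K (pows R x m) \<subseteq> Span K (pows R x n)" if "m \<le> n" for m n
    using Span_pows_mono[OF sK x that order_refl] .
  have monic: "\<exists>y\<in>Span K (pows R x (2 * i)). w [^] i = x [^] (2 * i) \<oplus> y" for i :: nat
  proof (induction i)
    case 0
    then show ?case by (auto simp: Span_Nil)
  next
    case (Suc i)
    then obtain y where y: "y \<in> Span K (pows R x (2 * i))" "w [^] i = x [^] (2 * i) \<oplus> y" by blast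
    have yc: "y \<in> carrier R" using submodD(5)[OF V y(1)] .
    let ?V = "Span K (pows R x (2 * Suc i))"
    define p where "p = x [^] (2 * i)"
    have pc: "p \<in> carrier R" using x unfolding p_def by simp
    let ?z = "(p \<ominus> x [^] (Suc (2 * i))) \<oplus> ((x [^] (2::nat) \<otimes> y \<ominus> x [^] (1::nat) \<otimes> y) \<oplus> y)"
    have 1: "p \<in> ?V" "x [^] (Suc (2 * i)) \<in> ?V" unfolding p_def by (rule incl, simp)+
    have 2: "x [^] (2::nat) \<otimes> y \<in> ?V" using Span_pows_mult[OF sK x y(1), of 2] by simp
    have 3: "x [^] (1::nat) \<otimes> y \<in> ?V"
      using Span_pows_mult[OF sK x y(1), of 1] mono[of "1 + 2 * i" "2 * Suc i"] by auto
    have 4: "y \<in> ?V" using y(1) mono[of "2 * i" "2 * Suc i"] by auto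
    have z: "?z \<in> ?V"
      using submodD(3)[OF V] submod_minus[OF K V] 1 2 3 4 by metis
    have "w [^] Suc i = (p \<oplus> y) \<otimes> (x \<otimes> x \<ominus> x \<oplus> \<one>)" using y(2) unfolding w_def p_def by simp
    also have "\<dots> = p \<otimes> x \<otimes> x \<oplus> ((p \<ominus> p \<otimes> x) \<oplus> ((x \<otimes> x \<otimes> y \<ominus> x \<otimes> y) \<oplus> y))"
      using pc x yc by algebra
    also have "\<dots> = x [^] (2 * Suc i) \<oplus> ?z" using x unfolding p_def by (simp add: numeral_2_eq_2)
    finally show ?case using z by blast
  qed
  obtain n :: nat and c where c: "c \<in> K" "c \<noteq> \<zero>" "c \<otimes> w [^] n \<in> Span K (pows R w n)"
    using alg unfolding algebraic_over_def w_def by blast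
  have cc: "c \<in> carrier R" using c(1) Kc by blast
  have "Span K (pows R w n) \<subseteq> Span K (pows R x (2 * n))"
  proof (rule Span_min)
    show "submod R {} (Span K (pows R x (2 * n)))" using submod_mono[OF V] by simp
    fix k u assume k: "k \<in> K" and "u \<in> set (pows R w n)"
    then obtain i where i: "i < n" "u = w [^] i" by (auto simp: set_pows)
    obtain y where y: "y \<in> Span K (pows R x (2 * i))" "w [^] i = x [^] (2 * i) \<oplus> y" using monic by blast
    have "y \<in> Span K (pows R x (2 * n))" using y(1) mono[of "2 * i" "2 * n"] i(1) by auto
    then have "u \<in> Span K (pows R x (2 * n))"
      unfolding i(2) y(2) using submodD(3)[OF V] incl[of "2 * i" "2 * n"] i(1) by simp
    then show "k \<otimes> u \<in> Span K (pows R x (2 * n))" using submodD(4)[OF V k] by blast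
  qed
  moreover obtain y where y: "y \<in> Span K (pows R x (2 * n))" "w [^] n = x [^] (2 * n) \<oplus> y" using monic by blast
  moreover have "c \<otimes> x [^] (2 * n) = c \<otimes> w [^] n \<ominus> c \<otimes> y"
  proof -
    have yc: "y \<in> carrier R" and pc: "x [^] (2 * n) \<in> carrier R" using submodD(5)[OF V y(1)] x by auto
    have "c \<otimes> p = c \<otimes> (p \<oplus> y) \<ominus> c \<otimes> y" if "p \<in> carrier R" for p
      using cc yc that by algebra
    from this[OF pc] show ?thesis unfolding y(2) .
  qed
  ultimately have "c \<otimes> x [^] (2 * n) \<in> Span K (pows R x (2 * n))"
    using submod_minus[OF K V] submodD(4)[OF V c(1)] c(3) by auto
  then show ?thesis unfolding algebraic_over_def using c(1,2) by blast
qed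

text \<open>The subring \<open>C\<close> below plays the role of a field over which \<open>R\<close> has transcendence degree
  one, with \<open>w\<close> as transcendence basis; the construction gives the \<open>w\<close>-adic valuation.\<close>

lemma (in domain) exists_maximal_subring_transcendental:
  assumes w: "w \<in> carrier R" "v \<in> carrier R" "w \<otimes> v = \<one>"
    and tr: "\<not> algebraic_over R (range (of_integer R)) w"
  obtains S M where "subring S R" "w \<in> S" "S \<subseteq> M" "maximal_subring M R" "v \<notin> M"
    "\<And>a n. a \<in> carrier R \<Longrightarrow> a [^] (n::nat) \<in> Span S (pows R a n) \<Longrightarrow> a \<in> S"
proof -
  let ?P = "range (of_integer R)"
  note P = subring_range_of_integer
  \<comment> \<open>A form of transcendence of \<open>w\<close> over \<open>C\<close>: dividing a
    relation by a power of \<open>w\<close> makes its constant term nonzero, and it then reads w y =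
    c with \<open>c\<close> nonzero in \<open>C\<close>. This form passes to unions of
    chains.\<close>
  define \<Psi> where "\<Psi> C \<longleftrightarrow> (\<forall>y\<in>adj R C w. w \<otimes> y \<in> C \<longrightarrow> w \<otimes> y = \<zero>)" for C
  \<comment> \<open>The top coefficient of \<open>y\<close> would lead a relation for
    \<open>w\<close> over the prime ring, so it vanishes and the degree drops.\<close>
  have "\<forall>y\<in>Span ?P (pows R w n). w \<otimes> y \<in> ?P \<longrightarrow> w \<otimes> y = \<zero>" for n
  proof (induction n)
    case 0
    then show ?case using w by (simp add: Span_Nil)
  next
    case (Suc n)
    show ?case
    proof (intro ballI impI)
      fix y assume y: "y \<in> Span ?P (pows R w (Suc n))" and wy: "w \<otimes> y \<in> ?P"
      note V = submod_Span_pows[OF submod_self[OF P] subringE(1)[OF P] w(1)]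
      obtain z k where z: "y = z \<oplus> k \<otimes> w [^] n" "z \<in> Span ?P (pows R w n)" "k \<in> ?P"
        using Span_snocE[OF submod_self[OF P] pows_carrier[OF w(1)] _ y[unfolded pows_Suc]] w by auto
      have c: "z \<in> carrier R" "k \<in> carrier R" "w [^] n \<in> carrier R" "w \<otimes> y \<in> carrier R"
        using submodD(5)[OF V z(2)] z(3) w submodD(5)[OF V y] by auto
      have "k \<otimes> w [^] Suc n = w \<otimes> y \<ominus> w \<otimes> z"
      proof -
        have "k \<otimes> (e \<otimes> w) = w \<otimes> (z \<oplus> k \<otimes> e) \<ominus> w \<otimes> z" if "e \<in> carrier R" for e
          using that c(1,2) w(1) by algebra
        from this[OF c(3)] show ?thesis using z(1) by simp
      qed
      moreover have "w \<otimes> z \<in> Span ?P (pows R w (Suc n))"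
        using Span_pows_mult[OF submod_self[OF P] w(1) z(2), of 1] w by simp
      moreover have "w \<otimes> y \<in> Span ?P (pows R w (Suc n))"
      proof -
        have "w [^] (0::nat) \<in> set (pows R w (Suc n))" unfolding set_pows by blast
        then show ?thesis
          using Span_incl[OF submod_self[OF P] pows_carrier[OF w(1)] wy, of \<one> "Suc n"] c(4) by simp
      qed
      ultimately have "k \<otimes> w [^] Suc n \<in> Span ?P (pows R w (Suc n))" using submod_minus[OF P V] by simp
      then have "k = \<zero>" using tr z(3) unfolding algebraic_over_def by blast
      then have "y = z" using z(1) c by simp
      then show "w \<otimes> y = \<zero>" using Suc z(2) wy by blast
    qed
  qed
  then have \<Psi>P: "\<Psi> ?P" unfolding \<Psi>_def by (auto elim: adjE)
  let ?A = "{C. subring C R \<and> \<Psi> C}"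
  have "\<exists>C\<in>?A. \<forall>Y\<in>?A. C \<subseteq> Y \<longrightarrow> Y = C"
  proof (rule subset_Zorn_nonempty)
    show "?A \<noteq> {}" using \<Psi>P P by blast
    fix K assume K: "K \<noteq> {}" "subset.chain ?A K"
    then have A: "subring C R" "\<Psi> C" if "C \<in> K" for C using that unfolding pred_on.chain_def by auto
    have "\<Psi> (\<Union>K)" unfolding \<Psi>_def
    proof (intro ballI impI)
      fix y assume y: "y \<in> adj R (\<Union>K) w" and wy: "w \<otimes> y \<in> \<Union>K"
      obtain n where "y \<in> Span (\<Union>K) (pows R w n)" using y by (rule adjE)
      then obtain C where C: "C \<in> K" "y \<in> Span C (pows R w n)"
        using Span_Union_chain[OF K A(1) pows_carrier[OF w(1)]] by blast
      obtain C' where C': "C' \<in> K" "w \<otimes> y \<in> C'" using wy by blast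
      consider "C \<subseteq> C'" | "C' \<subseteq> C" using K(2) C(1) C'(1) unfolding pred_on.chain_def by blast
      then show "w \<otimes> y = \<zero>"
      proof cases
        case 1
        then have "y \<in> adj R C' w"
          using Span_pows_mono[OF submod_self[OF A(1)[OF C'(1)]] w(1) order_refl] C(2) adjI by blast
        then show ?thesis using A(2)[OF C'(1)] C'(2) unfolding \<Psi>_def by blast
      next
        case 2
        then show ?thesis using A(2)[OF C(1)] C(2) C'(2) adjI unfolding \<Psi>_def by blast
      qed
    qed
    then show "\<Union>K \<in> ?A" using subring_Union_chain[OF K A(1)] by blast
  qed
  \<comment> \<open>Maximality of \<open>C\<close> will make \<open>R\<close> algebraic over
    C[w].\<close>
  then obtain C where "C \<in> ?A" and Cmax: "\<forall>Y\<in>?A. C \<subseteq> Y \<longrightarrow> Y = C" by (rule bexE)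
  then have C: "subring C R" and \<Psi>C: "\<Psi> C" by auto
  have Cc: "C \<subseteq> carrier R" using subringE(1)[OF C] .
  define D where "D = adj R C w"
  have D: "subring D R" "C \<subseteq> D" "w \<in> D" unfolding D_def using subring_adj[OF C w(1)] by auto
  have Dc: "D \<subseteq> carrier R" using subringE(1)[OF D(1)] .
  have zero: "w \<otimes> y = \<zero>" if "y \<in> D" "w \<otimes> y \<in> C" for y
    using \<Psi>C that unfolding \<Psi>_def D_def by blast
  \<comment> \<open>In the polynomial ring D = C[w], \<open>I\<close> is the ideal generated by
    \<open>w\<close> and \<open>N\<close> consists of the elements with nonzero constant term; every
    nonzero element of \<open>D\<close> is a power of \<open>w\<close> times an element of
    \<open>N\<close>.\<close>
  define I where "I = {w \<otimes> y | y. y \<in> D}"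
  define N where "N = {c \<oplus> w \<otimes> y | c y. c \<in> C \<and> c \<noteq> \<zero> \<and> y \<in> D}"
  have NE: "\<exists>c y. x = c \<oplus> w \<otimes> y \<and> c \<in> C \<and> c \<noteq> \<zero> \<and> y \<in> D" if "x \<in> N" for x
    using that unfolding N_def by blast
  have NI: "c \<oplus> w \<otimes> y \<in> N" if "c \<in> C" "c \<noteq> \<zero>" "y \<in> D" for c y
    using that unfolding N_def by blast
  have wD: "w \<otimes> y \<in> D" if "y \<in> D" for y using subringE(6)[OF D(1) D(3) that] .
  have CN: "c \<in> N" if "c \<in> C" "c \<noteq> \<zero>" for c
    using NI[OF that subringE(2)[OF D(1)]] w Cc that(1) by auto
  have N0: "\<zero> \<notin> N" and NI0: "I \<inter> N = {}"
  proof -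
    have *: "False" if y: "y \<in> D" and n: "w \<otimes> y \<in> N" for y
    proof -
      obtain c z where cz: "w \<otimes> y = c \<oplus> w \<otimes> z" "c \<in> C" "c \<noteq> \<zero>" "z \<in> D" using NE[OF n] by blast
      have cc: "c \<in> carrier R" "y \<in> carrier R" "z \<in> carrier R" using cz y Cc Dc by auto
      have "w \<otimes> (y \<ominus> z) = w \<otimes> y \<ominus> w \<otimes> z" using cc w(1) by algebra
      also have "\<dots> = c" unfolding cz(1) using cc w(1) by algebra
      finally have "w \<otimes> (y \<ominus> z) = c" .
      then show False using zero[OF subring_minus[OF D(1) y cz(4)]] cz(2,3) by simp
    qed
    show "I \<inter> N = {}" unfolding I_def using * by blast
    show "\<zero> \<notin> N" using *[of \<zero>] subringE(2)[OF D(1)] w(1) by auto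
  qed
  have ND: "N \<subseteq> D" using NE D(2) wD subringE(7)[OF D(1)] by blast
  have Nmult: "s \<otimes> t \<in> N" if s: "s \<in> N" and t: "t \<in> N" for s t
  proof -
    obtain c y where 1: "s = c \<oplus> w \<otimes> y" "c \<in> C" "c \<noteq> \<zero>" "y \<in> D" using NE[OF s] by blast
    obtain d z where 2: "t = d \<oplus> w \<otimes> z" "d \<in> C" "d \<noteq> \<zero>" "z \<in> D" using NE[OF t] by blast
    have cc: "c \<in> carrier R" "y \<in> carrier R" "d \<in> carrier R" "z \<in> carrier R" using 1 2 Cc Dc by auto
    have "s \<otimes> t = c \<otimes> d \<oplus> w \<otimes> (c \<otimes> z \<oplus> (d \<otimes> y \<oplus> w \<otimes> y \<otimes> z))"
      unfolding 1(1) 2(1) using cc w(1) by algebra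
    moreover have "c \<otimes> d \<noteq> \<zero>" using cc 1(3) 2(3) integral by blast
    moreover have "c \<otimes> z \<oplus> (d \<otimes> y \<oplus> w \<otimes> y \<otimes> z) \<in> D"
      by (intro subringE(6,7)[OF D(1)] subsetD[OF D(2)] D(3) 1 2)
    ultimately show ?thesis using NI subringE(6)[OF C 1(2) 2(2)] by simp
  qed
  have split: "\<forall>d\<in>Span C (pows R w n). d \<noteq> \<zero> \<longrightarrow> (\<exists>j::nat. \<exists>c\<in>N. d = w [^] j \<otimes> c)" for n
  proof (induction n)
    case 0
    then show ?case by (simp add: Span_Nil)
  next
    case (Suc n)
    show ?case
    proof (intro ballI impI)
      fix d assume d: "d \<in> Span C (pows R w (Suc n))" "d \<noteq> \<zero>"
      obtain c y where y: "d = c \<otimes> \<one> \<oplus> y" "c \<in> C" "y \<in> Span C (map (\<lambda>e. w \<otimes> e) (pows R w n))"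
        using d(1) unfolding pows_Suc_Cons[OF w(1)] by (rule Span_ConsE)
      have "Span C (map (\<lambda>e. w \<otimes> e) (pows R w n)) \<subseteq> {w \<otimes> z | z. z \<in> Span C (pows R w n)}"
      proof (rule Span_min)
        note V = submod_Span_pows[OF submod_self[OF C] Cc w(1)]
        show "submod R {} {w \<otimes> z | z. z \<in> Span C (pows R w n)}"
        proof (rule submodI)
          show "{w \<otimes> z | z. z \<in> Span C (pows R w n)} \<subseteq> carrier R" using submodD(5)[OF V] w(1) by auto
          have "w \<otimes> \<zero> = \<zero>" using w(1) by simp
          then show "\<zero> \<in> {w \<otimes> z | z. z \<in> Span C (pows R w n)}" using submodD(2)[OF V, of n] by force
          fix a b assume "a \<in> {w \<otimes> z | z. z \<in> Span C (pows R w n)}" "b \<in> {w \<otimes> z | z. z \<in> Span C (pows R w n)}"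
          then obtain s t where *: "a = w \<otimes> s" "s \<in> Span C (pows R w n)" "b = w \<otimes> t" "t \<in> Span C (pows R w n)" by blast
          have "a \<oplus> b = w \<otimes> (s \<oplus> t)"
            unfolding *(1,3) using w(1) submodD(5)[OF V *(2)] submodD(5)[OF V *(4)] by (simp add: r_distr)
          then show "a \<oplus> b \<in> {w \<otimes> z | z. z \<in> Span C (pows R w n)}" using submodD(3)[OF V *(2,4)] by blast
        qed simp
        fix k u assume k: "k \<in> C" and "u \<in> set (map (\<lambda>e. w \<otimes> e) (pows R w n))"
        then obtain e where e: "u = w \<otimes> e" "e \<in> set (pows R w n)" by auto
        have "e \<in> carrier R" using e(2) pows_carrier[OF w(1)] by blast
        then have "k \<otimes> u = w \<otimes> (k \<otimes> e)" unfolding e(1) using k Cc w(1) by (auto simp: m_lcomm)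
        then show "k \<otimes> u \<in> {w \<otimes> z | z. z \<in> Span C (pows R w n)}"
          using Span_incl[OF submod_self[OF C] pows_carrier[OF w(1)] k e(2)] by blast
      qed
      then obtain z where z: "y = w \<otimes> z" "z \<in> Span C (pows R w n)" using y(3) by blast
      have zD: "z \<in> D" unfolding D_def using adjI[OF z(2)] .
      have cc: "c \<in> carrier R" "z \<in> carrier R" using y(2) Cc zD Dc by auto
      have d': "d = c \<oplus> w \<otimes> z" using y(1) z(1) cc by simp
      show "\<exists>j::nat. \<exists>c\<in>N. d = w [^] j \<otimes> c"
      proof (cases "c = \<zero>")
        case False
        then have "d \<in> N" using NI[OF y(2) _ zD] d' by simp
        moreover have "d = w [^] (0::nat) \<otimes> d" using d' cc w(1) by simp
        ultimately show ?thesis by blast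
      next
        case True
        then have "d = w \<otimes> z" "z \<noteq> \<zero>" using d' cc w(1) d(2) by auto
        moreover obtain j :: nat and e where "e \<in> N" "z = w [^] j \<otimes> e" using Suc z(2) \<open>z \<noteq> \<zero>\<close> by blast
        moreover have "e \<in> carrier R" using \<open>e \<in> N\<close> ND Dc by blast
        ultimately have "d = w [^] Suc j \<otimes> e" using w(1) by (simp add: m_ac)
        then show ?thesis using \<open>e \<in> N\<close> by blast
      qed
    qed
  qed
  \<comment> \<open>Subtracting the two sides of \<open>g = w \<otimes> y\<close> expresses (c - w
    d) a^n by lower powers, where \<open>c\<close> and \<open>d\<close> are the top coefficients.
    Either this is a relation for \<open>a\<close>, or \<open>c\<close> and w d both vanish and
    \<open>n\<close> drops; it cannot drop to zero, because \<open>g\<close> is nonzero.\<close>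
  have top: "\<forall>g\<in>Span C (pows R a n). \<forall>y\<in>Span D (pows R a n). g = w \<otimes> y \<longrightarrow> g \<noteq> \<zero> \<longrightarrow>
      (\<exists>m::nat. \<exists>d\<in>D. d \<noteq> \<zero> \<and> d \<otimes> a [^] m \<in> Span D (pows R a m))" if a: "a \<in> carrier R" for a n
  proof (induction n)
    case 0
    then show ?case by (simp add: Span_Nil)
  next
    case (Suc n)
    note V = submod_Span_pows[OF submod_self[OF D(1)] Dc a]
    show ?case
    proof (intro ballI impI)
      fix g y assume g: "g \<in> Span C (pows R a (Suc n))" and y: "y \<in> Span D (pows R a (Suc n))"
        and eq: "g = w \<otimes> y" and "g \<noteq> \<zero>"
      obtain g' c where g': "g = g' \<oplus> c \<otimes> a [^] n" "g' \<in> Span C (pows R a n)" "c \<in> C"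
        using Span_snocE[OF submod_self[OF C] pows_carrier[OF a] _ g[unfolded pows_Suc]] a by auto
      obtain y' d where y': "y = y' \<oplus> d \<otimes> a [^] n" "y' \<in> Span D (pows R a n)" "d \<in> D"
        using Span_snocE[OF submod_self[OF D(1)] pows_carrier[OF a] _ y[unfolded pows_Suc]] a by auto
      have g'D: "g' \<in> Span D (pows R a n)"
        using Span_pows_mono[OF submod_self[OF D(1)] a order_refl D(2)] g'(2) by blast
      have cc: "g' \<in> carrier R" "y' \<in> carrier R" "c \<in> carrier R" "d \<in> carrier R" "a [^] n \<in> carrier R"
        using submodD(5)[OF V g'D] submodD(5)[OF V y'(2)] g'(3) y'(3) Cc Dc a by auto
      have "(c \<ominus> w \<otimes> d) \<otimes> e = (w \<otimes> y' \<ominus> g') \<oplus> ((g' \<oplus> c \<otimes> e) \<ominus> w \<otimes> (y' \<oplus> d \<otimes> e))"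
        if "e \<in> carrier R" for e
        using that cc(1-4) w(1) by algebra
      from this[OF cc(5)]
      have "(c \<ominus> w \<otimes> d) \<otimes> a [^] n = (w \<otimes> y' \<ominus> g') \<oplus> ((g' \<oplus> c \<otimes> a [^] n) \<ominus> w \<otimes> (y' \<oplus> d \<otimes> a [^] n))" .
      also have "(g' \<oplus> c \<otimes> a [^] n) \<ominus> w \<otimes> (y' \<oplus> d \<otimes> a [^] n) = \<zero>"
        unfolding g'(1)[symmetric] y'(1)[symmetric] eq using w(1) submodD(5)[OF V y] by (simp add: minus_eq r_neg)
      finally have rel: "(c \<ominus> w \<otimes> d) \<otimes> a [^] n = w \<otimes> y' \<ominus> g'" using cc w(1) by simp
      show "\<exists>m::nat. \<exists>d\<in>D. d \<noteq> \<zero> \<and> d \<otimes> a [^] m \<in> Span D (pows R a m)"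
      proof (cases "c = \<zero>")
        case False
        have "c \<ominus> w \<otimes> d = c \<oplus> w \<otimes> (\<ominus> d)" using cc w(1) by (simp add: minus_eq r_minus)
        then have "c \<ominus> w \<otimes> d \<in> N" using NI[OF g'(3) False subringE(5)[OF D(1) y'(3)]] by simp
        then have "c \<ominus> w \<otimes> d \<in> D" "c \<ominus> w \<otimes> d \<noteq> \<zero>" using ND N0 by auto
        moreover have "(c \<ominus> w \<otimes> d) \<otimes> a [^] n \<in> Span D (pows R a n)"
          unfolding rel using submod_minus[OF D(1) V] submodD(4)[OF V D(3) y'(2)] g'D by blast
        ultimately show ?thesis by blast
      next
        case True
        show ?thesis
        proof (cases "w \<otimes> d = \<zero>")
          case False
          have "(w \<otimes> d) \<otimes> a [^] n = g' \<ominus> w \<otimes> y'"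
          proof -
            have "(w \<otimes> d) \<otimes> a [^] n = \<ominus> ((c \<ominus> w \<otimes> d) \<otimes> a [^] n)"
              using True cc w(1) by (simp add: minus_eq l_minus)
            also have "\<dots> = g' \<ominus> w \<otimes> y'" unfolding rel using cc(1,2) w(1) by algebra
            finally show ?thesis .
          qed
          then have "(w \<otimes> d) \<otimes> a [^] n \<in> Span D (pows R a n)"
            using submod_minus[OF D(1) V g'D submodD(4)[OF V D(3) y'(2)]] by simp
          then show ?thesis using False wD[OF y'(3)] by blast
        next
          case wd: True
          have "g = g'" using g'(1) True cc by simp
          moreover have "w \<otimes> y = w \<otimes> y'"
          proof -
            have "w \<otimes> y = w \<otimes> y' \<oplus> (w \<otimes> d) \<otimes> a [^] n"
              unfolding y'(1) using cc w(1) by (simp add: r_distr m_assoc)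
            then show ?thesis using wd cc w(1) by simp
          qed
          ultimately show ?thesis using Suc g'(2) y'(2) eq \<open>g \<noteq> \<zero>\<close> by metis
        qed
      qed
    qed
  qed
  have alg: "\<exists>n::nat. \<exists>d\<in>D. d \<noteq> \<zero> \<and> d \<otimes> a [^] n \<in> Span D (pows R a n)" if a: "a \<in> carrier R" for a
  proof (cases "a \<in> C")
    case True
    have "a \<otimes> a [^] (0::nat) \<in> Span D (pows R a 1)"
      by (rule Span_incl[OF submod_self[OF D(1)] pows_carrier[OF a]]) (use True D(2) in \<open>auto simp: set_pows\<close>)
    then have "\<one> \<otimes> a [^] (1::nat) \<in> Span D (pows R a 1)" using a by simp
    then show ?thesis using subringE(3)[OF D(1)] one_not_zero by blast
  next
    case False
    note CA = subring_adj[OF C a] and DA = subring_adj[OF D(1) a]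
    \<comment> \<open>The exchange argument: by maximality of \<open>C\<close>, \<open>w\<close> is
      algebraic over C[a]; read as a relation for \<open>a\<close>, this makes \<open>a\<close>
      algebraic over D = C[w].\<close>
    have "\<not> \<Psi> (adj R C a)" using Cmax CA False by blast
    then obtain y where y: "y \<in> adj R (adj R C a) w" "w \<otimes> y \<in> adj R C a" "w \<otimes> y \<noteq> \<zero>" unfolding \<Psi>_def by blast
    have "adj R C a \<subseteq> adj R D a" using adj_least[OF DA(1) _ DA(3)] D(2) DA(2) by blast
    then have "y \<in> adj R D a" using adj_least[OF DA(1)] D(3) DA(2) y(1) by blast
    then obtain m n where mn: "y \<in> Span D (pows R a m)" "w \<otimes> y \<in> Span C (pows R a n)"
      using y(2) by (auto elim!: adjE)
    have "y \<in> Span D (pows R a (max m n))" "w \<otimes> y \<in> Span C (pows R a (max m n))"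
      using mn Span_pows_mono[OF submod_self[OF D(1)] a, of m "max m n" D]
        Span_pows_mono[OF submod_self[OF C] a, of n "max m n" C] by auto
    then show ?thesis using top[OF a, of "max m n"] y(3) by blast
  qed
  have ID: "submod R D I"
  proof (rule submodI)
    show "I \<subseteq> carrier R" unfolding I_def using Dc w(1) by auto
    have "\<zero> = w \<otimes> \<zero>" using w(1) by simp
    then show "\<zero> \<in> I" unfolding I_def using subringE(2)[OF D(1)] by blast
    show "k \<otimes> s \<in> I" if k: "k \<in> D" and s: "s \<in> I" for k s
    proof -
      obtain y where y: "s = w \<otimes> y" "y \<in> D" using s unfolding I_def by blast
      have "k \<otimes> s = w \<otimes> (k \<otimes> y)" unfolding y(1) using m_lcomm[of k w y] k y(2) Dc w(1) by blast
      then show ?thesis unfolding I_def using subringE(6)[OF D(1) k y(2)] by blast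
    qed
    fix s t assume s: "s \<in> I" and t: "t \<in> I"
    obtain y where y: "s = w \<otimes> y" "y \<in> D" using s unfolding I_def by blast
    obtain z where z: "t = w \<otimes> z" "z \<in> D" using t unfolding I_def by blast
    have "s \<oplus> t = w \<otimes> (y \<oplus> z)" unfolding y(1) z(1) using r_distr[of y z w] y(2) z(2) Dc w(1) by (metis subsetD)
    then show "s \<oplus> t \<in> I" unfolding I_def using subringE(7)[OF D(1) y(2) z(2)] by blast
  qed
  have wI: "w \<in> I"
  proof -
    have "w = w \<otimes> \<one>" using w(1) by simp
    then show ?thesis unfolding I_def using subringE(3)[OF D(1)] by blast
  qed
  have I_D: "I \<subseteq> D" unfolding I_def using wD by blast
  have N1: "\<one> \<in> N" using CN[OF subringE(3)[OF C]] by simp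
  have split': "\<exists>j::nat. \<exists>c\<in>N. d = w [^] j \<otimes> c" if "d \<in> D" "d \<noteq> \<zero>" for d
    using that split unfolding D_def by (auto elim!: adjE)
  obtain S M where SM: "subring S R" "D \<subseteq> S" "S \<subseteq> M" "maximal_subring M R" "v \<notin> M"
    "\<And>a n. a \<in> carrier R \<Longrightarrow> a [^] (n::nat) \<in> Span S (pows R a n) \<Longrightarrow> a \<in> S"
    using exists_maximal_subring_avoiding_inverse[OF D(1) w ID I_D NI0 wI ND N1 Nmult split' alg]
    by blast
  have "w \<in> S" using D(3) SM(2) by blast
  show ?thesis
  proof (rule that[OF SM(1) \<open>w \<in> S\<close> SM(3-5)])
    show "a \<in> S" if "a \<in> carrier R" "a [^] n \<in> Span S (pows R a n)" for a and n :: nat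
      using SM(6) that .
  qed
qed

text \<open>The q-adic case: \<open>D\<close> is the prime ring, the ideal consists of the multiples
  of \<open>q\<close>, and \<open>N\<close> of the other integers. Characteristic zero keeps the two
  sets disjoint.\<close>

lemma (in cring) exists_maximal_subring_prime:
  assumes char0: "\<And>z. \<guillemotleft>z\<guillemotright> = \<zero> \<Longrightarrow> z = 0"
    and alg: "\<And>x. x \<in> carrier R \<Longrightarrow> algebraic_over R (range (of_integer R)) x"
    and q: "Factorial_Ring.prime (q :: int)" and v: "v \<in> carrier R" "\<guillemotleft>q\<guillemotright> \<otimes> v = \<one>"
  shows "\<exists>M. maximal_subring M R \<and> v \<notin> M"
proof -
  let ?P = "range (of_integer R)"
  note P = subring_range_of_integer
  have inj: "z = z'" if "\<guillemotleft>z\<guillemotright> = \<guillemotleft>z'\<guillemotright>" for z z'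
    using char0[of "z - z'"] that by (simp add: minus_eq r_neg)
  define I where "I = {\<guillemotleft>z\<guillemotright> | z. q dvd z}"
  define N where "N = {\<guillemotleft>z\<guillemotright> | z. \<not> q dvd z}"
  have I: "submod R ?P I"
  proof (rule submodI)
    show "I \<subseteq> carrier R" unfolding I_def by auto
    show "\<zero> \<in> I" unfolding I_def by (intro CollectI exI[of _ 0]) simp
    fix x assume "x \<in> I"
    then obtain z where z: "x = \<guillemotleft>z\<guillemotright>" "q dvd z" unfolding I_def by blast
    show "x \<oplus> y \<in> I" if yI: "y \<in> I" for y
    proof -
      obtain z' where z': "y = \<guillemotleft>z'\<guillemotright>" "q dvd z'" using yI unfolding I_def by blast
      show ?thesis unfolding I_def using z z' by (intro CollectI exI[of _ "z + z'"]) simp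
    qed
    show "k \<otimes> x \<in> I" if "k \<in> ?P" for k
    proof -
      obtain z' where z': "k = \<guillemotleft>z'\<guillemotright>" using \<open>k \<in> ?P\<close> by blast
      show ?thesis unfolding I_def using z z' by (intro CollectI exI[of _ "z' * z"]) simp
    qed
  qed
  have disj: "I \<inter> N = {}" unfolding I_def N_def using inj by blast
  have IP: "I \<subseteq> ?P" "N \<subseteq> ?P" "\<guillemotleft>q\<guillemotright> \<in> I" unfolding I_def N_def by auto
  have "\<guillemotleft>1\<guillemotright> \<in> N" unfolding N_def using q not_prime_unit by blast
  then have N1: "\<one> \<in> N" by simp
  have Nm: "s \<otimes> t \<in> N" if st: "s \<in> N" "t \<in> N" for s t
  proof -
    obtain z where z: "s = \<guillemotleft>z\<guillemotright>" "\<not> q dvd z" using st(1) unfolding N_def by blast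
    obtain z' where z': "t = \<guillemotleft>z'\<guillemotright>" "\<not> q dvd z'" using st(2) unfolding N_def by blast
    show ?thesis unfolding N_def using z z' q
      by (intro CollectI exI[of _ "z * z'"]) (simp add: prime_dvd_mult_iff)
  qed
  have split: "\<exists>(j::nat). \<exists>c\<in>N. d = \<guillemotleft>q\<guillemotright> [^] j \<otimes> c" if d: "d \<in> ?P" "d \<noteq> \<zero>" for d
  proof -
    obtain z where z: "d = \<guillemotleft>z\<guillemotright>" using d(1) by blast
    then have "z \<noteq> 0" using d(2) by auto
    then obtain y where y: "z = q ^ multiplicity q z * y" "\<not> q dvd y"
      using multiplicity_decompose'[of z q] q not_prime_unit by blast
    have "d = \<guillemotleft>q\<guillemotright> [^] multiplicity q z \<otimes> \<guillemotleft>y\<guillemotright>"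
      using y(1) z by (metis of_int_mult of_int_power)
    then show ?thesis using y(2) unfolding N_def by blast
  qed
  have alg': "\<exists>n::nat. \<exists>d\<in>?P. d \<noteq> \<zero> \<and> d \<otimes> a [^] n \<in> Span ?P (pows R a n)" if "a \<in> carrier R" for a
    using alg[OF that] unfolding algebraic_over_def .
  show ?thesis
  proof (rule exists_maximal_subring_avoiding_inverse[OF P of_int_closed v I IP(1) disj IP(3,2) N1 Nm split alg'])
    fix S M assume "maximal_subring M R" "v \<notin> M"
    then show ?thesis by blast
  qed
qed

text \<open>x^2 - x + 1 = 1 + (x - 1) x, so \<open>W (Suc i)\<close> is 1 modulo \<open>W i\<close>;
  and 1 is a fixed point of the recursion, so all later terms are 1 modulo \<open>W i\<close> as
  well.\<close>

lemma (in cring) quadratic_sequence: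
  fixes W :: "nat \<Rightarrow> 'a"
  assumes B: "subring B R" and W: "\<And>i. W (Suc i) = W i \<otimes> W i \<ominus> W i \<oplus> \<one>" and i: "W i \<in> B" and less: "i < j"
  shows "W j \<in> B \<and> (\<exists>g\<in>B. W j = \<one> \<oplus> g \<otimes> W i)"
  using less
proof (induction j)
  case (Suc j)
  have c: "x \<in> carrier R" if "x \<in> B" for x using that subringE(1)[OF B] by blast
  show ?case
  proof (cases "i = j")
    case True
    have "W i \<ominus> \<one> \<in> B" using subring_minus[OF B i] subringE(3)[OF B] by blast
    moreover have "W i \<otimes> W i \<ominus> W i \<oplus> \<one> = \<one> \<oplus> (W i \<ominus> \<one>) \<otimes> W i"
    proof -
      have "x \<otimes> x \<ominus> x \<oplus> \<one> = \<one> \<oplus> (x \<ominus> \<one>) \<otimes> x" if "x \<in> carrier R" for x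
        using that by algebra
      from this[OF c[OF i]] show ?thesis .
    qed
    ultimately show ?thesis using W[of i] True subringE(3,6,7)[OF B] i by metis
  next
    case False
    then obtain g where g: "W j \<in> B" "g \<in> B" "W j = \<one> \<oplus> g \<otimes> W i" using Suc by auto
    have "x \<otimes> x \<ominus> x \<oplus> \<one> = \<one> \<oplus> (x \<otimes> g) \<otimes> y" if "x = \<one> \<oplus> g \<otimes> y" "x \<in> B" "y \<in> B" for x y
    proof -
      have "x \<otimes> x \<ominus> x \<oplus> \<one> = \<one> \<oplus> x \<otimes> (x \<ominus> \<one>)"
        using c[OF that(2)] by algebra
      also have "x \<ominus> \<one> = g \<otimes> y"
        unfolding that(1) using c[OF g(2)] c[OF that(3)] by algebra
      finally show ?thesis using c[OF that(2)] c[OF g(2)] c[OF that(3)] by (simp add: m_assoc)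
    qed
    from this[OF g(3,1) i] have "W (Suc j) = \<one> \<oplus> (W j \<otimes> g) \<otimes> W i" using W by simp
    then show ?thesis using subringE(3,6,7)[OF B] g i by metis
  qed
qed simp

lemma (in domain) all_algebraic_over_prime_ring:
  assumes semi: "semilocal R" and fin: "finite (maximal_subrings R)" and x: "x \<in> carrier R"
  shows "algebraic_over R (range (of_integer R)) x"
proof (rule ccontr)
  assume tr: "\<not> algebraic_over R (range (of_integer R)) x"
  let ?P = "range (of_integer R)"
  note P = subring_range_of_integer
  define W where "W n = ((\<lambda>y. y \<otimes> y \<ominus> y \<oplus> \<one>) ^^ n) x" for n :: nat
  have W0: "W 0 = x" and WS: "W (Suc i) = W i \<otimes> W i \<ominus> W i \<oplus> \<one>" for i unfolding W_def by simp_all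
  note G = subring_adj[OF P x]
  have WG: "W i \<in> B" if "subring B R" "x \<in> B" for i B
    using quadratic_sequence[of B W 0 i, OF that(1) WS] that(2) W0 by (cases "i = 0") auto
  have Wc: "W i \<in> carrier R" for i using WG[OF carrier_is_subring x] .
  have Wtr: "\<not> algebraic_over R ?P (W i)" for i
  proof (induction i)
    case 0
    then show ?case using tr W0 by simp
  next
    case (Suc i)
    then show ?case using algebraic_over_quadratic[OF P Wc, of i] WS by metis
  qed
  have "infinite (maximal_subrings R)"
  proof (rule infinite_maximal_subrings_of_units[OF semi G(1)])
    show "W i \<in> adj R ?P x" for i using WG[OF G(1,3)] .
    show "\<exists>g\<in>adj R ?P x. \<exists>h\<in>adj R ?P x. g \<otimes> W i \<oplus> h \<otimes> W j = \<one>" if ij: "i < j" for i j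
    proof -
      obtain g where g: "g \<in> adj R ?P x" "W j = \<one> \<oplus> g \<otimes> W i"
        using quadratic_sequence[where W = W, OF G(1) WS WG[OF G(1,3)] ij] by blast
      have gc: "g \<in> carrier R" using g(1) subringE(1)[OF G(1)] by blast
      have "(\<ominus> g) \<otimes> y \<oplus> \<one> \<otimes> (\<one> \<oplus> g \<otimes> y) = \<one>" if "y \<in> carrier R" for y
        using that gc by algebra
      from this[OF Wc[of i]] have "(\<ominus> g) \<otimes> W i \<oplus> \<one> \<otimes> W j = \<one>" using g(2) by simp
      then show ?thesis using subringE(3,5)[OF G(1)] g(1) by blast
    qed
    fix i v assume v: "v \<in> carrier R" "W i \<otimes> v = \<one>"
    obtain S M where S: "subring S R" "W i \<in> S" "S \<subseteq> M" "maximal_subring M R" "v \<notin> M"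
      "\<And>a n. a \<in> carrier R \<Longrightarrow> a [^] (n::nat) \<in> Span S (pows R a n) \<Longrightarrow> a \<in> S"
      using exists_maximal_subring_transcendental[OF Wc v Wtr] by blast
    \<comment> \<open>\<open>W j\<close> is a root of the monic polynomial X^2 - X + 1 - W (j+1),
      and \<open>S\<close> contains the elements integral over it; so membership descends from
      \<open>W i\<close> to W 0 = x, and every maximal subring obtained here contains Z[x].\<close>
    have "W j \<in> S" if "j \<le> i" for j
      using that
    proof (induction rule: inc_induct)
      case base
      then show ?case using S(2) .
    next
      case (step j)
      let ?V = "Span S (pows R (W j) 2)"
      have V: "submod R S ?V"
        using submod_Span_pows[OF submod_self[OF S(1)] subringE(1)[OF S(1)] Wc] .
      have in_V: "W j [^] (k::nat) \<in> ?V" if "k < 2" for k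
        using Span_incl_one[OF S(1) pows_carrier[OF Wc], of "W j [^] k" j 2] that by (auto simp: set_pows)
      have "y [^] (2::nat) = (y \<otimes> y \<ominus> y \<oplus> \<one> \<ominus> \<one>) \<otimes> y [^] (0::nat) \<oplus> y [^] (1::nat)" if "y \<in> carrier R" for y
      proof -
        have "y \<otimes> y = (y \<otimes> y \<ominus> y \<oplus> \<one> \<ominus> \<one>) \<otimes> \<one> \<oplus> y" using that by algebra
        then show ?thesis using that by (simp add: numeral_2_eq_2)
      qed
      from this[OF Wc[of j]]
      have "W j [^] (2::nat) = (W (Suc j) \<ominus> \<one>) \<otimes> W j [^] (0::nat) \<oplus> W j [^] (1::nat)" using WS by simp
      moreover have "W (Suc j) \<ominus> \<one> \<in> S" using subring_minus[OF S(1) step.IH subringE(3)[OF S(1)]] .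
      ultimately have "W j [^] (2::nat) \<in> ?V"
        using submodD(3)[OF V submodD(4)[OF V]] in_V[of 0] in_V[of 1] by simp
      then show ?case using S(6)[OF Wc] by blast
    qed
    then have "x \<in> S" using W0 by (metis le0)
    then have "adj R ?P x \<subseteq> S" using adj_least[OF S(1) of_integer_in_subring[OF S(1)]] by blast
    then show "\<exists>M. maximal_subring M R \<and> adj R ?P x \<subseteq> M \<and> v \<notin> M" using S(3-5) by blast
  qed
  then show False using fin by blast
qed

text \<open>In characteristic zero the prime numbers would be the comaximal elements: their Bezout
  coefficients lie in the prime ring, which is contained in every subring.\<close>

lemma (in domain) of_integer_not_injective:
  assumes semi: "semilocal R" and fin: "finite (maximal_subrings R)"
  shows "\<exists>z. z \<noteq> 0 \<and> \<guillemotleft>z\<guillemotright> = \<zero>"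
proof (rule ccontr)
  assume "\<not> (\<exists>z. z \<noteq> 0 \<and> \<guillemotleft>z\<guillemotright> = \<zero>)"
  then have char0: "\<And>z. \<guillemotleft>z\<guillemotright> = \<zero> \<Longrightarrow> z = 0" by blast
  let ?P = "range (of_integer R)"
  define q :: "nat \<Rightarrow> int" where "q i = int (enumerate {p::nat. Factorial_Ring.prime p} i)" for i
  have q: "Factorial_Ring.prime (q i)" for i
    using enumerate_in_set[OF primes_infinite, of i] unfolding q_def by simp
  have qlt: "q i < q j" if "i < j" for i j
    using enumerate_mono[OF that primes_infinite] unfolding q_def by simp
  have "infinite (maximal_subrings R)"
  proof (rule infinite_maximal_subrings_of_units[OF semi subring_range_of_integer])
    show "\<guillemotleft>q i\<guillemotright> \<in> ?P" for i by blast
    show "\<exists>g\<in>?P. \<exists>h\<in>?P. g \<otimes> \<guillemotleft>q i\<guillemotright> \<oplus> h \<otimes> \<guillemotleft>q j\<guillemotright> = \<one>" if "i < j" for i j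
    proof -
      have "coprime (q i) (q j)" using primes_coprime[OF q q, of i j] qlt[OF that] by simp
      then obtain g h where "g * q i + h * q j = 1" using bezout_int[of "q i" "q j"] by auto
      then have "\<guillemotleft>g * q i + h * q j\<guillemotright> = \<one>" by (simp del: of_int_add of_int_mult)
      then have "\<guillemotleft>g\<guillemotright> \<otimes> \<guillemotleft>q i\<guillemotright> \<oplus> \<guillemotleft>h\<guillemotright> \<otimes> \<guillemotleft>q j\<guillemotright> = \<one>" by simp
      then show ?thesis by blast
    qed
    fix i v assume v: "v \<in> carrier R" "\<guillemotleft>q i\<guillemotright> \<otimes> v = \<one>"
    obtain M where M: "maximal_subring M R" "v \<notin> M"
      using exists_maximal_subring_prime[OF char0 all_algebraic_over_prime_ring[OF semi fin] q v] by blast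
    moreover have "?P \<subseteq> M" using of_integer_in_subring M(1) unfolding maximal_subring_def by blast
    ultimately show "\<exists>M. maximal_subring M R \<and> ?P \<subseteq> M \<and> v \<notin> M" by blast
  qed
  then show False using fin by blast
qed

section \<open>From algebraic elements to roots of unity\<close>

lemma (in cring) finite_Span:
  assumes "finite K" shows "finite (Span K us)"
proof (induction us)
  case Nil
  then show ?case by (simp add: Span_Nil)
next
  case (Cons u us)
  have "Span K (u # us) \<subseteq> (\<lambda>(k, y). k \<otimes> u \<oplus> y) ` (K \<times> Span K us)"
    by (auto elim!: Span_ConsE)
  then show ?case using assms Cons by (meson finite_SigmaI finite_imageI finite_subset)
qed

lemma (in domain) finite_range_of_integer:
  assumes "z \<noteq> 0" "\<guillemotleft>z\<guillemotright> = \<zero>"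
  shows "finite (range (of_integer R))"
proof -
  have "range (of_integer R) \<subseteq> of_integer R ` {0..<\<bar>z\<bar>}"
  proof
    fix y assume "y \<in> range (of_integer R)"
    then obtain k where k: "y = \<guillemotleft>k\<guillemotright>" by blast
    have z: "\<guillemotleft>\<bar>z\<bar>\<guillemotright> = \<zero>" using assms(2) by (cases "z \<ge> 0") simp_all
    have "\<guillemotleft>k\<guillemotright> = \<guillemotleft>(k div \<bar>z\<bar>) * \<bar>z\<bar> + k mod \<bar>z\<bar>\<guillemotright>" by simp
    also have "\<dots> = \<guillemotleft>k mod \<bar>z\<bar>\<guillemotright>" unfolding of_int_add of_int_mult z by simp
    finally show "y \<in> of_integer R ` {0..<\<bar>z\<bar>}" using k assms(1) by auto
  qed
  then show ?thesis using finite_subset by blast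
qed

lemma (in monoid) nat_pow_eq_of_finite:
  assumes "finite A" "\<And>n::nat. x [^] n \<in> A"
  shows "\<exists>a b :: nat. b < a \<and> x [^] a = x [^] b"
proof -
  have "\<not> inj (\<lambda>n::nat. x [^] n)"
    using assms finite_subset[of "range (\<lambda>n::nat. x [^] n)" A] finite_imageD[of "\<lambda>n::nat. x [^] n" UNIV]
      infinite_UNIV_nat by blast
  then obtain a b :: nat where "a \<noteq> b" "x [^] a = x [^] b" unfolding inj_def by blast
  then consider "b < a \<and> x [^] a = x [^] b" | "a < b \<and> x [^] b = x [^] a" by fastforce
  then show ?thesis by cases blast+
qed

lemma (in domain) nat_pow_eq_one:
  assumes "x \<in> carrier R" "x \<noteq> \<zero>" "b < a" "x [^] a = x [^] (b::nat)"
  shows "x [^] (a - b) = \<one>"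
proof -
  have "x [^] b \<otimes> x [^] (a - b) = x [^] b \<otimes> \<one>"
    using assms by (simp add: nat_pow_mult)
  then show ?thesis using m_lcancel[of "x [^] b" "x [^] (a - b)" \<one>] assms(1,2) by simp
qed

text \<open>The prime ring is a finite domain, so the leading coefficient of a relation for
  \<open>x\<close> is a root of unity and the relation can be made monic. All powers of
  \<open>x\<close> then lie in one finite span, so two of them coincide.\<close>

theorem (in domain) nat_pow_eq_of_finite_maximal_subrings:
  assumes semi: "semilocal R" and fin: "finite (maximal_subrings R)" and x: "x \<in> carrier R"
  shows "\<exists>a b :: nat. b < a \<and> x [^] a = x [^] b"
proof -
  let ?P = "range (of_integer R)"
  note P = subring_range_of_integer
  have finP: "finite ?P" using of_integer_not_injective[OF semi fin] finite_range_of_integer by blast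
  obtain n :: nat and c where c: "c \<in> ?P" "c \<noteq> \<zero>" "c \<otimes> x [^] n \<in> Span ?P (pows R x n)"
    using all_algebraic_over_prime_ring[OF semi fin x] unfolding algebraic_over_def by blast
  have cc: "c \<in> carrier R" using c(1) subringE(1)[OF P] by blast
  have powP: "c [^] k \<in> ?P" for k :: nat using nat_pow_in_subring[OF P c(1)] .
  obtain a b :: nat where ab: "b < a" "c [^] a = c [^] b" using nat_pow_eq_of_finite[OF finP powP] by blast
  moreover have "a - b = Suc (a - b - 1)" using ab(1) by simp
  ultimately have "c [^] Suc (a - b - 1) = \<one>" using nat_pow_eq_one[OF cc c(2) ab] by metis
  let ?V = "\<lambda>n. Span ?P (pows R x n)"
  have V: "submod R ?P (?V n)" for n using submod_Span_pows[OF submod_self[OF P] subringE(1)[OF P] x] .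
  have "x [^] n = c [^] (a - b - 1) \<otimes> (c \<otimes> x [^] n)"
    using \<open>c [^] Suc (a - b - 1) = \<one>\<close> cc x by (simp add: m_assoc[symmetric])
  also have "\<dots> \<in> ?V n" using submodD(4)[OF V powP c(3)] .
  finally have xn: "x [^] n \<in> ?V n" .
  have "x [^] k \<in> ?V n" for k :: nat
  proof (induction k)
    case 0
    show ?case
    proof (cases n)
      case 0
      then show ?thesis using xn by simp
    next
      case (Suc m)
      then have "x [^] (0::nat) \<in> set (pows R x n)" unfolding set_pows by blast
      then show ?thesis using Span_incl_one[OF P pows_carrier[OF x]] by blast
    qed
  next
    case (Suc k)
    have "x \<otimes> (x [^] k) \<in> ?V n"
    proof (rule Span_mult_image[OF x _ subringE(1)[OF P] pows_carrier[OF x] _ Suc])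
      show "submod R {} (?V n)" using submod_mono[OF V] by simp
      fix p u assume p: "p \<in> ?P" and "u \<in> set (pows R x n)"
      then obtain i where i: "i < n" "u = x [^] i" by (auto simp: set_pows)
      have pc: "p \<in> carrier R" using p subringE(1)[OF P] by blast
      have "x [^] Suc i \<in> ?V n"
      proof (cases "Suc i = n")
        case True
        then show ?thesis using xn by simp
      next
        case False
        then have "x [^] Suc i \<in> set (pows R x n)" using i(1) unfolding set_pows by (intro imageI) simp
        then show ?thesis using Span_incl_one[OF P pows_carrier[OF x]] by blast
      qed
      then have "p \<otimes> x [^] Suc i \<in> ?V n" using submodD(4)[OF V p] by blast
      then show "x \<otimes> (p \<otimes> u) \<in> ?V n" unfolding i(2) using pc x by (simp add: m_ac)
    qed
    then show ?case using x by (simp add: m_comm)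
  qed
  then show ?thesis using nat_pow_eq_of_finite[OF finite_Span[OF finP]] by blast
qed


section \<open>Power torsion rings\<close>

lemma (in cring) quot_hom:
  assumes "ideal I R"
  shows "ring_hom_cring R (R Quot I) ((+>) I)" "ring_hom_ring R (R Quot I) ((+>) I)"
    "((+>) I) ` carrier R = carrier (R Quot I)"
    "{x \<in> carrier R. I +> x = \<zero>\<^bsub>R Quot I\<^esub>} = I"
    "\<And>x y. x \<in> carrier R \<Longrightarrow> y \<in> carrier R \<Longrightarrow> I +> x = I +> y \<longleftrightarrow> x \<ominus> y \<in> I"
proof -
  interpret I: ideal I R by fact
  show "ring_hom_cring R (R Quot I) ((+>) I)" using I.rcos_ring_hom_cring is_cring by blast
  show hr: "ring_hom_ring R (R Quot I) ((+>) I)" using I.rcos_ring_hom_ring .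
  show "((+>) I) ` carrier R = carrier (R Quot I)"
    unfolding FactRing_def A_RCOSETS_def' by auto
  show "\<And>x y. x \<in> carrier R \<Longrightarrow> y \<in> carrier R \<Longrightarrow> I +> x = I +> y \<longleftrightarrow> x \<ominus> y \<in> I"
    using quotient_eq_iff_same_a_r_cos[OF assms] by blast
  show "{x \<in> carrier R. I +> x = \<zero>\<^bsub>R Quot I\<^esub>} = I"
  proof -
    have z: "\<zero>\<^bsub>R Quot I\<^esub> = I" unfolding FactRing_def by simp
    show ?thesis unfolding z
      using a_coset_join1[of I] a_coset_join2[of _ I] I.a_subgroup I.a_subset by blast
  qed
qed

text \<open>The multiplicative set generated by the x^a - x^b with b < a. Products are needed
  because the exponents may differ from one prime ideal to the next.\<close>

inductive_set power_differences :: "('a, 'b) ring_scheme \<Rightarrow> 'a \<Rightarrow> 'a set" for R x where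
  one: "\<one>\<^bsub>R\<^esub> \<in> power_differences R x"
| step: "s \<in> power_differences R x \<Longrightarrow> (b::nat) < a \<Longrightarrow>
    s \<otimes>\<^bsub>R\<^esub> (x [^]\<^bsub>R\<^esub> a \<ominus>\<^bsub>R\<^esub> x [^]\<^bsub>R\<^esub> b) \<in> power_differences R x"

text \<open>Equivalently, every element of every quotient by a prime ideal is zero or a root of unity;
  in this form the property visibly passes to subrings and gives integrality over the prime
  ring.\<close>

definition power_torsion :: "('a, 'b) ring_scheme \<Rightarrow> bool" where
  "power_torsion R \<longleftrightarrow> (\<forall>x\<in>carrier R. \<zero>\<^bsub>R\<^esub> \<in> power_differences R x)"

lemma (in cring) power_differences_carrier:
  assumes "x \<in> carrier R" "s \<in> power_differences R x" shows "s \<in> carrier R"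
  using assms(2) by induction (use assms(1) in auto)

lemma (in cring) power_differences_mult:
  assumes x: "x \<in> carrier R" and t: "t \<in> power_differences R x" and s: "s \<in> power_differences R x"
  shows "s \<otimes> t \<in> power_differences R x"
  using t
proof induction
  case one
  then show ?case using s power_differences_carrier[OF x s] by simp
next
  case (step t b a)
  have "s \<otimes> (t \<otimes> (x [^] a \<ominus> x [^] b)) = (s \<otimes> t) \<otimes> (x [^] a \<ominus> x [^] b)"
    using power_differences_carrier[OF x] s step.hyps(1) x by (simp add: m_assoc)
  then show ?case using power_differences.step[OF step.IH step.hyps(2)] by simp
qed

lemma (in cring) primeideal_power_differences:
  assumes x: "x \<in> carrier R" and P: "primeideal P R" and s: "s \<in> power_differences R x" "s \<in> P"
  shows "\<exists>a b::nat. b < a \<and> x [^] a \<ominus> x [^] b \<in> P"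
  using s
proof induction
  case one
  then show ?case using primeideal.I_notcarr[OF P] ideal.one_imp_carrier primeideal.axioms(1)[OF P] by blast
next
  case (step s b a)
  have "s \<in> P \<or> x [^] a \<ominus> x [^] b \<in> P"
    using primeideal.I_prime[OF P _ _ step.prems] power_differences_carrier[OF x step.hyps(1)] x by simp
  then show ?case using step by blast
qed

text \<open>A multiplicative set that misses zero is disjoint from some prime, against the
  assumption at that prime. This merges the exponents of all primes into one product.\<close>

lemma (in cring) power_torsionI:
  assumes "\<And>P x. primeideal P R \<Longrightarrow> x \<in> carrier R \<Longrightarrow> \<exists>a b::nat. b < a \<and> x [^] a \<ominus> x [^] b \<in> P"
  shows "power_torsion R"
  unfolding power_torsion_def
proof (intro ballI, rule ccontr)
  fix x assume x: "x \<in> carrier R" and "\<zero> \<notin> power_differences R x"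
  then have d: "{\<zero>} \<inter> power_differences R x = {}" by blast
  obtain P where P: "primeideal P R" "P \<inter> power_differences R x = {}"
  proof (rule exists_primeideal_disjoint[OF zeroideal d _ power_differences.one])
    show "power_differences R x \<subseteq> carrier R" using power_differences_carrier[OF x] by blast
    show "\<And>s t. s \<in> power_differences R x \<Longrightarrow> t \<in> power_differences R x \<Longrightarrow> s \<otimes> t \<in> power_differences R x"
      using power_differences_mult[OF x] .
  qed
  obtain a b :: nat where ab: "b < a" "x [^] a \<ominus> x [^] b \<in> P" using assms[OF P(1) x] by blast
  have "\<one> \<otimes> (x [^] a \<ominus> x [^] b) \<in> power_differences R x"
    using power_differences.step[OF power_differences.one ab(1)] .
  then show False using ab(2) P(2) x by auto
qed

lemma (in cring) power_torsionD:
  assumes "power_torsion R" "primeideal P R" "x \<in> carrier R"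
  shows "\<exists>a b::nat. b < a \<and> x [^] a \<ominus> x [^] b \<in> P"
  using primeideal_power_differences[OF assms(3,2)] assms(1,3)
    idealD(3) primeideal.axioms(1)[OF assms(2)] unfolding power_torsion_def by blast

lemma (in cring) subring_a_inv:
  assumes "subring K R" "x \<in> K" shows "\<ominus>\<^bsub>R\<lparr>carrier := K\<rparr>\<^esub> x = \<ominus> x"
proof -
  interpret K: cring "R\<lparr>carrier := K\<rparr>" using subring_cring[OF assms(1)] .
  have "x \<in> carrier R" using assms subringE(1) by blast
  then show ?thesis
    using K.minus_equality[of "\<ominus> x" x] subringE(5)[OF assms] assms(2) by (simp add: l_neg)
qed

lemma (in cring) subring_a_minus:
  assumes "subring K R" "x \<in> K" "y \<in> K" shows "x \<ominus>\<^bsub>R\<lparr>carrier := K\<rparr>\<^esub> y = x \<ominus> y"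
  using subring_a_inv[OF assms(1,3)] by (simp add: a_minus_def)

lemma (in cring) subring_nat_pow: "x [^]\<^bsub>R\<lparr>carrier := K\<rparr>\<^esub> (n::nat) = x [^] n"
  by (simp add: nat_pow_def)

lemma (in cring) power_torsion_subring:
  assumes "power_torsion R" "subring K R"
  shows "power_torsion (R\<lparr>carrier := K\<rparr>)"
  unfolding power_torsion_def
proof
  fix x assume "x \<in> carrier (R\<lparr>carrier := K\<rparr>)"
  then have x: "x \<in> K" by simp
  have "s \<in> power_differences (R\<lparr>carrier := K\<rparr>) x" if "s \<in> power_differences R x" for s
    using that
  proof induction
    case one
    show ?case using power_differences.one[of "R\<lparr>carrier := K\<rparr>" x] by simp
  next
    case (step s b a)
    have "x [^] a \<in> K" "x [^] b \<in> K" using nat_pow_in_subring[OF assms(2) x] by auto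
    then show ?case
      using power_differences.step[OF step.IH step.hyps(2)] subring_a_minus[OF assms(2)]
      by (simp add: subring_nat_pow)
  qed
  then show "\<zero>\<^bsub>R\<lparr>carrier := K\<rparr>\<^esub> \<in> power_differences (R\<lparr>carrier := K\<rparr>) x"
    using assms(1) x subringE(1)[OF assms(2)] unfolding power_torsion_def by auto
qed

text \<open>x^a - x^b = - x^b (1 - x^(a-b-1) x), so for \<open>x\<close> outside \<open>P\<close>
  the power x^(a-b-1) is an inverse modulo \<open>P\<close>.\<close>

lemma (in cring) torsion_primeideal_maximal:
  assumes P: "primeideal P R"
    and tor: "\<And>x. x \<in> carrier R \<Longrightarrow> \<exists>a b::nat. b < a \<and> x [^] a \<ominus> x [^] b \<in> P"
  shows "maximalideal P R"
proof (rule maximalidealI_inverse)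
  have Pi: "ideal P R" using primeideal.axioms(1)[OF P] .
  then show "ideal P R" .
  show "\<one> \<notin> P" using primeideal.I_notcarr[OF P] ideal.one_imp_carrier[OF Pi] by blast
  fix x assume x: "x \<in> carrier R" "x \<notin> P"
  obtain a b :: nat where ab: "b < a" "x [^] a \<ominus> x [^] b \<in> P" using tor[OF x(1)] by blast
  have xb: "x [^] n \<notin> P" for n :: nat
  proof (induction n)
    case 0
    then show ?case using \<open>\<one> \<notin> P\<close> by simp
  next
    case (Suc n)
    then show ?case using primeideal.I_prime[OF P, of "x [^] n" x] x by auto
  qed
  define c where "c = a - b - 1"
  have a: "a = b + c + 1" using ab(1) unfolding c_def by simp
  have "u \<otimes> v \<otimes> x \<ominus> u = \<ominus> (u \<otimes> (\<one> \<ominus> v \<otimes> x))" if "u \<in> carrier R" "v \<in> carrier R" for u v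
    using that x(1) by algebra
  from this[of "x [^] b" "x [^] c"]
  have "x [^] a \<ominus> x [^] b = \<ominus> (x [^] b \<otimes> (\<one> \<ominus> x [^] c \<otimes> x))" using x(1) a by (simp add: nat_pow_mult)
  then have "\<ominus> (\<ominus> (x [^] b \<otimes> (\<one> \<ominus> x [^] c \<otimes> x))) \<in> P" using idealD(7)[OF Pi ab(2)] by simp
  then have "x [^] b \<otimes> (\<one> \<ominus> x [^] c \<otimes> x) \<in> P" using x(1) by simp
  then have "\<one> \<ominus> x [^] c \<otimes> x \<in> P" using primeideal.I_prime[OF P, of "x [^] b" "\<one> \<ominus> x [^] c \<otimes> x"] xb x(1) by auto
  then show "\<exists>r\<in>carrier R. \<one> \<ominus> r \<otimes> x \<in> P" using x(1) by (intro bexI[of _ "x [^] c"]) auto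
qed

lemma (in cring) power_torsion_prime_maximal:
  assumes "power_torsion R" "primeideal P R" shows "maximalideal P R"
  using torsion_primeideal_maximal[OF assms(2)] power_torsionD[OF assms] by blast

section \<open>Zero-dimensionality and contraction of primes\<close>

lemma zero_dimensional_iff:
  "zero_dimensional R \<longleftrightarrow> (\<forall>P Q. primeideal P R \<longrightarrow> primeideal Q R \<longrightarrow> P \<subseteq> Q \<longrightarrow> P = Q)"
proof
  assume "zero_dimensional R"
  then have 0: "x = 0" if "x \<in> {enat n | n. \<exists>P :: nat \<Rightarrow> 'a set.
     (\<forall>i\<le>n. primeideal (P i) R) \<and> (\<forall>i<n. P i \<subset> P (Suc i))}" for x
    using that Sup_upper[OF that] unfolding zero_dimensional_def krull_dim_def by simp
  show "\<forall>P Q. primeideal P R \<longrightarrow> primeideal Q R \<longrightarrow> P \<subseteq> Q \<longrightarrow> P = Q"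
  proof (intro allI impI, rule ccontr)
    fix P Q assume *: "primeideal P R" "primeideal Q R" "P \<subseteq> Q" "P \<noteq> Q"
    define F where "F i = (if i = 0 then P else Q)" for i :: nat
    have "(\<forall>i\<le>1. primeideal (F i) R) \<and> (\<forall>i<1. F i \<subset> F (Suc i))"
      unfolding F_def using * by auto
    then have "enat 1 = 0" by (intro 0 CollectI exI[of _ "1::nat"] conjI exI[of _ F]) auto
    then show False by (simp add: enat_0_iff)
  qed
next
  assume *: "\<forall>P Q. primeideal P R \<longrightarrow> primeideal Q R \<longrightarrow> P \<subseteq> Q \<longrightarrow> P = Q"
  have "x \<le> 0" if xn: "x \<in> {enat n | n. \<exists>P :: nat \<Rightarrow> 'a set.
     (\<forall>i\<le>n. primeideal (P i) R) \<and> (\<forall>i<n. P i \<subset> P (Suc i))}" for x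
  proof -
    obtain n P where P: "x = enat n" "\<forall>i\<le>n. primeideal (P i) R" "\<forall>i<n. P i \<subset> P (Suc i)" using xn by blast
    have "n = 0"
    proof (rule ccontr)
      assume "n \<noteq> 0"
      then have "primeideal (P 0) R" "primeideal (P 1) R" "P 0 \<subset> P 1" using P(2,3) by auto
      then show False using * by blast
    qed
    then show ?thesis using P(1) by (simp add: enat_0)
  qed
  then have "krull_dim R \<le> 0" unfolding krull_dim_def by (rule Sup_least)
  then show "zero_dimensional R" unfolding zero_dimensional_def by simp
qed

lemma (in cring) power_torsion_zero_dimensional:
  assumes "power_torsion R" shows "zero_dimensional R"
  unfolding zero_dimensional_iff
proof (intro allI impI)
  fix P Q assume *: "primeideal P R" "primeideal Q R" "P \<subseteq> Q"
  then show "P = Q"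
    using maximalideal_subset_eq power_torsion_prime_maximal[OF assms] by blast
qed

text \<open>A prime of \<open>R\<close> disjoint from \<open>K - Q\<close> contracts to a prime
  inside \<open>Q\<close>, and equality follows because \<open>K\<close> inherits power torsion and
  so has dimension zero.\<close>

lemma (in cring) power_torsion_prime_lift:
  assumes "power_torsion R" "subring K R" "primeideal Q (R\<lparr>carrier := K\<rparr>)"
  obtains P where "primeideal P R" "P \<inter> K = Q"
proof -
  interpret K: cring "R\<lparr>carrier := K\<rparr>" using subring_cring[OF assms(2)] .
  have Qi: "ideal Q (R\<lparr>carrier := K\<rparr>)" using primeideal.axioms(1)[OF assms(3)] .
  have QK: "Q \<subseteq> K" "\<zero> \<in> Q" using K.idealD(1,3)[OF Qi] by auto
  have one: "\<one> \<notin> Q" using primeideal.I_notcarr[OF assms(3)] ideal.one_imp_carrier[OF Qi] by auto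
  have d: "{\<zero>} \<inter> (K - Q) = {}" using QK by blast
  obtain P where P: "primeideal P R" "P \<inter> (K - Q) = {}"
  proof (rule exists_primeideal_disjoint[OF zeroideal d])
    show "K - Q \<subseteq> carrier R" using subringE(1)[OF assms(2)] by blast
    show "\<one> \<in> K - Q" using one subringE(3)[OF assms(2)] by blast
    show "x \<otimes> y \<in> K - Q" if "x \<in> K - Q" "y \<in> K - Q" for x y
      using primeideal.I_prime[OF assms(3), of x y] subringE(6)[OF assms(2), of x y] that by auto
  qed
  have "primeideal (P \<inter> K) (R\<lparr>carrier := K\<rparr>)" using primeideal_restrict[OF P(1) assms(2)] .
  moreover have "P \<inter> K \<subseteq> Q" using P(2) by blast
  ultimately have "P \<inter> K = Q"
    using K.power_torsion_zero_dimensional[OF power_torsion_subring[OF assms(1,2)]] assms(3)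
    unfolding zero_dimensional_iff by blast
  then show ?thesis using that P(1) by blast
qed

lemma (in cring) power_torsion_semilocal_subring:
  assumes "power_torsion R" "subring K R" "semilocal R"
  shows "semilocal (R\<lparr>carrier := K\<rparr>)"
proof -
  interpret K: cring "R\<lparr>carrier := K\<rparr>" using subring_cring[OF assms(2)] .
  have "{Q. maximalideal Q (R\<lparr>carrier := K\<rparr>)} \<subseteq> (\<lambda>P. P \<inter> K) ` {P. maximalideal P R}"
  proof
    fix Q assume "Q \<in> {Q. maximalideal Q (R\<lparr>carrier := K\<rparr>)}"
    then have "primeideal Q (R\<lparr>carrier := K\<rparr>)" using K.maximalideal_prime by blast
    then obtain P where "primeideal P R" "P \<inter> K = Q" using power_torsion_prime_lift[OF assms(1,2)] by blast
    then show "Q \<in> (\<lambda>P. P \<inter> K) ` {P. maximalideal P R}"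
      using power_torsion_prime_maximal[OF assms(1)] by blast
  qed
  then show ?thesis using assms(3) unfolding semilocal_def by (meson finite_imageI finite_subset)
qed

section \<open>Deriving power torsion from the cases of the theorem\<close>

lemma (in cring) finite_maximal_subrings_quot:
  assumes "ideal I R" "finite (maximal_subrings R)"
  shows "finite (maximal_subrings (R Quot I))"
  using ring_hom_ring.finite_maximal_subrings_iff[OF quot_hom(2,3)[OF assms(1)]] assms(2) by simp

lemma (in cring) torsion_mod_prime:
  assumes fin: "finite (maximal_subrings R)" and P: "primeideal P R"
    and finM: "finite {M. maximalideal M R \<and> P \<subseteq> M}" and x: "x \<in> carrier R"
  shows "\<exists>a b::nat. b < a \<and> x [^] a \<ominus> x [^] b \<in> P"
proof -
  have Pi: "ideal P R" using primeideal.axioms(1)[OF P] .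
  interpret h: ring_hom_cring R "R Quot P" "(+>) P" using quot_hom(1)[OF Pi] .
  interpret Q: domain "R Quot P" using primeideal.quotient_is_domain[OF P] .
  have "semilocal (R Quot P)"
    using h.semilocal_image[OF quot_hom(3)[OF Pi]] finM unfolding quot_hom(4)[OF Pi] .
  then obtain a b :: nat where ab: "b < a" "(P +> x) [^]\<^bsub>R Quot P\<^esub> a = (P +> x) [^]\<^bsub>R Quot P\<^esub> b"
    using Q.nat_pow_eq_of_finite_maximal_subrings[OF _ finite_maximal_subrings_quot[OF Pi fin], of "P +> x"] x
    by auto
  have "P +> (x [^] n) = (P +> x) [^]\<^bsub>R Quot P\<^esub> n" for n :: nat
    using ring_hom_ring.hom_nat_pow[OF quot_hom(2)[OF Pi] x] .
  then have "x [^] a \<ominus> x [^] b \<in> P" using ab(2) quot_hom(5)[OF Pi, of "x [^] a" "x [^] b"] x by simp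
  then show ?thesis using ab(1) by blast
qed

lemma (in cring) power_torsion_of_finite:
  assumes fin: "finite (maximal_subrings R)"
    and finM: "\<And>P. primeideal P R \<Longrightarrow> finite {M. maximalideal M R \<and> P \<subseteq> M}"
  shows "power_torsion R"
  using power_torsionI torsion_mod_prime[OF fin _ finM] by blast

lemma (in cring) power_torsion_semilocal:
  assumes "finite (maximal_subrings R)" "semilocal R" shows "power_torsion R"
proof (rule power_torsion_of_finite[OF assms(1)])
  fix P
  have "{M. maximalideal M R \<and> P \<subseteq> M} \<subseteq> {M. maximalideal M R}" by blast
  then show "finite {M. maximalideal M R \<and> P \<subseteq> M}"
    using assms(2) finite_subset unfolding semilocal_def by blast
qed

lemma (in cring) power_torsion_of_zero_dimensional:
  assumes "finite (maximal_subrings R)" "zero_dimensional R" shows "power_torsion R"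
proof (rule power_torsion_of_finite[OF assms(1)])
  fix P assume P: "primeideal P R"
  have "{M. maximalideal M R \<and> P \<subseteq> M} \<subseteq> {P}"
    using assms(2) P maximalideal_prime unfolding zero_dimensional_iff by blast
  then show "finite {M. maximalideal M R \<and> P \<subseteq> M}" using finite_subset by blast
qed

text \<open>All maximal ideals above \<open>P\<close> contract to the same prime
  \<open>P \<inter> K\<close>, so infinitely many of them would produce infinitely many maximal
  subrings.\<close>

lemma (in cring) power_torsion_of_zero_dimensional_subring:
  assumes fin: "finite (maximal_subrings R)" and K: "subring K R"
    and F: "finite F" "carrier R = generate_ring R (K \<union> F)"
    and dim: "zero_dimensional (R\<lparr>carrier := K\<rparr>)"
  shows "power_torsion R"
proof (rule power_torsion_of_finite[OF fin], rule ccontr)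
  fix P assume P: "primeideal P R" and inf: "infinite {M. maximalideal M R \<and> P \<subseteq> M}"
  have "infinite (maximal_subrings R)"
  proof (rule infinite_maximal_subrings[OF K F inf])
    fix M assume M: "M \<in> {M. maximalideal M R \<and> P \<subseteq> M}"
    then show "maximalideal M R" by blast
    have "primeideal (M \<inter> K) (R\<lparr>carrier := K\<rparr>)" "primeideal (P \<inter> K) (R\<lparr>carrier := K\<rparr>)"
      using primeideal_restrict[OF _ K] maximalideal_prime M P by blast+
    then show "M \<inter> K = P \<inter> K"
      using dim M unfolding zero_dimensional_iff by blast
  qed
  then show False using fin by blast
qed

text \<open>Maximal ideals contract to maximal ideals, because their residue fields consist of zero
  and roots of unity. So there are finitely many contractions, and infinitely many maximal ideals
  would put infinitely many over one of them.\<close>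

lemma (in cring) semilocal_of_semilocal_subring:
  assumes fin: "finite (maximal_subrings R)" and K: "subring K R"
    and F: "finite F" "carrier R = generate_ring R (K \<union> F)"
    and semi: "semilocal (R\<lparr>carrier := K\<rparr>)"
  shows "semilocal R"
  unfolding semilocal_def
proof (rule ccontr)
  assume inf: "infinite {M. maximalideal M R}"
  interpret K: cring "R\<lparr>carrier := K\<rparr>" using subring_cring[OF K] .
  have max: "maximalideal (M \<inter> K) (R\<lparr>carrier := K\<rparr>)" if M: "maximalideal M R" for M
  proof (rule K.torsion_primeideal_maximal)
    have Mp: "primeideal M R" using M maximalideal_prime by blast
    then show "primeideal (M \<inter> K) (R\<lparr>carrier := K\<rparr>)" using primeideal_restrict[OF _ K] by blast
    fix x assume "x \<in> carrier (R\<lparr>carrier := K\<rparr>)"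
    then have x: "x \<in> K" "x \<in> carrier R" using subringE(1)[OF K] by auto
    have "{M'. maximalideal M' R \<and> M \<subseteq> M'} \<subseteq> {M}" using maximalideal_subset_eq[OF M] by blast
    then have "finite {M'. maximalideal M' R \<and> M \<subseteq> M'}" using finite_subset by blast
    then obtain a b :: nat where "b < a" "x [^] a \<ominus> x [^] b \<in> M"
      using torsion_mod_prime[OF fin Mp _ x(2)] by blast
    moreover have "x [^] a \<in> K" "x [^] b \<in> K" using nat_pow_in_subring[OF K x(1)] by auto
    ultimately show "\<exists>a b::nat. b < a \<and> x [^]\<^bsub>R\<lparr>carrier := K\<rparr>\<^esub> a \<ominus>\<^bsub>R\<lparr>carrier := K\<rparr>\<^esub> x [^]\<^bsub>R\<lparr>carrier := K\<rparr>\<^esub> b \<in> M \<inter> K"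
      using subring_a_minus[OF K] subring_minus[OF K]
      by (intro exI[of _ a] exI[of _ b]) (simp add: subring_nat_pow)
  qed
  have "finite ((\<lambda>M. M \<inter> K) ` {M. maximalideal M R})"
    using semi max unfolding semilocal_def by (auto elim: finite_subset[rotated])
  then obtain M\<^sub>0 where "infinite {M \<in> {M. maximalideal M R}. M \<inter> K = M\<^sub>0 \<inter> K}"
    using pigeonhole_infinite[OF inf] by blast
  then have "infinite (maximal_subrings R)"
    using infinite_maximal_subrings[OF K F, of "{M \<in> {M. maximalideal M R}. M \<inter> K = M\<^sub>0 \<inter> K}" "M\<^sub>0 \<inter> K"] by blast
  then show False using fin by blast
qed


section \<open>Finite modules and the artinian property\<close>

text \<open>Multiplication by x^a - x^b raises the degree by \<open>a\<close> and keeps the leading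
  coefficient 1, since b < a.\<close>

lemma (in cring) power_differences_monic:
  assumes K: "subring K R" and x: "x \<in> carrier R" and s: "s \<in> power_differences R x"
  shows "\<exists>d. \<exists>y\<in>Span K (pows R x d). s = x [^] d \<oplus> y"
  using s
proof induction
  case one
  have "\<one> = x [^] (0::nat) \<oplus> \<zero>" by simp
  moreover have "\<zero> \<in> Span K (pows R x 0)" by (simp add: Span_Nil)
  ultimately show ?case by blast
next
  case (step s b a)
  then obtain d y where y: "y \<in> Span K (pows R x d)" "s = x [^] d \<oplus> y" by blast
  note sK = submod_self[OF K]
  have V: "submod R K (Span K (pows R x n))" for n using submod_Span_pows[OF sK subringE(1)[OF K] x] .
  let ?V = "Span K (pows R x (d + a))"
  have yc: "y \<in> carrier R" using submodD(5)[OF V y(1)] .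
  have 1: "x [^] a \<otimes> y \<in> ?V" using Span_pows_mult[OF sK x y(1), of a] by (simp add: add.commute)
  have 2: "x [^] b \<otimes> y \<in> ?V"
    using Span_pows_mult[OF sK x y(1), of b] Span_pows_mono[OF sK x _ order_refl, of "b + d" "d + a"] step.hyps(2) by auto
  have "x [^] (d + b) \<in> set (pows R x (d + a))" using step.hyps(2) unfolding set_pows by (intro imageI) simp
  then have 3: "x [^] (d + b) \<in> ?V" using Span_incl_one[OF K pows_carrier[OF x]] by blast
  have "(p \<oplus> y) \<otimes> (q \<ominus> r) = p \<otimes> q \<oplus> ((q \<otimes> y \<ominus> p \<otimes> r) \<ominus> r \<otimes> y)"
    if "p \<in> carrier R" "q \<in> carrier R" "r \<in> carrier R" for p q r
    using that yc by algebra
  from this[of "x [^] d" "x [^] a" "x [^] b"]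
  have "s \<otimes> (x [^] a \<ominus> x [^] b) = x [^] (d + a) \<oplus> ((x [^] a \<otimes> y \<ominus> x [^] (d + b)) \<ominus> x [^] b \<otimes> y)"
    using x y(2) by (simp add: nat_pow_mult)
  moreover have "(x [^] a \<otimes> y \<ominus> x [^] (d + b)) \<ominus> x [^] b \<otimes> y \<in> ?V"
    using submod_minus[OF K V] 1 2 3 by blast
  ultimately show ?case by blast
qed

lemma (in cring) power_torsion_integral:
  assumes K: "subring K R" and tor: "power_torsion R" and x: "x \<in> carrier R"
  obtains d where "x [^] Suc d \<in> Span K (pows R x (Suc d))"
proof -
  note V = submod_Span_pows[OF submod_self[OF K] subringE(1)[OF K] x]
  have "\<zero> \<in> power_differences R x" using tor x unfolding power_torsion_def by blast
  then obtain d y where y: "y \<in> Span K (pows R x d)" "\<zero> = x [^] d \<oplus> y"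
    using power_differences_monic[OF K x] by blast
  have "x [^] d = \<ominus> y" using sum_zero_eq_neg[of "x [^] d" y] y(2) submodD(5)[OF V y(1)] x by simp
  then have "x [^] d \<in> Span K (pows R x d)" using submod_uminus[OF K V y(1)] by simp
  \<comment> \<open>The extra factor \<open>x\<close> makes the degree positive, so that 1 is always
    among the listed powers.\<close>
  then have "x [^] (1::nat) \<otimes> x [^] d \<in> Span K (pows R x (1 + d))" by (rule Span_pows_mult[OF submod_self[OF K] x])
  then have "x [^] Suc d \<in> Span K (pows R x (Suc d))" using x by (simp add: m_comm)
  then show ?thesis by (rule that)
qed

text \<open>A new element \<open>x\<close> of \<open>F\<close> replaces the generators
  \<open>u\<close> by the products x^i u with i below the degree of an integral equation. At the
  end, the elements that multiply the span into itself form a subring containing \<open>K\<close>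
  and \<open>F\<close>, hence are everything; as 1 lies in the span, so does the whole ring.\<close>

lemma (in cring) power_torsion_finite_module:
  assumes K: "subring K R" and tor: "power_torsion R"
    and F: "finite F" "carrier R = generate_ring R (K \<union> F)"
  shows "\<exists>us. set us \<subseteq> carrier R \<and> Span K us = carrier R"
proof -
  have Kc: "K \<subseteq> carrier R" using subringE(1)[OF K] .
  note sK = submod_self[OF K]
  have KFc: "K \<union> F \<subseteq> carrier R" using F(2) generate_ring.incl[of _ "K \<union> F" R] by blast
  have gens: "\<exists>us. set us \<subseteq> carrier R \<and> \<one> \<in> Span K us \<and> (\<forall>x\<in>F. \<forall>u\<in>set us. x \<otimes> u \<in> Span K us)"
    if "finite F" "F \<subseteq> carrier R" for F
    using that
  proof (induction F)
    case empty
    have "\<one> \<in> Span K [\<one>]" by (rule Span_incl_one[OF K]) auto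
    then show ?case by (intro exI[of _ "[\<one>]"]) auto
  next
    case (insert x F)
    then obtain us where us: "set us \<subseteq> carrier R" "\<one> \<in> Span K us"
      "\<And>f u. f \<in> F \<Longrightarrow> u \<in> set us \<Longrightarrow> f \<otimes> u \<in> Span K us" by blast
    have x: "x \<in> carrier R" using insert.prems by blast
    obtain d where d: "x [^] Suc d \<in> Span K (pows R x (Suc d))" using power_torsion_integral[OF K tor x] .
    define vs where "vs = concat (map (\<lambda>e. map (\<lambda>u. e \<otimes> u) us) (pows R x (Suc d)))"
    have vs: "set vs = (\<Union>i<Suc d. (\<lambda>u. x [^] i \<otimes> u) ` set us)"
      unfolding vs_def by (auto simp: set_pows)
    have vsI: "x [^] i \<otimes> u \<in> set vs" if "i < Suc d" "u \<in> set us" for i u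
      unfolding vs by (rule UN_I[of i]) (use that in auto)
    have vsE: "\<exists>i<Suc d. \<exists>u\<in>set us. v = x [^] i \<otimes> u" if "v \<in> set vs" for v
      using that unfolding vs by blast
    have vc: "set vs \<subseteq> carrier R"
    proof
      fix v assume "v \<in> set vs"
      then obtain i u where "v = x [^] (i::nat) \<otimes> u" "u \<in> set us" using vsE by blast
      then show "v \<in> carrier R" using us(1) x by auto
    qed
    have V: "submod R K (Span K vs)" using submod_Span[OF sK Kc vc] .
    have V0: "submod R {} (Span K vs)" using submod_mono[OF V] by simp
    have small: "x [^] i \<otimes> y \<in> Span K vs" if i: "i < Suc d" and y: "y \<in> Span K us" for i y
    proof (rule Span_mult_image[OF _ V0 Kc us(1) _ y])
      show "x [^] i \<in> carrier R" using x by simp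
      fix k u assume k: "k \<in> K" and u: "u \<in> set us"
      have "x [^] i \<otimes> (k \<otimes> u) = k \<otimes> (x [^] i \<otimes> u)"
        using m_lcomm[of "x [^] i" k u] k Kc u us(1) x by blast
      then show "x [^] i \<otimes> (k \<otimes> u) \<in> Span K vs" using Span_incl[OF sK vc k vsI[OF i u]] by simp
    qed
    have "\<one> \<in> Span K vs" using small[OF _ us(2), of 0] by simp
    moreover have "f \<otimes> v \<in> Span K vs" if f: "f \<in> insert x F" and v: "v \<in> set vs" for f v
    proof -
      obtain i u where iu: "i < Suc d" "u \<in> set us" "v = x [^] i \<otimes> u" using vsE[OF v] by blast
      have uc: "u \<in> carrier R" using iu(2) us(1) by blast
      show ?thesis
      proof (cases "f \<in> F")
        case True
        have "f \<in> carrier R" using True insert.prems by blast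
        then have "f \<otimes> v = x [^] i \<otimes> (f \<otimes> u)" unfolding iu(3) using uc x by (simp add: m_lcomm)
        then show ?thesis using small[OF iu(1) us(3)[OF True iu(2)]] by simp
      next
        case False
        then have "f = x" using f by simp
        then have eq: "f \<otimes> v = x [^] Suc i \<otimes> u" unfolding iu(3) using uc x by (simp add: m_ac)
        show ?thesis
        proof (cases "Suc i < Suc d")
          case True
          then show ?thesis using small[OF True Span_incl_one[OF K us(1) iu(2)]] eq by simp
        next
          case False
          then have "Suc i = Suc d" using iu(1) by simp
          moreover have "u \<otimes> x [^] Suc d \<in> Span K vs"
          proof (rule Span_mult_image[OF uc V0 Kc pows_carrier[OF x] _ d])
            fix k e assume k: "k \<in> K" and "e \<in> set (pows R x (Suc d))"
            then obtain j where j: "j < Suc d" "e = x [^] j" unfolding set_pows by blast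
            have kc: "k \<in> carrier R" using k Kc by blast
            have "u \<otimes> (k \<otimes> e) = k \<otimes> (x [^] j \<otimes> u)" unfolding j(2) using uc kc x by (simp add: m_ac)
            then show "u \<otimes> (k \<otimes> e) \<in> Span K vs" using Span_incl[OF sK vc k vsI[OF j(1) iu(2)]] by simp
          qed
          ultimately show ?thesis using eq m_comm[OF uc, of "x [^] Suc d"] x by simp
        qed
      qed
    qed
    ultimately show ?case using vc by blast
  qed
  have "F \<subseteq> carrier R" using KFc by blast
  from gens[OF F(1) this] obtain us where us: "set us \<subseteq> carrier R" "\<one> \<in> Span K us"
    and "\<forall>f\<in>F. \<forall>u\<in>set us. f \<otimes> u \<in> Span K us" by (elim exE conjE)
  then have Fus: "f \<otimes> u \<in> Span K us" if "f \<in> F" "u \<in> set us" for f u using that by simp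
  have V: "submod R K (Span K us)" using submod_Span[OF sK Kc us(1)] .
  have V0: "submod R {} (Span K us)" using submod_mono[OF V] by simp
  note V' = submodD[OF V]
  let ?B = "{y \<in> carrier R. \<forall>z\<in>Span K us. y \<otimes> z \<in> Span K us}"
  have "subring ?B R"
  proof (rule subringI)
    show "\<one> \<in> ?B" using V'(5) by auto
    show "\<ominus> h \<in> ?B" if "h \<in> ?B" for h
      using that submod_uminus[OF K V] V'(5) by (auto simp: l_minus)
    show "h \<otimes> h' \<in> ?B" if "h \<in> ?B" "h' \<in> ?B" for h h'
      using that V'(5) by (auto simp: m_assoc)
    show "h \<oplus> h' \<in> ?B" if "h \<in> ?B" "h' \<in> ?B" for h h'
      using that V'(3,5) by (auto simp: l_distr)
  qed auto
  moreover have "K \<union> F \<subseteq> ?B"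
  proof
    fix y assume y: "y \<in> K \<union> F"
    then have yc: "y \<in> carrier R" using KFc by blast
    have "y \<otimes> z \<in> Span K us" if z: "z \<in> Span K us" for z
    proof (cases "y \<in> K")
      case True
      then show ?thesis using V'(4)[OF True z] by simp
    next
      case False
      then have yF: "y \<in> F" using y by blast
      show ?thesis
      proof (rule Span_mult_image[OF yc V0 Kc us(1) _ z])
        fix k u assume k: "k \<in> K" and u: "u \<in> set us"
        have "y \<otimes> (k \<otimes> u) = k \<otimes> (y \<otimes> u)" using m_lcomm[of y k u] yc k Kc u us(1) by blast
        then show "y \<otimes> (k \<otimes> u) \<in> Span K us" using V'(4)[OF k Fus[OF yF u]] by simp
      qed
    qed
    then show "y \<in> ?B" using yc by blast
  qed
  ultimately have "carrier R \<subseteq> ?B" using generate_ring_min_subring1[OF KFc] F(2) by blast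
  then have "y \<in> Span K us" if "y \<in> carrier R" for y
    using that us(2) r_one[OF that] by force
  then show ?thesis using us(1) V'(1) by blast
qed

section \<open>The descending chain condition for submodules\<close>

definition dcc_on :: "('a, 'b) ring_scheme \<Rightarrow> 'a set \<Rightarrow> 'a set \<Rightarrow> bool" where
  "dcc_on R K W \<longleftrightarrow> (\<forall>N :: nat \<Rightarrow> 'a set. (\<forall>n. submod R K (N n) \<and> N n \<subseteq> W) \<longrightarrow>
     (\<forall>n. N (Suc n) \<subseteq> N n) \<longrightarrow> (\<exists>n. \<forall>m\<ge>n. N m = N n))"

lemma dcc_onD:
  fixes N :: "nat \<Rightarrow> 'a set"
  assumes "dcc_on R K W" "\<And>n. submod R K (N n)" "\<And>n. N n \<subseteq> W" "\<And>n. N (Suc n) \<subseteq> N n"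
  obtains n where "\<And>m. m \<ge> n \<Longrightarrow> N m = N n"
  using assms unfolding dcc_on_def by meson

lemma dcc_on_mono: "dcc_on R K W \<Longrightarrow> W' \<subseteq> W \<Longrightarrow> dcc_on R K W'"
  unfolding dcc_on_def by (meson subset_trans)

text \<open>Chains are always taken in the ambient ring, so that the artinian property of
  \<open>K\<close>, that of \<open>R\<close>, and the chain condition for \<open>R\<close> as a
  \<open>K\<close>-module are instances of one predicate.\<close>

lemma (in cring) artinian_subring_iff:
  assumes "subring K R" shows "artinian (R\<lparr>carrier := K\<rparr>) \<longleftrightarrow> dcc_on R K K"
  unfolding artinian_def dcc_on_def ideal_subring_iff[OF assms] by meson

lemma (in cring) artinian_iff: "artinian R \<longleftrightarrow> dcc_on R (carrier R) (carrier R)"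
proof -
  have "R\<lparr>carrier := carrier R\<rparr> = R" by simp
  then show ?thesis using artinian_subring_iff[OF carrier_is_subring] by simp
qed

definition module_sum :: "('a, 'b) ring_scheme \<Rightarrow> 'a set \<Rightarrow> 'a set \<Rightarrow> 'a set" where
  "module_sum R W V = {w \<oplus>\<^bsub>R\<^esub> v | w v. w \<in> W \<and> v \<in> V}"

context cring
begin

lemma module_sumE:
  assumes "x \<in> module_sum R W V" obtains w v where "x = w \<oplus> v" "w \<in> W" "v \<in> V"
  using assms unfolding module_sum_def by blast

lemma module_sumI: "w \<in> W \<Longrightarrow> v \<in> V \<Longrightarrow> w \<oplus> v \<in> module_sum R W V"
  unfolding module_sum_def by blast

lemma submod_module_sum:
  assumes "submod R K W" "submod R K V" "K \<subseteq> carrier R" shows "submod R K (module_sum R W V)"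
proof (rule submodI)
  note W = submodD[OF assms(1)] and V = submodD[OF assms(2)]
  show "module_sum R W V \<subseteq> carrier R" using W(5) V(5) by (auto elim!: module_sumE)
  have "\<zero> \<oplus> \<zero> \<in> module_sum R W V" using W(2) V(2) by (rule module_sumI)
  then show "\<zero> \<in> module_sum R W V" by simp
  show "x \<oplus> y \<in> module_sum R W V" if x: "x \<in> module_sum R W V" and y: "y \<in> module_sum R W V" for x y
  proof -
    obtain w v where 1: "x = w \<oplus> v" "w \<in> W" "v \<in> V" using x by (rule module_sumE)
    obtain w' v' where 2: "y = w' \<oplus> v'" "w' \<in> W" "v' \<in> V" using y by (rule module_sumE)
    have "x \<oplus> y = (w \<oplus> w') \<oplus> (v \<oplus> v')" unfolding 1(1) 2(1)
      using W(5)[OF 1(2)] W(5)[OF 2(2)] V(5)[OF 1(3)] V(5)[OF 2(3)] by (simp add: a_ac)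
    then show ?thesis using module_sumI[OF W(3)[OF 1(2) 2(2)] V(3)[OF 1(3) 2(3)]] by simp
  qed
  show "k \<otimes> x \<in> module_sum R W V" if k: "k \<in> K" and x: "x \<in> module_sum R W V" for k x
  proof -
    obtain w v where 1: "x = w \<oplus> v" "w \<in> W" "v \<in> V" using x by (rule module_sumE)
    have "k \<otimes> x = k \<otimes> w \<oplus> k \<otimes> v" unfolding 1(1)
      using r_distr[of w v k] W(5)[OF 1(2)] V(5)[OF 1(3)] k assms(3) by blast
    then show ?thesis using module_sumI[OF W(4)[OF k 1(2)] V(4)[OF k 1(3)]] by simp
  qed
qed

text \<open>The assumption on \<open>J\<close> is the chain condition for (W + K v) / W, which is
  \<open>K\<close> modulo {r. r v in W}. Of two nested submodules of W + K v, the smaller equals the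
  larger if both have the same intersection with \<open>W\<close> and the same ideal of coefficients
  at \<open>v\<close>.\<close>

lemma dcc_on_extend:
  assumes K: "subring K R" and W: "submod R K W" "dcc_on R K W" and v: "v \<in> carrier R"
    and J: "\<And>J :: nat \<Rightarrow> 'a set. (\<And>n. submod R K (J n)) \<Longrightarrow> (\<And>n. J n \<subseteq> K) \<Longrightarrow>
      (\<And>n. {r \<in> K. r \<otimes> v \<in> W} \<subseteq> J n) \<Longrightarrow> (\<And>n. J (Suc n) \<subseteq> J n) \<Longrightarrow> \<exists>n. \<forall>m\<ge>n. J m = J n"
  shows "dcc_on R K (module_sum R W {r \<otimes> v | r. r \<in> K})"
  unfolding dcc_on_def
proof (intro allI impI)
  fix N :: "nat \<Rightarrow> 'a set"
  assume N: "\<forall>n. submod R K (N n) \<and> N n \<subseteq> module_sum R W {r \<otimes> v | r. r \<in> K}" and dec: "\<forall>n. N (Suc n) \<subseteq> N n"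
  have Kc: "K \<subseteq> carrier R" using subringE(1)[OF K] .
  have Ns: "submod R K (N n)" for n using N by blast
  note W' = submodD[OF W(1)] and N' = submodD[OF Ns]
  have anti: "N m \<subseteq> N n" if "n \<le> m" for n m using lift_Suc_antimono_le[of N n m] dec that by blast
  obtain n1 where n1: "\<And>m. m \<ge> n1 \<Longrightarrow> N m \<inter> W = N n1 \<inter> W"
  proof (rule dcc_onD[OF W(2), of "\<lambda>n. N n \<inter> W"])
    show "submod R K (N n \<inter> W)" for n using submod_Int Ns W(1) by blast
  qed (use dec in auto)
  define J where "J n = {r \<in> K. \<exists>w\<in>W. w \<oplus> r \<otimes> v \<in> N n}" for n
  have JE: "\<exists>w\<in>W. w \<oplus> r \<otimes> v \<in> N n" if "r \<in> J n" for r n using that unfolding J_def by blast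
  have "\<exists>n. \<forall>m\<ge>n. J m = J n"
  proof (rule assms(5))
    show "J n \<subseteq> K" for n unfolding J_def by blast
    show "J (Suc n) \<subseteq> J n" for n unfolding J_def using dec by blast
    show "{r \<in> K. r \<otimes> v \<in> W} \<subseteq> J n" for n
    proof
      fix r assume r: "r \<in> {r \<in> K. r \<otimes> v \<in> W}"
      then have "\<ominus> (r \<otimes> v) \<in> W" using submod_uminus[OF K W(1)] by blast
      moreover have "\<ominus> (r \<otimes> v) \<oplus> r \<otimes> v = \<zero>" using r Kc v by (auto intro: l_neg)
      ultimately show "r \<in> J n" unfolding J_def using r N'(2) by force
    qed
    show "submod R K (J n)" for n
    proof (rule submodI)
      show "J n \<subseteq> carrier R" unfolding J_def using Kc by blast
      have "\<zero> \<oplus> \<zero> \<otimes> v \<in> N n" using N'(2) v by simp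
      then show "\<zero> \<in> J n" unfolding J_def using W'(2) subringE(2)[OF K] by blast
      fix r assume r: "r \<in> J n"
      obtain w where w: "w \<in> W" "w \<oplus> r \<otimes> v \<in> N n" using JE[OF r] by blast
      have rc: "r \<in> K" "r \<in> carrier R" using r Kc unfolding J_def by auto
      show "r \<oplus> s \<in> J n" if s: "s \<in> J n" for s
      proof -
        obtain w' where w': "w' \<in> W" "w' \<oplus> s \<otimes> v \<in> N n" using JE[OF s] by blast
        have sc: "s \<in> K" "s \<in> carrier R" using s Kc unfolding J_def by auto
        have "(w \<oplus> r \<otimes> v) \<oplus> (w' \<oplus> s \<otimes> v) = (w \<oplus> w') \<oplus> (r \<oplus> s) \<otimes> v"
          using W'(5)[OF w(1)] W'(5)[OF w'(1)] rc(2) sc(2) v by algebra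
        then have "(w \<oplus> w') \<oplus> (r \<oplus> s) \<otimes> v \<in> N n" using N'(3)[OF w(2) w'(2)] by simp
        then show ?thesis unfolding J_def using W'(3)[OF w(1) w'(1)] subringE(7)[OF K rc(1) sc(1)] by blast
      qed
      show "k \<otimes> r \<in> J n" if k: "k \<in> K" for k
      proof -
        have "k \<otimes> (w \<oplus> r \<otimes> v) = k \<otimes> w \<oplus> (k \<otimes> r) \<otimes> v"
          using W'(5)[OF w(1)] rc(2) v subsetD[OF Kc k] by algebra
        then have "k \<otimes> w \<oplus> (k \<otimes> r) \<otimes> v \<in> N n" using N'(4)[OF k w(2)] by simp
        then show ?thesis unfolding J_def using W'(4)[OF k w(1)] subringE(6)[OF K k rc(1)] by blast
      qed
    qed
  qed
  then obtain n2 where n2: "\<And>m. m \<ge> n2 \<Longrightarrow> J m = J n2" by blast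
  define n where "n = max n1 n2"
  have "N m = N n" if m: "m \<ge> n" for m
  proof
    show "N m \<subseteq> N n" using anti[OF m] .
    show "N n \<subseteq> N m"
    proof
      fix y assume y: "y \<in> N n"
      then have "y \<in> module_sum R W {r \<otimes> v | r. r \<in> K}" using N by blast
      then obtain w r where wr: "y = w \<oplus> r \<otimes> v" "w \<in> W" "r \<in> K" by (auto elim!: module_sumE)
      have "r \<in> J n" unfolding J_def using wr y by blast
      then have "r \<in> J m" using n2[of n] n2[of m] m unfolding n_def by simp
      then obtain w' where w': "w' \<in> W" "w' \<oplus> r \<otimes> v \<in> N m" using JE by blast
      have c: "w \<in> carrier R" "w' \<in> carrier R" "r \<in> carrier R" using wr w' W'(5) Kc by auto
      have "y \<ominus> (w' \<oplus> r \<otimes> v) = w \<ominus> w'" unfolding wr(1) using c v by algebra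
      then have "w \<ominus> w' \<in> N n" using submod_minus[OF K Ns y, of "w' \<oplus> r \<otimes> v"] w'(2) anti[OF m] by auto
      then have "w \<ominus> w' \<in> N n \<inter> W" using submod_minus[OF K W(1) wr(2) w'(1)] by blast
      then have "w \<ominus> w' \<in> N m" using n1[of n] n1[of m] m unfolding n_def by auto
      then have "(w' \<oplus> r \<otimes> v) \<oplus> (w \<ominus> w') \<in> N m" using N'(3) w'(2) by blast
      moreover have "(w' \<oplus> r \<otimes> v) \<oplus> (w \<ominus> w') = y" unfolding wr(1) using c v by algebra
      ultimately show "y \<in> N m" by simp
    qed
  qed
  then show "\<exists>n. \<forall>m\<ge>n. N m = N n" by blast
qed

lemma dcc_on_zero: "dcc_on R K {\<zero>}"
  unfolding dcc_on_def
proof (intro allI impI)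
  fix N :: "nat \<Rightarrow> 'a set" assume N: "\<forall>n. submod R K (N n) \<and> N n \<subseteq> {\<zero>}"
  then have "N n = {\<zero>}" for n using submodD(2)[of R K "N n"] by blast
  then show "\<exists>n. \<forall>m\<ge>n. N m = N n" by simp
qed

lemma dcc_on_Span:
  assumes K: "subring K R" and dcc: "dcc_on R K K" and us: "set us \<subseteq> carrier R"
  shows "dcc_on R K (Span K us)"
  using us
proof (induction us)
  case Nil
  then show ?case by (simp add: Span_Nil dcc_on_zero)
next
  case (Cons u us)
  have V: "submod R K (Span K us)" using submod_Span[OF submod_self[OF K] subringE(1)[OF K]] Cons.prems by simp
  have "dcc_on R K (module_sum R (Span K us) {r \<otimes> u | r. r \<in> K})"
  proof (rule dcc_on_extend[OF K V])
    show "dcc_on R K (Span K us)" "u \<in> carrier R" using Cons by auto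
    show "\<exists>n. \<forall>m\<ge>n. J m = J n" if "\<And>n. submod R K (J n)" "\<And>n. J n \<subseteq> K" "\<And>n. J (Suc n) \<subseteq> J n"
      for J :: "nat \<Rightarrow> 'a set" using that dcc unfolding dcc_on_def by blast
  qed
  moreover have "Span K (u # us) \<subseteq> module_sum R (Span K us) {r \<otimes> u | r. r \<in> K}"
  proof
    fix x assume "x \<in> Span K (u # us)"
    then obtain k y where x: "x = k \<otimes> u \<oplus> y" "k \<in> K" "y \<in> Span K us" by (rule Span_ConsE)
    have "k \<in> carrier R" "u \<in> carrier R" using x(2) subringE(1)[OF K] Cons.prems by auto
    then have "x = y \<oplus> k \<otimes> u" using x(1) submodD(5)[OF V x(3)] by (simp add: a_comm)
    moreover have "k \<otimes> u \<in> {r \<otimes> u | r. r \<in> K}" using x(2) by blast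
    ultimately show "x \<in> module_sum R (Span K us) {r \<otimes> u | r. r \<in> K}" using module_sumI[OF x(3)] by simp
  qed
  ultimately show ?case by (rule dcc_on_mono)
qed

lemma artinian_of_finite_module:
  assumes K: "subring K R" and art: "artinian (R\<lparr>carrier := K\<rparr>)"
    and us: "set us \<subseteq> carrier R" "Span K us = carrier R"
  shows "artinian R"
proof -
  have d: "dcc_on R K (carrier R)"
    using dcc_on_Span[OF K _ us(1)] art us(2) unfolding artinian_subring_iff[OF K] by simp
  show ?thesis
    unfolding artinian_iff dcc_on_def
    using d submod_mono[OF _ subringE(1)[OF K]] unfolding dcc_on_def by blast
qed

text \<open>\<open>Q\<close> sends the new generators into \<open>W\<close>, so each of them adds at
  most a copy of the field K/Q: the coefficient ideals can only be \<open>Q\<close> or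
  \<open>K\<close>.\<close>

lemma dcc_on_extend_maximal:
  assumes K: "subring K R" and W: "submod R K W" "dcc_on R K W"
    and Q: "maximalideal Q (R\<lparr>carrier := K\<rparr>)"
    and vs: "set vs \<subseteq> carrier R" "\<And>q v. q \<in> Q \<Longrightarrow> v \<in> set vs \<Longrightarrow> q \<otimes> v \<in> W"
  shows "dcc_on R K (module_sum R W (Span K vs))"
  using vs
proof (induction vs)
  case Nil
  have "module_sum R W (Span K []) \<subseteq> W"
    using submodD(5)[OF W(1)] by (auto elim!: module_sumE simp: Span_Nil)
  then show ?case using W(2) dcc_on_mono by blast
next
  case (Cons v vs)
  have Kc: "K \<subseteq> carrier R" using subringE(1)[OF K] .
  have V: "submod R K (Span K vs)" using submod_Span[OF submod_self[OF K] Kc] Cons.prems by simp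
  have WV: "submod R K (module_sum R W (Span K vs))" using submod_module_sum[OF W(1) V Kc] .
  have vc: "v \<in> carrier R" using Cons.prems by simp
  have Qi: "ideal Q (R\<lparr>carrier := K\<rparr>)" using maximalideal.axioms(1)[OF Q] .
  have QK: "Q \<subseteq> K" using Qi ideal_subring_iff[OF K] by blast
  have "dcc_on R K (module_sum R (module_sum R W (Span K vs)) {r \<otimes> v | r. r \<in> K})"
  proof (rule dcc_on_extend[OF K WV _ vc])
    show "dcc_on R K (module_sum R W (Span K vs))" using Cons by auto
    fix J :: "nat \<Rightarrow> 'a set"
    assume J: "\<And>n. submod R K (J n)" "\<And>n. J n \<subseteq> K"
      "\<And>n. {r \<in> K. r \<otimes> v \<in> module_sum R W (Span K vs)} \<subseteq> J n" "\<And>n. J (Suc n) \<subseteq> J n"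
    have QJ: "Q \<subseteq> J n" for n
    proof
      fix q assume q: "q \<in> Q"
      have qv: "q \<otimes> v \<in> W" using Cons.prems(2)[OF q] by simp
      have "q \<otimes> v \<oplus> \<zero> \<in> module_sum R W (Span K vs)" using qv submodD(2)[OF V] by (rule module_sumI)
      then show "q \<in> J n" using J(3)[of n] q QK submodD(5)[OF W(1) qv] by auto
    qed
    have two: "J n = Q \<or> J n = K" for n
      using maximalideal.I_maximal[OF Q _ QJ, of n] ideal_subring_iff[OF K, of "J n"] J(1,2) by auto
    have anti: "J m \<subseteq> J n" if "n \<le> m" for n m using lift_Suc_antimono_le[of J n m] J(4) that by blast
    show "\<exists>n. \<forall>m\<ge>n. J m = J n"
    proof (cases "\<exists>n. J n = Q")
      case True
      then obtain n where n: "J n = Q" by blast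
      have "J m = J n" if "m \<ge> n" for m using anti[OF that] QJ[of m] n by blast
      then show ?thesis by blast
    next
      case False
      then have "J n = K" for n using two by blast
      then show ?thesis by simp
    qed
  qed
  moreover have "module_sum R W (Span K (v # vs)) \<subseteq> module_sum R (module_sum R W (Span K vs)) {r \<otimes> v | r. r \<in> K}"
  proof
    fix x assume "x \<in> module_sum R W (Span K (v # vs))"
    then obtain w y where x: "x = w \<oplus> y" "w \<in> W" "y \<in> Span K (v # vs)" by (rule module_sumE)
    obtain k z where y: "y = k \<otimes> v \<oplus> z" "k \<in> K" "z \<in> Span K vs" using x(3) by (rule Span_ConsE)
    have "x = (w \<oplus> z) \<oplus> k \<otimes> v" unfolding x(1) y(1)
      using submodD(5)[OF W(1) x(2)] submodD(5)[OF V y(3)] vc subsetD[OF Kc y(2)] by (simp add: a_ac)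
    moreover have "k \<otimes> v \<in> {r \<otimes> v | r. r \<in> K}" using y(2) by blast
    ultimately show "x \<in> module_sum R (module_sum R W (Span K vs)) {r \<otimes> v | r. r \<in> K}"
      using module_sumI[OF module_sumI[OF x(2) y(3)]] by simp
  qed
  ultimately show ?case by (rule dcc_on_mono)
qed

lemma artinian_minimal:
  assumes "artinian R" "\<A> \<noteq> {}" "\<And>I. I \<in> \<A> \<Longrightarrow> ideal I R"
  shows "\<exists>I\<in>\<A>. \<forall>J\<in>\<A>. J \<subseteq> I \<longrightarrow> J = I"
proof (rule ccontr)
  assume "\<not> ?thesis"
  then have no: "\<exists>J. J \<in> \<A> \<and> J \<subset> I" if "I \<in> \<A>" for I using that by blast
  obtain I\<^sub>0 where I\<^sub>0: "I\<^sub>0 \<in> \<A>" using assms(2) by blast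
  have "\<exists>f. \<forall>n. f n \<in> \<A> \<and> f (Suc n) \<subset> f n"
    by (rule dependent_nat_choice) (use I\<^sub>0 no in auto)
  then obtain f where f: "\<forall>n::nat. f n \<in> \<A> \<and> f (Suc n) \<subset> f n" by (rule exE)
  have "ideal (f n) R" "f (Suc n) \<subset> f n" for n using f assms(3) by auto
  then have f': "\<forall>n. ideal (f n) R" "\<forall>n. f (Suc n) \<subseteq> f n" by auto
  obtain n where n: "\<forall>m\<ge>n. f m = f n"
    using mp[OF mp[OF assms(1)[unfolded artinian_def, THEN spec[of _ f]] f'(1)] f'(2)] by (rule exE)
  have fin: "f (Suc n) = f n" by (rule mp[OF spec[OF n]]) simp
  show False using conjunct2[OF spec[OF f, of n]] unfolding fin by (rule psubsetE) simp
qed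

end

section \<open>Products of maximal ideals in artinian rings\<close>

inductive_set maximal_products :: "('a, 'b) ring_scheme \<Rightarrow> 'a set set" for R where
  unit: "carrier R \<in> maximal_products R"
| mult: "I \<in> maximal_products R \<Longrightarrow> maximalideal M R \<Longrightarrow> I \<cdot>\<^bsub>R\<^esub> M \<in> maximal_products R"

lemma (in cring) maximal_products_ideal:
  assumes "I \<in> maximal_products R" shows "ideal I R"
  using assms
proof induction
  case unit
  then show ?case using oneideal .
next
  case (mult I M)
  then show ?case using ideal_prod_is_ideal maximalideal.axioms(1) by blast
qed

text \<open>A minimal product \<open>I\<close> satisfies I M = I for every maximal \<open>M\<close>.
  If \<open>I\<close> is nonzero, take \<open>J\<close> minimal with J I nonzero and
  \<open>x\<close> in \<open>J\<close> with x I nonzero. Then (x M) I = x I is nonzero, so x M = J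
  and x = x m for some m in \<open>M\<close>. With \<open>M\<close> above the annihilator of
  \<open>x\<close>, both m and 1 - m lie in \<open>M\<close>.\<close>

lemma (in cring) artinian_zero_product:
  assumes "artinian R" shows "{\<zero>} \<in> maximal_products R"
proof -
  have "\<exists>I\<in>maximal_products R. \<forall>J\<in>maximal_products R. J \<subseteq> I \<longrightarrow> J = I"
    by (rule artinian_minimal[OF assms]) (use maximal_products.unit[of R] maximal_products_ideal in auto)
  then obtain I where I: "I \<in> maximal_products R" "\<And>J. J \<in> maximal_products R \<Longrightarrow> J \<subseteq> I \<Longrightarrow> J = I"
    by (elim bexE) blast
  have Ii: "ideal I R" using maximal_products_ideal[OF I(1)] .
  have IM: "I \<cdot>\<^bsub>R\<^esub> M = I" if M: "maximalideal M R" for M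
    using I(2)[OF maximal_products.mult[OF I(1) M]] ideal_prod_inter[OF Ii maximalideal.axioms(1)[OF M]] by blast
  have "I = {\<zero>}"
  proof (rule ccontr)
    assume "I \<noteq> {\<zero>}"
    then obtain y\<^sub>0 where y\<^sub>0: "y\<^sub>0 \<in> I" "y\<^sub>0 \<noteq> \<zero>" using idealD(3)[OF Ii] by blast
    define \<A> where "\<A> = {J. ideal J R \<and> (\<exists>x\<in>J. \<exists>y\<in>I. x \<otimes> y \<noteq> \<zero>)}"
    have "\<one> \<otimes> y\<^sub>0 \<noteq> \<zero>" using y\<^sub>0 idealD(2)[OF Ii] by simp
    then have "carrier R \<in> \<A>" unfolding \<A>_def using oneideal y\<^sub>0(1) by blast
    then have "\<exists>J\<in>\<A>. \<forall>J'\<in>\<A>. J' \<subseteq> J \<longrightarrow> J' = J"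
      by (intro artinian_minimal[OF assms]) (auto simp: \<A>_def)
    then obtain J where J: "J \<in> \<A>" "\<And>J'. J' \<in> \<A> \<Longrightarrow> J' \<subseteq> J \<Longrightarrow> J' = J"
      by (elim bexE) blast
    have Ji: "ideal J R" using J(1) unfolding \<A>_def by blast
    obtain x y where xy: "x \<in> J" "y \<in> I" "x \<otimes> y \<noteq> \<zero>" using J(1) unfolding \<A>_def by blast
    have xc: "x \<in> carrier R" using idealD(2)[OF Ji xy(1)] .
    have fix_x: "\<exists>m\<in>M. x = x \<otimes> m" if M: "maximalideal M R" for M
    proof -
      have Mi: "ideal M R" using maximalideal.axioms(1)[OF M] .
      define L where "L = (\<lambda>m. x \<otimes> m) ` M"
      have Li: "ideal L R" unfolding ideal_iff_submod
      proof (rule submodI)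
        show "L \<subseteq> carrier R" unfolding L_def using idealD(2)[OF Mi] xc by auto
        have "x \<otimes> \<zero> \<in> L" unfolding L_def using idealD(3)[OF Mi] by blast
        then show "\<zero> \<in> L" using xc by simp
        fix a assume "a \<in> L"
        then obtain m where m: "a = x \<otimes> m" "m \<in> M" unfolding L_def by blast
        show "a \<oplus> b \<in> L" if b: "b \<in> L" for b
        proof -
          obtain m' where m': "b = x \<otimes> m'" "m' \<in> M" using b unfolding L_def by blast
          have "a \<oplus> b = x \<otimes> (m \<oplus> m')"
            unfolding m(1) m'(1) using r_distr[of m m' x] idealD(2)[OF Mi] m(2) m'(2) xc by simp
          then show ?thesis unfolding L_def using idealD(4)[OF Mi m(2) m'(2)] by blast
        qed
        show "k \<otimes> a \<in> L" if k: "k \<in> carrier R" for k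
        proof -
          have "k \<otimes> a = x \<otimes> (k \<otimes> m)" unfolding m(1) using m_lcomm[of k x m] idealD(2)[OF Mi m(2)] xc k by simp
          then show ?thesis unfolding L_def using idealD(5)[OF Mi k m(2)] by blast
        qed
      qed
      have "L \<subseteq> J" unfolding L_def using idealD(6)[OF Ji _ xy(1)] idealD(2)[OF Mi] by blast
      moreover have "L \<in> \<A>"
      proof (rule ccontr)
        assume "L \<notin> \<A>"
        then have z: "x \<otimes> m \<otimes> y = \<zero>" if "m \<in> M" "y \<in> I" for m y
          using that Li unfolding \<A>_def L_def by blast
        have "z \<in> carrier R \<and> x \<otimes> z = \<zero>" if "z \<in> I \<cdot>\<^bsub>R\<^esub> M" for z
          using that
        proof induction
          case (prod i j)
          have c: "i \<in> carrier R" "j \<in> carrier R" using idealD(2)[OF Ii prod(1)] idealD(2)[OF Mi prod(2)] by auto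
          have "x \<otimes> (i \<otimes> j) = x \<otimes> j \<otimes> i" using c xc by (simp add: m_ac)
          then show ?case using z[OF prod(2,1)] c by simp
        next
          case (sum s1 s2)
          then show ?case using xc by (simp add: r_distr)
        qed
        then show False using IM[OF M] xy(2,3) by auto
      qed
      ultimately have "L = J" using J(2) by blast
      then show ?thesis using xy(1) unfolding L_def by blast
    qed
    define A where "A = {r \<in> carrier R. x \<otimes> r = \<zero>}"
    have Ai: "ideal A R" unfolding ideal_iff_submod A_def
      using xc by (intro submodI) (auto simp: r_distr m_lcomm)
    have "\<one> \<notin> A"
    proof
      assume "\<one> \<in> A"
      then have "x = \<zero>" unfolding A_def using xc by simp
      then show False using xy(3) idealD(2)[OF Ii xy(2)] by simp
    qed
    then obtain M where M: "maximalideal M R" "A \<subseteq> M" using exists_maximalideal[OF Ai] by blast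
    have Mi: "ideal M R" using maximalideal.axioms(1)[OF M(1)] .
    obtain m where m: "m \<in> M" "x = x \<otimes> m" using fix_x[OF M(1)] by blast
    have mc: "m \<in> carrier R" using idealD(2)[OF Mi m(1)] .
    have "x \<otimes> (\<one> \<ominus> m) = x \<ominus> x \<otimes> m" using xc mc by algebra
    also have "\<dots> = \<zero>" using m(2) xc by (metis minus_eq r_neg)
    finally have "\<one> \<ominus> m \<in> M" using M(2) mc unfolding A_def by auto
    then have "(\<one> \<ominus> m) \<oplus> m \<in> M" using idealD(4)[OF Mi _ m(1)] by blast
    moreover have "(\<one> \<ominus> m) \<oplus> m = \<one>" using mc by algebra
    ultimately show False using ideal.one_imp_carrier[OF Mi] maximalideal.I_notcarr[OF M(1)] by simp
  qed
  then show ?thesis using I(1) by simp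
qed

text \<open>A maximal ideal containing a product of maximal ideals is one of the factors, and zero
  is such a product.\<close>

lemma (in cring) artinian_semilocal:
  assumes "artinian R" shows "semilocal R"
proof -
  have "\<exists>F. finite F \<and> {N. maximalideal N R \<and> I \<subseteq> N} \<subseteq> F" if "I \<in> maximal_products R" for I
    using that
  proof induction
    case unit
    have "{N. maximalideal N R \<and> carrier R \<subseteq> N} \<subseteq> {}"
    proof
      fix N assume "N \<in> {N. maximalideal N R \<and> carrier R \<subseteq> N}"
      then have N: "maximalideal N R" "carrier R \<subseteq> N" by auto
      then show "N \<in> {}" using maximalideal.I_notcarr[OF N(1)] idealD(1)[OF maximalideal.axioms(1)[OF N(1)]] by blast
    qed
    then show ?case by blast
  next
    case (mult I M)
    then obtain F where F: "finite F" "{N. maximalideal N R \<and> I \<subseteq> N} \<subseteq> F" by blast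
    have "{N. maximalideal N R \<and> I \<cdot>\<^bsub>R\<^esub> M \<subseteq> N} \<subseteq> insert M F"
    proof
      fix N assume "N \<in> {N. maximalideal N R \<and> I \<cdot>\<^bsub>R\<^esub> M \<subseteq> N}"
      then have N: "maximalideal N R" "I \<cdot>\<^bsub>R\<^esub> M \<subseteq> N" by auto
      interpret N: primeideal N R using maximalideal_prime[OF N(1)] .
      have c: "\<And>i. i \<in> I \<Longrightarrow> i \<in> carrier R" "\<And>m. m \<in> M \<Longrightarrow> m \<in> carrier R"
        using idealD(2) maximal_products_ideal[OF mult.hyps(1)] maximalideal.axioms(1)[OF mult.hyps(2)] by blast+
      show "N \<in> insert M F"
      proof (cases "I \<subseteq> N")
        case True
        then show ?thesis using F N by blast
      next
        case False
        then obtain i where i: "i \<in> I" "i \<notin> N" by blast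
        have "m \<in> N" if m: "m \<in> M" for m
          using N.I_prime[OF c(1)[OF i(1)] c(2)[OF m]] ideal_prod.prod[OF i(1) m] N(2) i(2) by blast
        then show ?thesis using maximalideal_subset_eq[OF mult.hyps(2) N(1)] by blast
      qed
    qed
    then show ?case using F(1) by blast
  qed
  then obtain F where "finite F" "{N. maximalideal N R \<and> {\<zero>} \<subseteq> N} \<subseteq> F"
    using artinian_zero_product[OF assms] by blast
  moreover have "{N. maximalideal N R} \<subseteq> {N. maximalideal N R \<and> {\<zero>} \<subseteq> N}"
    using idealD(3) maximalideal.axioms(1) by blast
  ultimately show ?thesis unfolding semilocal_def by (meson finite_subset)
qed

text \<open>Zero is a product of maximal ideals, so it is enough that the chain condition climbs
  from I M to \<open>I\<close>. A simple step from W' to W' + R v is killed by \<open>M\<close> and,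
  as \<open>R\<close> is finite over \<open>K\<close>, is a finite-dimensional space over K / (M
  \<inter> K). That finitely many steps suffice is the artinian property, used as the existence of a
  minimal \<open>W\<close> from which the condition climbs to \<open>I\<close>.\<close>

lemma (in cring) artinian_subring_of_finite_module:
  assumes K: "subring K R" and art: "artinian R" and us: "set us \<subseteq> carrier R" "Span K us = carrier R"
    and max: "\<And>M. maximalideal M R \<Longrightarrow> maximalideal (M \<inter> K) (R\<lparr>carrier := K\<rparr>)"
  shows "artinian (R\<lparr>carrier := K\<rparr>)"
proof -
  have Kc: "K \<subseteq> carrier R" using subringE(1)[OF K] .
  have "dcc_on R K I \<longrightarrow> dcc_on R K (carrier R)" if "I \<in> maximal_products R" for I
    using that
  proof induction
    case unit
    then show ?case by blast
  next
    case (mult I M)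
    let ?IM = "I \<cdot>\<^bsub>R\<^esub> M"
    have Ii: "ideal I R" and Mi: "ideal M R"
      using maximal_products_ideal[OF mult.hyps(1)] maximalideal.axioms(1)[OF mult.hyps(2)] by auto
    have IMi: "ideal ?IM R" using ideal_prod_is_ideal[OF Ii Mi] .
    define \<A> where "\<A> = {W. ideal W R \<and> ?IM \<subseteq> W \<and> W \<subseteq> I \<and> (dcc_on R K W \<longrightarrow> dcc_on R K I)}"
    have "I \<in> \<A>" unfolding \<A>_def using Ii ideal_prod_inter[OF Ii Mi] by blast
    then have "\<exists>W\<in>\<A>. \<forall>J\<in>\<A>. J \<subseteq> W \<longrightarrow> J = W"
      by (intro artinian_minimal[OF art]) (auto simp: \<A>_def)
    then obtain W where W: "W \<in> \<A>" "\<And>J. J \<in> \<A> \<Longrightarrow> J \<subseteq> W \<Longrightarrow> J = W"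
      by (elim bexE) blast
    have Wi: "ideal W R" "?IM \<subseteq> W" "W \<subseteq> I" "dcc_on R K W \<longrightarrow> dcc_on R K I" using W(1) unfolding \<A>_def by auto
    have "W = ?IM"
    proof (rule ccontr)
      assume "W \<noteq> ?IM"
      then obtain v where v: "v \<in> W" "v \<notin> ?IM" using Wi(2) by blast
      have vc: "v \<in> carrier R" using idealD(2)[OF Wi(1) v(1)] .
      \<comment> \<open>An ideal avoids this set if it lies inside \<open>W\<close> and misses
        \<open>v\<close>; a maximal such ideal is one simple step below \<open>W\<close>.\<close>
      have "?IM \<inter> insert v (carrier R - W) = {}" using v(2) Wi(2) by blast
      then obtain W' where W': "ideal W' R" "?IM \<subseteq> W'" "W' \<inter> insert v (carrier R - W) = {}"
        "\<And>L. ideal L R \<Longrightarrow> W' \<subseteq> L \<Longrightarrow> L \<inter> insert v (carrier R - W) = {} \<Longrightarrow> L = W'"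
        using exists_ideal_maximal_disjoint[OF IMi] by blast
      have W'W: "W' \<subseteq> W" "v \<notin> W'" using W'(3) idealD(1)[OF W'(1)] by blast+
      have W'K: "submod R K W'" using W'(1) submod_mono[OF _ Kc] ideal_iff_submod by blast
      \<comment> \<open>As R = \<open>Span K us\<close>, the ideal R v is spanned over
        \<open>K\<close> by the products u v.\<close>
      define vs where "vs = map (\<lambda>u. u \<otimes> v) us"
      have vsc: "set vs \<subseteq> carrier R" unfolding vs_def using us(1) vc by auto
      have tv: "t \<otimes> v \<in> Span K vs" if t: "t \<in> carrier R" for t
      proof -
        have "v \<otimes> t \<in> Span K vs"
        proof (rule Span_mult_image[OF vc _ Kc us(1)])
          show "submod R {} (Span K vs)" using submod_Span[OF submod_self[OF K] Kc vsc] submod_mono by blast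
          show "t \<in> Span K us" using t us(2) by simp
          fix k u assume k: "k \<in> K" and u: "u \<in> set us"
          have "u \<otimes> v \<in> set vs" unfolding vs_def using u by simp
          moreover have "v \<otimes> (k \<otimes> u) = k \<otimes> (u \<otimes> v)"
          proof -
            have "k \<in> carrier R" "u \<in> carrier R" using k Kc u us(1) by auto
            then show ?thesis using vc by (simp add: m_ac)
          qed
          ultimately show "v \<otimes> (k \<otimes> u) \<in> Span K vs" using Span_incl[OF submod_self[OF K] vsc k] by simp
        qed
        then show ?thesis using m_comm[OF vc t] by simp
      qed
      have cover: "W \<subseteq> module_sum R W' (Span K vs)"
      proof
        fix w assume w: "w \<in> W"
        have wc: "w \<in> carrier R" using idealD(2)[OF Wi(1) w] .
        show "w \<in> module_sum R W' (Span K vs)"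
        proof (cases "w \<in> W'")
          case True
          then have "w \<oplus> \<zero> \<in> module_sum R W' (Span K vs)"
            using module_sumI submodD(2)[OF submod_Span[OF submod_self[OF K] Kc vsc]] by blast
          then show ?thesis using wc by simp
        next
          case False
          define L where "L = {j \<oplus> r \<otimes> w | j r. j \<in> W' \<and> r \<in> carrier R}"
          have L: "ideal L R" "W' \<subseteq> L" "w \<in> L" unfolding L_def using sum_ideal_elem[OF W'(1) wc] by auto
          have "L \<subseteq> W"
          proof
            fix z assume "z \<in> L"
            then obtain j r where "z = j \<oplus> r \<otimes> w" "j \<in> W'" "r \<in> carrier R" unfolding L_def by blast
            then show "z \<in> W" using idealD(4)[OF Wi(1)] idealD(5)[OF Wi(1) _ w] W'W(1) by blast
          qed
          \<comment> \<open>Maximality of \<open>W'\<close> gives v = j + t w with \<open>j\<close>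
            in \<open>W'\<close>. Here \<open>t\<close> is not in \<open>M\<close>, since M w lies
            in I M; inverting \<open>t\<close> modulo \<open>M\<close> expresses \<open>w\<close>
            through \<open>v\<close>.\<close>
          then have "v \<in> L" using W'(4)[OF L(1,2)] L(3) False by blast
          then obtain j t where jt: "v = j \<oplus> t \<otimes> w" "j \<in> W'" "t \<in> carrier R" unfolding L_def by blast
          have jc: "j \<in> carrier R" using idealD(2)[OF W'(1) jt(2)] .
          have "t \<notin> M"
          proof
            assume "t \<in> M"
            then have "w \<otimes> t \<in> ?IM" using w Wi(3) by (intro ideal_prod.prod) auto
            then have "t \<otimes> w \<in> W'" using W'(2) m_comm[OF wc jt(3)] by auto
            then show False using jt idealD(4)[OF W'(1)] W'W(2) by blast
          qed
          then obtain s where s: "s \<in> carrier R" "\<one> \<ominus> s \<otimes> t \<in> M" using maximalideal_inverse[OF mult.hyps(2) jt(3)] by blast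
          have "w \<otimes> (\<one> \<ominus> s \<otimes> t) \<in> ?IM" using w Wi(3) s(2) by (intro ideal_prod.prod) auto
          then have "w \<otimes> (\<one> \<ominus> s \<otimes> t) \<ominus> s \<otimes> j \<in> W'"
            using idealD(8)[OF W'(1)] idealD(5)[OF W'(1) s(1) jt(2)] W'(2) by blast
          moreover have "w = (w \<otimes> (\<one> \<ominus> s \<otimes> t) \<ominus> s \<otimes> j) \<oplus> s \<otimes> v"
            unfolding jt(1) using wc s(1) jt(3) jc by algebra
          ultimately show ?thesis using module_sumI tv[OF s(1)] by metis
        qed
      qed
      have "dcc_on R K W'\<longrightarrow> dcc_on R K W"
      proof
        assume "dcc_on R K W'"
        then have "dcc_on R K (module_sum R W' (Span K vs))"
        proof (rule dcc_on_extend_maximal[OF K W'K _ max[OF mult.hyps(2)] vsc])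
          fix q z assume q: "q \<in> M \<inter> K" and "z \<in> set vs"
          then obtain u where u: "z = u \<otimes> v" "u \<in> set us" unfolding vs_def by auto
          have c: "q \<in> carrier R" "u \<in> carrier R" using q idealD(2)[OF Mi] u(2) us(1) by auto
          have "v \<otimes> (u \<otimes> q) \<in> ?IM"
            using v(1) Wi(3) idealD(5)[OF Mi c(2), of q] q by (intro ideal_prod.prod) auto
          moreover have "q \<otimes> z = v \<otimes> (u \<otimes> q)" unfolding u(1) using c vc by (simp add: m_ac)
          ultimately show "q \<otimes> z \<in> W'" using W'(2) by auto
        qed
        then show "dcc_on R K W" using cover dcc_on_mono by blast
      qed
      then have "W' \<in> \<A>" unfolding \<A>_def using W'(1,2) W'W(1) Wi(3,4) by blast
      then show False using W(2)[of W'] W'W v(1) by blast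
    qed
    then show ?case using Wi(4) mult.IH by blast
  qed
  then have "dcc_on R K (carrier R)" using artinian_zero_product[OF art] dcc_on_zero by blast
  then show ?thesis using artinian_subring_iff[OF K] dcc_on_mono[OF _ Kc] by blast
qed


section \<open>Polynomial roots and the Frobenius map\<close>

text \<open>The constant coefficient comes first, so \<open>last\<close> picks the leading
  one.\<close>

primrec horner :: "('a, 'b) ring_scheme \<Rightarrow> 'a list \<Rightarrow> 'a \<Rightarrow> 'a" where
  "horner R [] x = \<zero>\<^bsub>R\<^esub>"
| "horner R (c # cs) x = c \<oplus>\<^bsub>R\<^esub> x \<otimes>\<^bsub>R\<^esub> horner R cs x"

lemma (in cring) horner_closed [simp]:
  "set cs \<subseteq> carrier R \<Longrightarrow> x \<in> carrier R \<Longrightarrow> horner R cs x \<in> carrier R"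
  by (induction cs) auto

text \<open>Division by X - r in Horner's scheme: the values at \<open>r\<close> of the tails are
  the coefficients of the quotient. The leading coefficient is tracked so that the root count can
  recurse on the quotient.\<close>

lemma (in cring) horner_factor:
  assumes r: "r \<in> carrier R" and cs: "set cs \<subseteq> carrier R"
  shows "\<exists>ds. set ds \<subseteq> carrier R \<and> length ds = length cs - 1 \<and> (length cs \<ge> 2 \<longrightarrow> last ds = last cs) \<and>
    (\<forall>x\<in>carrier R. horner R cs x \<ominus> horner R cs r = (x \<ominus> r) \<otimes> horner R ds x)"
  using cs
proof (induction cs)
  case Nil
  then show ?case using r by (intro exI[of _ "[]"]) (auto simp: minus_eq)
next
  case (Cons c cs)
  then obtain ds where ds: "set ds \<subseteq> carrier R" "length ds = length cs - 1" "length cs \<ge> 2 \<longrightarrow> last ds = last cs"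
    "\<And>x. x \<in> carrier R \<Longrightarrow> horner R cs x \<ominus> horner R cs r = (x \<ominus> r) \<otimes> horner R ds x" by auto
  have c: "c \<in> carrier R" "set cs \<subseteq> carrier R" using Cons.prems by auto
  show ?case
  proof (cases "cs = []")
    case True
    then show ?thesis using r c by (intro exI[of _ "[]"]) (auto simp: minus_eq r_neg)
  next
    case False
    let ?ds = "horner R cs r # ds"
    have "horner R (c # cs) x \<ominus> horner R (c # cs) r = (x \<ominus> r) \<otimes> horner R ?ds x" if x: "x \<in> carrier R" for x
    proof -
      have "(c \<oplus> x \<otimes> u) \<ominus> (c \<oplus> r \<otimes> v) = (x \<ominus> r) \<otimes> v \<oplus> x \<otimes> (u \<ominus> v)"
        if "u \<in> carrier R" "v \<in> carrier R" for u v
        using that c(1) r x by algebra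
      from this[of "horner R cs x" "horner R cs r"]
      have "horner R (c # cs) x \<ominus> horner R (c # cs) r
        = (x \<ominus> r) \<otimes> horner R cs r \<oplus> x \<otimes> ((x \<ominus> r) \<otimes> horner R ds x)"
        using ds(4)[OF x] c(2) r x by simp
      also have "\<dots> = (x \<ominus> r) \<otimes> horner R ?ds x"
        using ds(1) c(2) r x by (simp add: r_distr m_lcomm)
      finally show ?thesis .
    qed
    moreover have "last ?ds = last (c # cs)"
    proof (cases "length cs \<ge> 2")
      case True
      then have "ds \<noteq> []" using ds(2) by auto
      then show ?thesis using True ds(3) False by simp
    next
      case small: False
      then obtain e where e: "cs = [e]" using False by (cases cs) (auto simp: Suc_le_eq)
      then have "ds = []" using ds(2) by simp
      then show ?thesis using e c r by simp
    qed
    moreover have "length ?ds = length (c # cs) - 1" using ds(2) False by (cases cs) auto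
    moreover have "set ?ds \<subseteq> carrier R" using ds(1) c(2) r by simp
    ultimately show ?thesis by blast
  qed
qed

lemma (in domain) card_roots_less_length:
  assumes "set cs \<subseteq> carrier R" "cs \<noteq> []" "last cs \<noteq> \<zero>" "finite A" "A \<subseteq> carrier R"
    "\<And>x. x \<in> A \<Longrightarrow> horner R cs x = \<zero>"
  shows "card A < length cs"
  using assms
proof (induction "length cs" arbitrary: cs A)
  case (Suc n)
  show ?case
  proof (cases "A = {}")
    case True
    then show ?thesis using Suc.prems(2) by simp
  next
    case False
    then obtain r where r: "r \<in> A" by blast
    have rc: "r \<in> carrier R" using r Suc.prems(5) by blast
    obtain ds where ds: "set ds \<subseteq> carrier R" "length ds = length cs - 1" "length cs \<ge> 2 \<longrightarrow> last ds = last cs"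
      "\<And>x. x \<in> carrier R \<Longrightarrow> horner R cs x \<ominus> horner R cs r = (x \<ominus> r) \<otimes> horner R ds x"
      using horner_factor[OF rc Suc.prems(1)] by blast
    have two: "length cs \<ge> 2"
    proof (rule ccontr)
      assume "\<not> length cs \<ge> 2"
      then obtain c where "cs = [c]" using Suc.prems(2) by (cases cs) (auto simp: Suc_le_eq)
      then show False using Suc.prems(1,3) Suc.prems(6)[OF r] rc by simp
    qed
    have "card (A - {r}) < length ds"
    proof (rule Suc.hyps(1))
      show "n = length ds" using Suc.hyps(2) ds(2) by simp
      show "ds \<noteq> []" using two ds(2) by auto
      show "last ds \<noteq> \<zero>" using ds(3) two Suc.prems(3) by simp
      fix x assume x: "x \<in> A - {r}"
      have xc: "x \<in> carrier R" using x Suc.prems(5) by blast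
      have hx: "horner R cs x = \<zero>" "horner R cs r = \<zero>" using Suc.prems(6) x r by blast+
      have "(x \<ominus> r) \<otimes> horner R ds x = \<zero>" using ds(4)[OF xc, symmetric] unfolding hx by (simp add: minus_eq)
      moreover have "x \<ominus> r \<noteq> \<zero>" using x eq_diff0[OF xc rc] by blast
      ultimately show "horner R ds x = \<zero>" using integral[of "x \<ominus> r" "horner R ds x"] xc rc ds(1) by auto
    qed (use Suc.prems ds(1) in auto)
    then show ?thesis using ds(2) Suc.prems(4) r by (simp add: card_Diff_singleton)
  qed
qed simp

lemma (in cring) horner_monom: "x \<in> carrier R \<Longrightarrow> horner R (replicate n \<zero> @ [\<one>]) x = x [^] n"
  by (induction n) (auto simp: m_comm)

lemma (in domain) card_frobenius_fixed:
  assumes "s \<ge> 2" "finite A" "A \<subseteq> carrier R" "\<And>x. x \<in> A \<Longrightarrow> x [^] (s::nat) = x"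
  shows "card A \<le> s"
proof -
  \<comment> \<open>The coefficients of X^s - X, a list of length s + 1.\<close>
  let ?cs = "\<zero> # \<ominus> \<one> # (replicate (s - 2) \<zero> @ [\<one>])"
  have "card A < length ?cs"
  proof (rule card_roots_less_length[OF _ _ _ assms(2,3)])
    fix x assume x: "x \<in> A"
    have xc: "x \<in> carrier R" using x assms(3) by blast
    have "horner R ?cs x = x \<otimes> (\<ominus> \<one> \<oplus> x \<otimes> x [^] (s - 2))" using xc by (simp add: horner_monom)
    also have "\<dots> = x [^] (s - 2) \<otimes> x [^] (2::nat) \<ominus> x"
      using xc by (simp add: r_distr r_minus minus_eq numeral_2_eq_2 m_ac a_ac)
    also have "x [^] (s - 2) \<otimes> x [^] (2::nat) = x [^] s" by (simp only: nat_pow_mult[OF xc] le_add_diff_inverse2[OF assms(1)])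
    also have "x [^] s \<ominus> x = \<zero>" using assms(4)[OF x] xc by (simp add: minus_eq r_neg)
    finally show "horner R ?cs x = \<zero>" .
  qed auto
  then show ?thesis using assms(1) by simp
qed

lemma (in domain) finite_frobenius_fixed:
  assumes "s \<ge> 2" shows "finite {x \<in> carrier R. x [^] (s::nat) = x}"
proof (rule ccontr)
  assume "infinite {x \<in> carrier R. x [^] s = x}"
  from infinite_arbitrarily_large[OF this, of "Suc s"]
  obtain A where A: "finite A" "card A = Suc s" "A \<subseteq> {x \<in> carrier R. x [^] s = x}" by blast
  have "card A \<le> s"
  proof (rule card_frobenius_fixed[OF assms A(1)])
    show "A \<subseteq> carrier R" using A(3) by blast
    show "x [^] s = x" if "x \<in> A" for x using A(3) that by blast
  qed
  then show False using A(2) by simp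
qed

section \<open>The binomial theorem and additivity of the Frobenius map\<close>

primrec binomial_sum :: "('a, 'b) ring_scheme \<Rightarrow> 'a \<Rightarrow> 'a \<Rightarrow> nat \<Rightarrow> nat \<Rightarrow> 'a" where
  "binomial_sum R x y n 0 = y [^]\<^bsub>R\<^esub> n"
| "binomial_sum R x y n (Suc m) = binomial_sum R x y n m \<oplus>\<^bsub>R\<^esub>
     of_integer R (int (n choose Suc m)) \<otimes>\<^bsub>R\<^esub> (x [^]\<^bsub>R\<^esub> Suc m \<otimes>\<^bsub>R\<^esub> y [^]\<^bsub>R\<^esub> (n - Suc m))"

context cring
begin

lemma binomial_sum_closed [simp]:
  "x \<in> carrier R \<Longrightarrow> y \<in> carrier R \<Longrightarrow> binomial_sum R x y n m \<in> carrier R"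
  by (induction m) auto

text \<open>For partial sums, Pascal's rule absorbs all terms of the product but one; for m = n the
  remaining term is x^(n+1), the last term of the next expansion.\<close>

lemma binomial_sum_step:
  assumes xy: "x \<in> carrier R" "y \<in> carrier R" and "m \<le> n"
  shows "(x \<oplus> y) \<otimes> binomial_sum R x y n m =
    binomial_sum R x y (Suc n) m \<oplus> \<guillemotleft>int (n choose m)\<guillemotright> \<otimes> (x [^] Suc m \<otimes> y [^] (n - m))"
  using assms(3)
proof (induction m)
  case 0
  have "(x \<oplus> y) \<otimes> u = u \<otimes> y \<oplus> \<one> \<otimes> (x \<otimes> u)" if "u \<in> carrier R" for u
    using that xy by algebra
  from this[of "y [^] n"] show ?case using xy by simp
next
  case (Suc m)
  define A B C u v where "A = binomial_sum R x y n m" and "B = binomial_sum R x y (Suc n) m"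
    and "C = \<guillemotleft>int (n choose m)\<guillemotright>" and "u = x [^] Suc m" and "v = y [^] (n - Suc m)"
  define D where "D = \<guillemotleft>int (n choose Suc m)\<guillemotright>"
  have c: "A \<in> carrier R" "B \<in> carrier R" "C \<in> carrier R" "D \<in> carrier R" "u \<in> carrier R" "v \<in> carrier R"
    unfolding A_def B_def C_def D_def u_def v_def using xy by auto
  have "n - m = Suc (n - Suc m)" using Suc.prems by simp
  then have vy: "y [^] (n - m) = v \<otimes> y" unfolding v_def by simp
  have IH: "(x \<oplus> y) \<otimes> A = B \<oplus> C \<otimes> (u \<otimes> (v \<otimes> y))"
    using Suc unfolding A_def B_def C_def u_def vy by simp
  have "(x \<oplus> y) \<otimes> (A \<oplus> D \<otimes> (u \<otimes> v)) = (x \<oplus> y) \<otimes> A \<oplus> D \<otimes> ((x \<oplus> y) \<otimes> (u \<otimes> v))"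
    using c xy by (simp add: r_distr m_lcomm)
  also have "\<dots> = (B \<oplus> C \<otimes> (u \<otimes> (v \<otimes> y))) \<oplus> D \<otimes> ((x \<oplus> y) \<otimes> (u \<otimes> v))" unfolding IH ..
  also have "\<dots> = (B \<oplus> (C \<oplus> D) \<otimes> (u \<otimes> (v \<otimes> y))) \<oplus> D \<otimes> (u \<otimes> x \<otimes> v)"
    using c xy by algebra
  finally show ?case
    unfolding binomial_sum.simps A_def[symmetric] B_def[symmetric] u_def[symmetric] v_def[symmetric] D_def[symmetric]
    using vy unfolding C_def D_def u_def by simp
qed

lemma binomial_theorem:
  assumes "x \<in> carrier R" "y \<in> carrier R"
  shows "(x \<oplus> y) [^] n = binomial_sum R x y n n"
proof (induction n)
  case (Suc n)
  have "(x \<oplus> y) [^] Suc n = (x \<oplus> y) \<otimes> binomial_sum R x y n n" using Suc assms by (simp add: m_comm)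
  also have "\<dots> = binomial_sum R x y (Suc n) (Suc n)" using binomial_sum_step[OF assms order_refl] assms by simp
  finally show ?case .
qed simp

text \<open>\<open>p\<close> divides the inner binomial coefficients, so the partial sums stay at
  y^p until the last term x^p.\<close>

lemma frobenius_add:
  assumes p: "Factorial_Ring.prime p" "\<guillemotleft>int p\<guillemotright> = \<zero>" and xy: "x \<in> carrier R" "y \<in> carrier R"
  shows "(x \<oplus> y) [^] p = x [^] p \<oplus> y [^] p"
proof -
  have low: "binomial_sum R x y p m = y [^] p" if "m < p" for m
    using that
  proof (induction m)
    case (Suc m)
    have "p dvd (p choose Suc m)" using dvd_choose_prime[of "Suc m" p] p(1) Suc.prems by simp
    then obtain c where "p choose Suc m = p * c" by blast
    then have "\<guillemotleft>int (p choose Suc m)\<guillemotright> = \<zero>" using p(2) by simp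
    then show ?case using Suc xy by simp
  qed simp
  obtain m where m: "p = Suc m" using p(1) prime_gt_0_nat gr0_implies_Suc by blast
  have l: "binomial_sum R x y p m = y [^] p" "p choose Suc m = 1" "p - Suc m = 0"
    using low[of m] unfolding m by simp_all
  have "(x \<oplus> y) [^] p = binomial_sum R x y p (Suc m)" using binomial_theorem[OF xy, of p] unfolding m .
  also have "\<dots> = y [^] p \<oplus> x [^] Suc m" using l xy by (simp del: nat_pow_Suc)
  finally show ?thesis using xy unfolding m[symmetric] by (simp add: a_comm)
qed

lemma frobenius_pow_add:
  assumes p: "Factorial_Ring.prime p" "\<guillemotleft>int p\<guillemotright> = \<zero>" and xy: "x \<in> carrier R" "y \<in> carrier R"
  shows "(x \<oplus> y) [^] (p ^ n) = x [^] (p ^ n) \<oplus> y [^] (p ^ n)"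
proof (induction n)
  case (Suc n)
  have pw: "z [^] (p ^ Suc n) = (z [^] (p ^ n)) [^] p" if "z \<in> carrier R" for z
    using that by (simp add: nat_pow_pow mult.commute)
  show ?case using Suc xy frobenius_add[OF p] by (simp only: pw a_closed nat_pow_closed)
qed (use xy in simp)

text \<open>Additivity applied to - x + x = 0 treats p = 2 and odd \<open>p\<close> alike.\<close>

lemma frobenius_pow_uminus:
  assumes p: "Factorial_Ring.prime p" "\<guillemotleft>int p\<guillemotright> = \<zero>" and x: "x \<in> carrier R"
  shows "(\<ominus> x) [^] (p ^ n) = \<ominus> (x [^] (p ^ n))"
proof -
  have "p ^ n \<noteq> 0" using p(1) by simp
  then have "\<zero> = (\<ominus> x \<oplus> x) [^] (p ^ n)" using x by (simp add: l_neg nat_pow_zero)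
  also have "\<dots> = (\<ominus> x) [^] (p ^ n) \<oplus> x [^] (p ^ n)" using frobenius_pow_add[OF p] x by simp
  finally have "(\<ominus> x) [^] (p ^ n) \<oplus> x [^] (p ^ n) = \<zero>" by simp
  then show ?thesis using sum_zero_eq_neg x by simp
qed

section \<open>Subrings of subrings, and the order of finite subrings\<close>

lemma subring_subring_iff:
  assumes K: "subring K R"
  shows "subring k (R\<lparr>carrier := K\<rparr>) \<longleftrightarrow> k \<subseteq> K \<and> subring k R"
proof -
  interpret K: cring "R\<lparr>carrier := K\<rparr>" using subring_cring[OF K] .
  show ?thesis
  proof
    assume k: "subring k (R\<lparr>carrier := K\<rparr>)"
    have kK: "k \<subseteq> K" using subringE(1)[OF k] by simp
    moreover have "subring k R"
    proof (rule subringI)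
      show "k \<subseteq> carrier R" using kK subringE(1)[OF K] by blast
      show "\<one> \<in> k" using subringE(3)[OF k] by simp
      show "\<ominus> h \<in> k" if "h \<in> k" for h using subringE(5)[OF k that] subring_a_inv[OF K, of h] that kK by auto
      show "h \<otimes> h' \<in> k" "h \<oplus> h' \<in> k" if "h \<in> k" "h' \<in> k" for h h'
        using subringE(6,7)[OF k that] by simp_all
    qed
    ultimately show "k \<subseteq> K \<and> subring k R" by blast
  next
    assume k: "k \<subseteq> K \<and> subring k R"
    show "subring k (R\<lparr>carrier := K\<rparr>)"
    proof (rule K.subringI)
      show "\<ominus>\<^bsub>R\<lparr>carrier := K\<rparr>\<^esub> h \<in> k" if "h \<in> k" for h
        using subringE(5)[of k R h] subring_a_inv[OF K, of h] that k by auto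
    qed (use k subringE[of k R] in auto)
  qed
qed

lemma add_monoid_pow:
  assumes "y \<in> carrier R"
  shows "y [^]\<^bsub>add_monoid (R\<lparr>carrier := E\<rparr>)\<^esub> (k::nat) = \<guillemotleft>int k\<guillemotright> \<otimes> y"
  using assms by (induction k) (simp_all add: nat_pow_def l_distr a_comm)

text \<open>If a prime r other than \<open>p\<close> divided the order of the additive group,
  Sylow's theorem would give a nonzero \<open>y\<close> with r y = 0; since p y = 0 too, Bezout's
  identity gives y = 0.\<close>

lemma card_subring_char_p:
  assumes p: "Factorial_Ring.prime p" "\<guillemotleft>int p\<guillemotright> = \<zero>" and E: "subring E R" "finite E"
  obtains n where "card E = p ^ n"
proof -
  have Ec: "E \<subseteq> carrier R" using subringE(1)[OF E(1)] .
  interpret E: cring "R\<lparr>carrier := E\<rparr>" using subring_cring[OF E(1)] .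
  let ?G = "add_monoid (R\<lparr>carrier := E\<rparr>)"
  have G: "group ?G" using E.add.is_group .
  have "r = p" if r: "Factorial_Ring.prime r" "r dvd card E" for r
  proof (rule ccontr)
    assume "r \<noteq> p"
    obtain m where "card E = r * m" using r(2) by blast
    then have "order ?G = r ^ 1 * m" by (simp add: order_def)
    then obtain H where H: "subgroup H ?G" "card H = r ^ 1"
      using sylow_thm[OF r(1) G, of 1 m] E(2) by auto
    have "\<not> H \<subseteq> {\<zero>}"
    proof
      assume "H \<subseteq> {\<zero>}"
      then have "card H \<le> card {\<zero>}" by (rule card_mono[rotated]) simp
      then show False using H(2) prime_gt_1_nat[OF r(1)] by simp
    qed
    then obtain y where y: "y \<in> H" "y \<noteq> \<zero>" by blast
    have yc: "y \<in> carrier R" using y(1) subgroup.subset[OF H(1)] Ec by auto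
    interpret H: group "?G\<lparr>carrier := H\<rparr>" using subgroup.subgroup_is_group[OF H(1) G] .
    have "y [^]\<^bsub>?G\<lparr>carrier := H\<rparr>\<^esub> order (?G\<lparr>carrier := H\<rparr>) = \<one>\<^bsub>?G\<lparr>carrier := H\<rparr>\<^esub>"
      using H.pow_order_eq_1[of y] y(1) by simp
    moreover have "y [^]\<^bsub>?G\<lparr>carrier := H\<rparr>\<^esub> k = y [^]\<^bsub>?G\<^esub> k" for k :: nat
      by (simp add: nat_pow_def)
    ultimately have ry: "\<guillemotleft>int r\<guillemotright> \<otimes> y = \<zero>"
      using add_monoid_pow[OF yc, of E r] H(2) by (simp add: order_def)
    have "coprime (int r) (int p)" using primes_coprime[OF r(1) p(1) \<open>r \<noteq> p\<close>] by simp
    then obtain a b where "a * int r + b * int p = 1" using bezout_int[of "int r" "int p"] by auto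
    then have "\<one> = \<guillemotleft>a * int r + b * int p\<guillemotright>" by (simp del: of_int_add of_int_mult)
    then have "\<one> = \<guillemotleft>a\<guillemotright> \<otimes> \<guillemotleft>int r\<guillemotright>" using p(2) by simp
    then have "y = \<guillemotleft>a\<guillemotright> \<otimes> (\<guillemotleft>int r\<guillemotright> \<otimes> y)" using yc by (metis l_one m_assoc of_int_closed)
    then show False using ry y(2) by simp
  qed
  note primes = this
  have "card E \<noteq> 0" using E(2) subringE(2)[OF E(1)] by auto
  then obtain y where y: "card E = p ^ multiplicity p (card E) * y" "\<not> p dvd y"
    using multiplicity_decompose'[of "card E" p] p(1) not_prime_unit by blast
  have "y = 1"
  proof (rule ccontr)
    assume "y \<noteq> 1"
    then obtain r where r: "Factorial_Ring.prime r" "r dvd y" using prime_factor_nat by blast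
    then have "r = p" using primes[OF r(1)] y(1) by (metis dvd_mult)
    then show False using r(2) y(2) by simp
  qed
  then show ?thesis using that y(1) by simp
qed

end


section \<open>Subrings of domains algebraic over a finite field\<close>

text \<open>A domain algebraic over a prime field of characteristic \<open>p\<close>, described elementwise: each
  element is fixed by some power of the Frobenius map.\<close>

locale frobenius_domain = domain +
  fixes p :: nat
  assumes prime_p: "Factorial_Ring.prime p" and char_p: "\<guillemotleft>int p\<guillemotright> = \<zero>"
    and periodic: "x \<in> carrier R \<Longrightarrow> \<exists>n\<ge>1. x [^] (p ^ n) = x"
begin

lemma p_ge_2: "p \<ge> 2" using prime_p prime_ge_2_nat by blast

lemma period_mult:
  assumes "x \<in> carrier R" "x [^] (p ^ n) = x" shows "x [^] (p ^ (k * n)) = x"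
proof (induction k)
  case (Suc k)
  have "x [^] (p ^ (Suc k * n)) = (x [^] (p ^ n)) [^] (p ^ (k * n))"
    using assms(1) by (simp add: nat_pow_pow power_add)
  then show ?case using Suc assms(2) by simp
qed (use assms(1) in simp)

lemma period_dvd:
  assumes "x \<in> carrier R" "x [^] (p ^ n) = x" "n dvd m" shows "x [^] (p ^ m) = x"
  using period_mult[OF assms(1,2)] assms(3) by (metis dvd_def mult.commute)

text \<open>For a prime power \<open>N\<close> these are the subfields whose degree (as a Steinitz number) is not
  divisible by \<open>N\<close>.\<close>

definition degree_avoiding :: "nat \<Rightarrow> 'a set" where
  "degree_avoiding N = {x \<in> carrier R. \<exists>n\<ge>1. x [^] (p ^ n) = x \<and> \<not> N dvd n}"

lemma degree_avoidingI:
  "x \<in> carrier R \<Longrightarrow> n \<ge> 1 \<Longrightarrow> x [^] (p ^ n) = x \<Longrightarrow> \<not> N dvd n \<Longrightarrow> x \<in> degree_avoiding N"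
  unfolding degree_avoiding_def by blast

text \<open>Sums and products have the lcm of the two periods as a period, and a prime power
  dividing an lcm divides one of the two numbers; this is why the degrees are tested against prime
  powers.\<close>

lemma subring_degree_avoiding:
  assumes q: "Factorial_Ring.prime q" "e \<ge> 1" shows "subring (degree_avoiding (q ^ e)) R"
proof (rule subringI)
  show "degree_avoiding (q ^ e) \<subseteq> carrier R" unfolding degree_avoiding_def by blast
  have "\<not> q ^ e dvd 1" using q prime_ge_2_nat[OF q(1)] by simp
  then show "\<one> \<in> degree_avoiding (q ^ e)" by (intro degree_avoidingI[of _ 1]) auto
  fix x assume "x \<in> degree_avoiding (q ^ e)"
  then obtain n where x: "x \<in> carrier R" and n: "n \<ge> 1" "x [^] (p ^ n) = x" "\<not> q ^ e dvd n"
    unfolding degree_avoiding_def by blast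
  show "\<ominus> x \<in> degree_avoiding (q ^ e)"
    using frobenius_pow_uminus[OF prime_p char_p x, of n] n x by (intro degree_avoidingI[of _ n]) auto
  fix y assume "y \<in> degree_avoiding (q ^ e)"
  then obtain m where y: "y \<in> carrier R" and m: "m \<ge> 1" "y [^] (p ^ m) = y" "\<not> q ^ e dvd m"
    unfolding degree_avoiding_def by blast
  define l where "l = lcm n m"
  have l0: "l \<ge> 1" using n(1) m(1) unfolding l_def by (metis lcm_pos_nat less_eq_Suc_le One_nat_def)
  have xl: "x [^] (p ^ l) = x" "y [^] (p ^ l) = y"
    using period_dvd[OF x n(2)] period_dvd[OF y m(2)] unfolding l_def by auto
  have le: "\<not> q ^ e dvd l"
  proof
    assume "q ^ e dvd l"
    moreover have "multiplicity q l = max (multiplicity q n) (multiplicity q m)"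
      unfolding l_def using multiplicity_lcm[of n m q] n(1) m(1) q(1) by simp
    ultimately have "e \<le> max (multiplicity q n) (multiplicity q m)"
      using power_dvd_iff_le_multiplicity[of l q e] l0 prime_gt_1_nat[OF q(1)] by simp
    then have "q ^ e dvd n \<or> q ^ e dvd m" by (auto simp: le_max_iff_disj intro: multiplicity_dvd')
    then show False using n(3) m(3) by blast
  qed
  show "x \<oplus> y \<in> degree_avoiding (q ^ e)"
    using frobenius_pow_add[OF prime_p char_p x y, of l] xl x y l0 le by (intro degree_avoidingI[of _ l]) auto
  show "x \<otimes> y \<in> degree_avoiding (q ^ e)"
    using nat_pow_distrib[OF x y, of "p ^ l"] xl x y l0 le by (intro degree_avoidingI[of _ l]) auto
qed

lemma subring_fixed:
  assumes "subring k R" shows "subring {x \<in> k. x [^] (p ^ n) = x} R"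
proof (rule subringI)
  note k = subringE[OF assms]
  have kc: "\<And>x. x \<in> k \<Longrightarrow> x \<in> carrier R" using k(1) by blast
  show "{x \<in> k. x [^] (p ^ n) = x} \<subseteq> carrier R" using kc by blast
  show "\<one> \<in> {x \<in> k. x [^] (p ^ n) = x}" using k(3) by simp
  show "\<ominus> h \<in> {x \<in> k. x [^] (p ^ n) = x}" if "h \<in> {x \<in> k. x [^] (p ^ n) = x}" for h
    using that k(5) frobenius_pow_uminus[OF prime_p char_p kc, of h n] by auto
  show "h \<otimes> h' \<in> {x \<in> k. x [^] (p ^ n) = x}"
    if "h \<in> {x \<in> k. x [^] (p ^ n) = x}" "h' \<in> {x \<in> k. x [^] (p ^ n) = x}" for h h'
    using that k(6) nat_pow_distrib[OF kc kc, of h h' "p ^ n"] by auto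
  show "h \<oplus> h' \<in> {x \<in> k. x [^] (p ^ n) = x}"
    if "h \<in> {x \<in> k. x [^] (p ^ n) = x}" "h' \<in> {x \<in> k. x [^] (p ^ n) = x}" for h h'
    using that k(7) frobenius_pow_add[OF prime_p char_p kc kc, of h h' n] by auto
qed

text \<open>\<open>E\<close> is a finite field, as a^(p^n - 2) inverts a nonzero \<open>a\<close> of
  period \<open>n\<close>, and Lagrange's theorem applies to its multiplicative group.\<close>

lemma finite_subring_fixed:
  assumes E: "subring E R" "finite E" and x: "x \<in> E"
  shows "x [^] card E = x"
proof (cases "x = \<zero>")
  case True
  have "card E \<noteq> 0" using E(2) x by auto
  then show ?thesis using True by (simp add: nat_pow_zero)
next
  case False
  have Ec: "E \<subseteq> carrier R" using subringE(1)[OF E(1)] .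
  interpret E: cring "R\<lparr>carrier := E\<rparr>" using subring_cring[OF E(1)] .
  have inv: "\<exists>b\<in>E. a \<otimes> b = \<one>" if a: "a \<in> E" "a \<noteq> \<zero>" for a
  proof -
    have ac: "a \<in> carrier R" using a Ec by blast
    obtain n where n: "n \<ge> 1" "a [^] (p ^ n) = a" using periodic[OF ac] by blast
    have "p ^ n \<ge> 2" using p_ge_2 n(1) self_le_power[of p n] by simp
    then have "p ^ n = Suc (Suc (p ^ n - 2))" by simp
    then obtain m where m: "p ^ n = Suc (Suc m)" by blast
    have "a \<otimes> (a [^] m \<otimes> a) = a \<otimes> \<one>" using n(2) ac unfolding m by (simp add: m_ac)
    then have "a \<otimes> a [^] m = \<one>" using m_lcancel[of a "a [^] m \<otimes> a" \<one>] a(2) ac by (simp add: m_comm)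
    then show ?thesis using nat_pow_in_subring[OF E(1) a(1), of m] by blast
  qed
  have "field (R\<lparr>carrier := E\<rparr>)"
    using E.cring_fieldI2 inv by simp
  then interpret F: field "R\<lparr>carrier := E\<rparr>" .
  interpret G: group "Multiplicative_Group.mult_of (R\<lparr>carrier := E\<rparr>)" using F.field_mult_group .
  have "x [^]\<^bsub>Multiplicative_Group.mult_of (R\<lparr>carrier := E\<rparr>)\<^esub> order (Multiplicative_Group.mult_of (R\<lparr>carrier := E\<rparr>)) = \<one>\<^bsub>Multiplicative_Group.mult_of (R\<lparr>carrier := E\<rparr>)\<^esub>"
    using G.pow_order_eq_1[of x] x False by simp
  then have "x [^] (card E - 1) = \<one>"
    using F.order_mult_of E(2) by (simp add: Multiplicative_Group.nat_pow_mult_of subring_nat_pow order_def)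
  then have "x [^] (card E - 1) \<otimes> x = x" using x Ec by auto
  then have "x [^] Suc (card E - 1) = x" by simp
  moreover have "card E > 0" using E(2) x card_gt_0_iff by blast
  ultimately show ?thesis by simp
qed

text \<open>Let \<open>m\<close> be the least period of \<open>a\<close>. If no prime power exactly
  dividing \<open>m\<close> worked, \<open>k\<close> would contain, for each prime factor of
  \<open>m\<close>, an element all of whose periods are divisible by the corresponding power. These
  elements lie in a finite subring \<open>E\<close> of \<open>k\<close> with p^n elements, so
  \<open>m\<close> divides \<open>n\<close>; then \<open>a\<close> and the elements of
  \<open>E\<close> are p^n + 1 roots of X^(p^n) - X.\<close>

lemma exists_degree_avoiding:
  assumes k: "subring k R" and a: "a \<in> carrier R" "a \<notin> k"
  shows "\<exists>q e. Factorial_Ring.prime q \<and> e \<ge> 1 \<and> k \<subseteq> degree_avoiding (q ^ e) \<and> a \<notin> degree_avoiding (q ^ e)"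
proof (rule ccontr)
  assume no: "\<not> ?thesis"
  have kc: "k \<subseteq> carrier R" using subringE(1)[OF k] .
  define m where "m = (LEAST n. n \<ge> 1 \<and> a [^] (p ^ n) = a)"
  have m: "m \<ge> 1" "a [^] (p ^ m) = a"
    using LeastI_ex[of "\<lambda>n. n \<ge> 1 \<and> a [^] (p ^ n) = a"] periodic[OF a(1)] unfolding m_def by auto
  have least: "m \<le> n" if "n \<ge> 1" "a [^] (p ^ n) = a" for n
    unfolding m_def using that by (intro Least_le) simp
  have mdvd: "m dvd n" if n: "a [^] (p ^ n) = a" for n
  proof -
    have "n = (n div m) * m + n mod m" by simp
    then have "a [^] (p ^ n) = (a [^] (p ^ ((n div m) * m))) [^] (p ^ (n mod m))"
      using a(1) by (metis nat_pow_pow power_add)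
    then have "a [^] (p ^ (n mod m)) = a" using period_mult[OF a(1) m(2)] n by simp
    then have "n mod m = 0" using least[of "n mod m"] mod_less_divisor[of m n] m(1) by (cases "n mod m") auto
    then show ?thesis by blast
  qed
  let ?Q = "prime_factors m"
  have "\<exists>x. x \<in> k \<and> (\<forall>n\<ge>1. x [^] (p ^ n) = x \<longrightarrow> q ^ multiplicity q m dvd n)" if q: "q \<in> ?Q" for q
  proof -
    have qp: "Factorial_Ring.prime q" "multiplicity q m \<ge> 1"
      using q prime_factors_multiplicity[of m] by auto
    have "a \<notin> degree_avoiding (q ^ multiplicity q m)"
      using mdvd multiplicity_dvd[of q m] dvd_trans unfolding degree_avoiding_def by blast
    then have "\<not> k \<subseteq> degree_avoiding (q ^ multiplicity q m)" using no qp by blast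
    then show ?thesis using kc unfolding degree_avoiding_def by blast
  qed
  then have "\<forall>q\<in>?Q. \<exists>x. x \<in> k \<and> (\<forall>n\<ge>1. x [^] (p ^ n) = x \<longrightarrow> q ^ multiplicity q m dvd n)" by blast
  from bchoice[OF this] obtain x where x: "\<forall>q\<in>?Q. x q \<in> k \<and> (\<forall>n\<ge>1. x q [^] (p ^ n) = x q \<longrightarrow> q ^ multiplicity q m dvd n)"
    by (rule exE)
  have "\<forall>q\<in>?Q. \<exists>n. n \<ge> 1 \<and> x q [^] (p ^ n) = x q" using x periodic kc by blast
  from bchoice[OF this] obtain f where f: "\<forall>q\<in>?Q. f q \<ge> (1::nat) \<and> x q [^] (p ^ f q) = x q" by (rule exE)
  define N where "N = prod f ?Q"
  have N1: "N \<ge> 1" unfolding N_def using f by (auto simp: Suc_le_eq intro!: prod_pos)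
  \<comment> \<open>The elements of \<open>k\<close> with the common period \<open>N\<close> of the
    chosen elements: finite as roots of one polynomial, and a subring because the Frobenius map is
    additive.\<close>
  define E where "E = {y \<in> k. y [^] (p ^ N) = y}"
  have E: "subring E R" unfolding E_def using subring_fixed[OF k] .
  have pN: "p ^ N \<ge> 2" using self_le_power[of p N] N1 p_ge_2 by simp
  have "E \<subseteq> {y \<in> carrier R. y [^] (p ^ N) = y}" unfolding E_def using kc by blast
  then have finE: "finite E" using finite_frobenius_fixed[OF pN] finite_subset by blast
  have xE: "x q \<in> E" if q: "q \<in> ?Q" for q
  proof -
    have "f q dvd N" unfolding N_def using dvd_prodI[OF finite_set_mset q, of f] by simp
    then have "x q [^] (p ^ N) = x q" using period_dvd[of "x q" "f q" N] f x q kc by blast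
    then show ?thesis unfolding E_def using x q by blast
  qed
  obtain n where n: "card E = p ^ n" using card_subring_char_p[OF prime_p char_p E finE] .
  have fixE: "y [^] (p ^ n) = y" if "y \<in> E" for y using finite_subring_fixed[OF E finE that] n by simp
  have n1: "n \<ge> 1"
  proof (rule ccontr)
    assume "\<not> n \<ge> 1"
    then have "card E = 1" using n by simp
    moreover have "{\<zero>, \<one>} \<subseteq> E" using subringE(2,3)[OF E] by blast
    then have "card {\<zero>, \<one>} \<le> card E" using card_mono[OF finE] by blast
    ultimately show False by simp
  qed
  have "m dvd n"
  proof (rule multiplicity_le_imp_dvd)
    show "m \<noteq> 0" using m(1) by simp
    fix q :: nat assume q: "Factorial_Ring.prime q"
    show "multiplicity q m \<le> multiplicity q n"
    proof (cases "q \<in> ?Q")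
      case True
      then have "q ^ multiplicity q m dvd n" using x fixE[OF xE[OF True]] n1 by blast
      then show ?thesis using power_dvd_iff_le_multiplicity[of n q] n1 prime_gt_1_nat[OF q] by simp
    next
      case False
      then have "multiplicity q m = 0" using q m(1) by (auto simp: prime_factors_multiplicity)
      then show ?thesis by simp
    qed
  qed
  then have an: "a [^] (p ^ n) = a" using period_dvd[OF a(1) m(2)] by blast
  have "a \<notin> E" using a(2) unfolding E_def by blast
  have pn: "p ^ n \<ge> 2" using self_le_power[of p n] n1 p_ge_2 by simp
  have "card (insert a E) \<le> p ^ n"
    by (rule card_frobenius_fixed[OF pn]) (use finE a(1) subringE(1)[OF E] an fixE in auto)
  then show False using \<open>a \<notin> E\<close> finE n by simp
qed

text \<open>A maximal subring \<open>k\<close> of \<open>K\<close> has the form \<open>K \<inter> degree_avoiding N\<close>.  Unless \<open>N\<close> divides a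
  period of the generators, \<open>degree_avoiding N\<close> contains these, and so lies in a maximal subring
  \<open>M\<close> of the whole ring with \<open>M \<inter> K = k\<close>.\<close>

lemma finite_maximal_subrings_base:
  assumes K: "subring K R" and F: "finite F" "carrier R = generate_ring R (K \<union> F)"
    and fin: "finite (maximal_subrings R)"
  shows "finite (maximal_subrings (R\<lparr>carrier := K\<rparr>))"
proof -
  have KFc: "K \<union> F \<subseteq> carrier R" using F(2) generate_ring.incl[of _ "K \<union> F" R] by blast
  have full: "B = carrier R" if "subring B R" "K \<subseteq> B" "F \<subseteq> B" for B
    using generate_ring_min_subring1[OF KFc that(1)] that subringE(1)[OF that(1)] F(2) by blast
  have "\<forall>y\<in>F. \<exists>n. n \<ge> 1 \<and> y [^] (p ^ n) = y" using periodic KFc by blast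
  from bchoice[OF this] obtain g where g: "\<forall>y\<in>F. g y \<ge> (1::nat) \<and> y [^] (p ^ g y) = y" by (rule exE)
  define f where "f = prod g F"
  have f1: "f \<ge> 1" unfolding f_def using g by (auto simp: Suc_le_eq intro!: prod_pos)
  have Ff: "y [^] (p ^ f) = y" if "y \<in> F" for y
  proof (rule period_dvd)
    show "g y dvd f" unfolding f_def using dvd_prodI[OF F(1) that] .
  qed (use g that KFc in auto)
  have "maximal_subrings (R\<lparr>carrier := K\<rparr>) \<subseteq>
    (\<lambda>M. M \<inter> K) ` maximal_subrings R \<union> (\<lambda>N. degree_avoiding N \<inter> K) ` {N. N dvd f}"
  proof
    fix k assume "k \<in> maximal_subrings (R\<lparr>carrier := K\<rparr>)"
    then have k: "k \<subseteq> K" "subring k R" "k \<noteq> K"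
      and max: "\<And>S. S \<subseteq> K \<Longrightarrow> subring S R \<Longrightarrow> S \<noteq> K \<Longrightarrow> k \<subseteq> S \<Longrightarrow> S = k"
      unfolding maximal_subrings_def maximal_subring_def subring_subring_iff[OF K] by auto
    obtain a where a: "a \<in> K" "a \<notin> k" using k by blast
    have ac: "a \<in> carrier R" using a(1) KFc by blast
    obtain q e where qe: "Factorial_Ring.prime q" "e \<ge> 1" "k \<subseteq> degree_avoiding (q ^ e)" "a \<notin> degree_avoiding (q ^ e)"
      using exists_degree_avoiding[OF k(2) ac a(2)] by blast
    let ?D = "degree_avoiding (q ^ e)"
    have D: "subring ?D R" using subring_degree_avoiding[OF qe(1,2)] .
    have kD: "?D \<inter> K = k"
    proof (rule max)
      show "subring (?D \<inter> K) R" using subring_inter[OF D K] .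
      show "?D \<inter> K \<noteq> K" using qe(4) a(1) by blast
      show "k \<subseteq> ?D \<inter> K" using qe(3) k(1) by blast
    qed blast
    show "k \<in> (\<lambda>M. M \<inter> K) ` maximal_subrings R \<union> (\<lambda>N. degree_avoiding N \<inter> K) ` {N. N dvd f}"
    proof (cases "q ^ e dvd f")
      case True
      then show ?thesis using kD by blast
    next
      case False
      have FD: "F \<subseteq> ?D"
      proof
        fix y assume "y \<in> F"
        then show "y \<in> ?D" using degree_avoidingI[OF _ f1 Ff False] KFc by blast
      qed
      have Dac: "?D \<union> {a} \<subseteq> carrier R" using subringE(1)[OF D] ac by blast
      define B where "B = generate_ring R (?D \<union> {a})"
      have B: "subring B R" "?D \<union> {a} \<subseteq> B"
        unfolding B_def using generate_ring_is_subring[OF Dac] generate_ring.incl[of _ "?D \<union> {a}" R] by blast+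
      have "B \<inter> K = K"
      proof (rule ccontr)
        assume "B \<inter> K \<noteq> K"
        then have "B \<inter> K = k" using max[of "B \<inter> K"] subring_inter[OF B(1) K] B(2) qe(3) k(1) by blast
        then show False using a B(2) by blast
      qed
      then have gen: "carrier R = generate_ring R (?D \<union> {a})"
        using full[OF B(1)] FD B(2) unfolding B_def by blast
      have "?D \<noteq> carrier R" using qe(4) ac by blast
      then obtain M where M: "maximal_subring M R" "?D \<subseteq> M"
        using exists_maximal_subring[OF D _ _ gen] by blast
      have Ms: "subring M R" "M \<noteq> carrier R" using M(1) unfolding maximal_subring_def by auto
      have "M \<inter> K \<noteq> K"
      proof
        assume "M \<inter> K = K"
        then have "M = carrier R" using full[OF Ms(1)] FD M(2) by blast
        then show False using Ms(2) by simp
      qed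
      then have "M \<inter> K = k" using max[of "M \<inter> K"] subring_inter[OF Ms(1) K] M(2) qe(3) k(1) by blast
      then show ?thesis using M(1) unfolding maximal_subrings_def by blast
    qed
  qed
  moreover have "finite {N. N dvd f}" using finite_divisors_nat f1 by simp
  ultimately show ?thesis using fin by (meson finite_Un finite_imageI finite_subset)
qed

end

section \<open>From coinciding powers to a Frobenius domain\<close>

lemma (in domain) exists_prime_characteristic:
  assumes "z \<noteq> 0" "\<guillemotleft>z\<guillemotright> = \<zero>"
  obtains p :: nat where "Factorial_Ring.prime p" "\<guillemotleft>int p\<guillemotright> = \<zero>"
proof -
  have "\<guillemotleft>int (nat \<bar>z\<bar>)\<guillemotright> = \<zero>" using assms(2) by (cases "z \<ge> 0") simp_all
  then have ex: "\<exists>n::nat. n \<ge> 1 \<and> \<guillemotleft>int n\<guillemotright> = \<zero>" using assms(1) by (intro exI[of _ "nat \<bar>z\<bar>"]) auto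
  define p where "p = (LEAST n::nat. n \<ge> 1 \<and> \<guillemotleft>int n\<guillemotright> = \<zero>)"
  have p: "p \<ge> 1" "\<guillemotleft>int p\<guillemotright> = \<zero>" using LeastI_ex[OF ex] unfolding p_def by auto
  have least: "p \<le> n" if "n \<ge> 1" "\<guillemotleft>int n\<guillemotright> = \<zero>" for n :: nat
    unfolding p_def using that by (intro Least_le) simp
  have "Factorial_Ring.prime p" unfolding prime_nat_iff
  proof (intro conjI allI impI)
    have "p \<noteq> 1" using p(2) by auto
    then show "1 < p" using p(1) by simp
    fix m assume "m dvd p"
    then obtain c where c: "p = m * c" by blast
    then have mc: "m \<ge> 1" "c \<ge> 1" using p(1) by (auto simp: Suc_le_eq)
    have "\<guillemotleft>int m\<guillemotright> \<otimes> \<guillemotleft>int c\<guillemotright> = \<zero>" using p(2) c by simp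
    then consider "\<guillemotleft>int m\<guillemotright> = \<zero>" | "\<guillemotleft>int c\<guillemotright> = \<zero>" using integral[of "\<guillemotleft>int m\<guillemotright>" "\<guillemotleft>int c\<guillemotright>"] by auto
    then show "m = 1 \<or> m = p"
    proof cases
      case 1
      then have "m * c \<le> m * 1" using least[OF mc(1)] c by simp
      then show ?thesis using c mc by simp
    next
      case 2
      then have "m * c \<le> 1 * c" using least[OF mc(2)] c by simp
      then show ?thesis using c mc by simp
    qed
  qed
  then show ?thesis using that p(2) by blast
qed

text \<open>Two equal powers of the element 2 give a nonzero integer that vanishes in
  \<open>R\<close>, hence a prime characteristic. A nonzero \<open>x\<close> is a root of unity, so
  x^(p^i) = x^(p^j) for some i < j, and additivity turns this into (x^(p^n) - x)^(p^i) = 0 with n =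
  j - i.\<close>

lemma (in domain) exists_frobenius_domain:
  assumes tor: "\<And>x. x \<in> carrier R \<Longrightarrow> \<exists>a b::nat. b < a \<and> x [^] a = x [^] b"
  obtains p where "frobenius_domain R p"
proof -
  obtain a b :: nat where ab: "b < a" "\<guillemotleft>2\<guillemotright> [^] a = \<guillemotleft>2\<guillemotright> [^] b" using tor[of "\<guillemotleft>2\<guillemotright>"] by auto
  have "\<guillemotleft>2 ^ a - 2 ^ b\<guillemotright> = \<zero>" using ab(2) by (simp add: minus_eq r_neg)
  moreover have "(2::int) ^ a - 2 ^ b \<noteq> 0" using ab(1) by simp
  ultimately obtain p where p: "Factorial_Ring.prime p" "\<guillemotleft>int p\<guillemotright> = \<zero>"
    using exists_prime_characteristic by blast
  have "\<exists>n\<ge>1. x [^] (p ^ n) = x" if x: "x \<in> carrier R" for x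
  proof (cases "x = \<zero>")
    case True
    then show ?thesis using p(1) by (intro exI[of _ 1]) (auto simp: nat_pow_zero)
  next
    case False
    obtain a b :: nat where ab: "b < a" "x [^] a = x [^] b" using tor[OF x] by blast
    define c where "c = a - b"
    have c: "c > 0" "x [^] c = \<one>" unfolding c_def using ab(1) nat_pow_eq_one[OF x False ab] by auto
    have red: "x [^] n = x [^] (n mod c)" for n :: nat
    proof -
      have "x [^] n = x [^] (c * (n div c) + n mod c)" by simp
      also have "\<dots> = (x [^] c) [^] (n div c) \<otimes> x [^] (n mod c)"
        using x by (simp only: nat_pow_mult[symmetric] nat_pow_pow)
      also have "\<dots> = x [^] (n mod c)" using c(2) x by simp
      finally show ?thesis .
    qed
    have "range (\<lambda>i. x [^] (p ^ i)) \<subseteq> (\<lambda>n. x [^] n) ` {..<c}"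
    proof
      fix y assume "y \<in> range (\<lambda>i. x [^] (p ^ i))"
      then obtain i where "y = x [^] (p ^ i)" by blast
      then have "y = x [^] (p ^ i mod c)" using red by (rule trans)
      moreover have "p ^ i mod c \<in> {..<c}" using c(1) by simp
      ultimately show "y \<in> (\<lambda>n. x [^] n) ` {..<c}" by (rule image_eqI)
    qed
    then have "finite (range (\<lambda>i. x [^] (p ^ i)))" using finite_subset by blast
    then have "\<not> inj (\<lambda>i. x [^] (p ^ i))" using finite_imageD infinite_UNIV_nat by blast
    then obtain i' j' where ne: "i' \<noteq> j'" and eq: "x [^] (p ^ i') = x [^] (p ^ j')" unfolding inj_def by blast
    have "\<exists>i j. i < j \<and> x [^] (p ^ i) = x [^] (p ^ j)"
    proof (cases "i' < j'")
      case True
      then show ?thesis using eq by blast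
    next
      case False
      then have "j' < i'" using ne by simp
      then show ?thesis using eq[symmetric] by blast
    qed
    then obtain i j where ij: "i < j" "x [^] (p ^ i) = x [^] (p ^ j)" by blast
    define n where "n = j - i"
    have n1: "n \<ge> 1" "p ^ j = p ^ n * p ^ i" unfolding n_def using ij(1) by (auto simp: power_add[symmetric])
    have xn: "x [^] (p ^ n) \<in> carrier R" using x by simp
    have "(x [^] (p ^ n) \<ominus> x) [^] (p ^ i) = (x [^] (p ^ n)) [^] (p ^ i) \<oplus> (\<ominus> x) [^] (p ^ i)"
      unfolding minus_eq using frobenius_pow_add[OF p xn] x by simp
    also have "\<dots> = x [^] (p ^ j) \<ominus> x [^] (p ^ i)"
      using frobenius_pow_uminus[OF p x] x n1(2) by (simp add: nat_pow_pow minus_eq)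
    also have "\<dots> = \<zero>" using ij(2) x by (simp add: minus_eq r_neg)
    finally have "x [^] (p ^ n) \<ominus> x = \<zero>" using nat_pow_eq_0_iff[of "x [^] (p ^ n) \<ominus> x" "p ^ i"] xn x by simp
    then have "x [^] (p ^ n) = x" using eq_diff0[OF xn x] by simp
    then show ?thesis using n1(1) by blast
  qed
  then have "frobenius_domain R p"
    using p by (intro frobenius_domain.intro domain_axioms frobenius_domain_axioms.intro) auto
  then show ?thesis by (rule that)
qed

lemma (in domain) finite_maximal_subrings_subring:
  assumes "\<And>x. x \<in> carrier R \<Longrightarrow> \<exists>a b::nat. b < a \<and> x [^] a = x [^] b"
    and "subring K R" "finite F" "carrier R = generate_ring R (K \<union> F)" "finite (maximal_subrings R)"
  shows "finite (maximal_subrings (R\<lparr>carrier := K\<rparr>))"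
proof -
  obtain p where "frobenius_domain R p" using exists_frobenius_domain assms(1) by blast
  then show ?thesis using frobenius_domain.finite_maximal_subrings_base assms(2-5) by blast
qed


section \<open>Maximal subrings of reduced rings\<close>

context cring
begin

lemma prod_avoiding_prime:
  assumes "finite \<N>" "\<And>M. M \<in> \<N> \<Longrightarrow> ideal M R \<and> (\<exists>x\<in>M. x \<notin> P)" "primeideal P R"
  shows "\<exists>x\<in>carrier R. x \<notin> P \<and> (\<forall>M\<in>\<N>. x \<in> M)"
  using assms(1,2)
proof (induction \<N>)
  case empty
  have "\<one> \<notin> P"
    using primeideal.I_notcarr[OF assms(3)] ideal.one_imp_carrier[OF primeideal.axioms(1)[OF assms(3)]] by blast
  then show ?case by blast
next
  case (insert M \<N>)
  then obtain x where x: "x \<in> carrier R" "x \<notin> P" "\<forall>M\<in>\<N>. x \<in> M" by auto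
  have M: "ideal M R" using insert.prems by blast
  obtain y where y: "y \<in> M" "y \<notin> P" using insert.prems by blast
  have yc: "y \<in> carrier R" using idealD(2)[OF M y(1)] .
  have "x \<otimes> y \<notin> P" using primeideal.I_prime[OF assms(3) x(1) yc] x(2) y(2) by blast
  moreover have "x \<otimes> y \<in> M" using idealD(5)[OF M x(1) y(1)] .
  moreover have "x \<otimes> y \<in> M'" if "M' \<in> \<N>" for M'
    using idealD(6)[of M' y x] insert.prems[of M'] that x(3) yc by blast
  ultimately show ?case using x(1) yc by blast
qed

text \<open>S + I is a subring strictly above \<open>S\<close>, hence everything.\<close>

lemma maximal_subring_sum_ideal:
  assumes S: "maximal_subring S R" and I: "ideal I R" "\<not> I \<subseteq> S" and x: "x \<in> carrier R"
  obtains s i where "x = s \<oplus> i" "s \<in> S" "i \<in> I"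
proof -
  have Ss: "subring S R" using S unfolding maximal_subring_def by blast
  define B where "B = {k \<oplus> i | k i. k \<in> S \<and> i \<in> I}"
  have B: "subring B R" "S \<subseteq> B" "I \<subseteq> B" unfolding B_def using subring_sum_ideal[OF Ss I(1)] by auto
  have "B = carrier R"
  proof (rule ccontr)
    assume "B \<noteq> carrier R"
    then have "B = S" using S B(1,2) unfolding maximal_subring_def by blast
    then show False using B(3) I(2) by blast
  qed
  then have "x \<in> B" using x by simp
  then show ?thesis using that unfolding B_def by blast
qed

text \<open>A maximal subring \<open>S\<close> containing no maximal ideal surjects onto every residue field.  If it
  met each ideal \<open>other_maximal M\<close> (the intersection of the maximal ideals other than \<open>M\<close>), it
  would contain all of them, hence be the whole ring; so it meets one of them trivially and
  is isomorphic to the quotient by it.\<close>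

definition other_maximal :: "'a set \<Rightarrow> 'a set" where
  "other_maximal M = {x \<in> carrier R. \<forall>N. maximalideal N R \<longrightarrow> N \<noteq> M \<longrightarrow> x \<in> N}"

lemma ideal_other_maximal: "ideal (other_maximal M) R"
proof -
  have i: "\<And>N. maximalideal N R \<Longrightarrow> ideal N R" using maximalideal.axioms(1) .
  show ?thesis unfolding ideal_iff_submod other_maximal_def
    using idealD(3-5)[OF i] by (intro submodI) auto
qed

lemma maximal_subring_iso_quotient:
  assumes fin: "semilocal R"
    and rad: "\<And>x. x \<in> carrier R \<Longrightarrow> (\<And>M. maximalideal M R \<Longrightarrow> x \<in> M) \<Longrightarrow> x = \<zero>"
    and S: "maximal_subring S R" and no: "\<And>M. maximalideal M R \<Longrightarrow> \<not> M \<subseteq> S"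
  shows "\<exists>M. maximalideal M R \<and> R\<lparr>carrier := S\<rparr> \<simeq> R Quot other_maximal M"
proof -
  have Ss: "subring S R" "S \<noteq> carrier R" using S unfolding maximal_subring_def by auto
  have Sc: "S \<subseteq> carrier R" using subringE(1)[OF Ss(1)] .
  have i: "\<And>N. maximalideal N R \<Longrightarrow> ideal N R" using maximalideal.axioms(1) .
  let ?I = other_maximal
  have Ii: "ideal (?I M) R" for M using ideal_other_maximal .
  have ImN: "x \<in> N" if "x \<in> ?I M" "maximalideal N R" "N \<noteq> M" for x M N
    using that unfolding other_maximal_def by blast
  have zero: "x = \<zero>" if M: "maximalideal M R" and x: "x \<in> ?I M" "x \<in> M" for x M
  proof (rule rad)
    show "x \<in> carrier R" using idealD(2)[OF Ii x(1)] .
    show "x \<in> N" if "maximalideal N R" for N using ImN[OF x(1) that] x(2) by blast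
  qed
  have "\<exists>M. maximalideal M R \<and> S \<inter> ?I M \<subseteq> {\<zero>}"
  proof (rule ccontr)
    assume "\<not> (\<exists>M. maximalideal M R \<and> S \<inter> ?I M \<subseteq> {\<zero>})"
    then have meet: "\<exists>s\<in>S \<inter> ?I M. s \<noteq> \<zero>" if "maximalideal M R" for M using that by blast
    \<comment> \<open>A nonzero \<open>s\<close> in \<open>S\<close> and \<open>?I M\<close> lies
      outside \<open>M\<close>; with an inverse \<open>r\<close> of \<open>s\<close> modulo
      \<open>M\<close> one gets b = (b r) s. Since S + M is everything, b r may be replaced by an
      element of \<open>S\<close>: the error lies in \<open>M\<close> and is killed by
      \<open>s\<close>.\<close>
    have sub: "?I M \<subseteq> S" if M: "maximalideal M R" for M
    proof
      fix b assume b: "b \<in> ?I M"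
      have bc: "b \<in> carrier R" using idealD(2)[OF Ii b] .
      obtain s where s: "s \<in> S" "s \<in> ?I M" "s \<noteq> \<zero>" using meet[OF M] by blast
      have sc: "s \<in> carrier R" using s(1) Sc by blast
      have "s \<notin> M" using zero[OF M s(2)] s(3) by blast
      then obtain r where r: "r \<in> carrier R" "\<one> \<ominus> r \<otimes> s \<in> M" using maximalideal_inverse[OF M sc] by blast
      have "b \<otimes> (\<one> \<ominus> r \<otimes> s) = \<zero>"
      proof (rule zero[OF M])
        show "b \<otimes> (\<one> \<ominus> r \<otimes> s) \<in> ?I M" using idealD(6)[OF Ii _ b] r(1) sc by simp
        show "b \<otimes> (\<one> \<ominus> r \<otimes> s) \<in> M" using idealD(5)[OF i[OF M] bc r(2)] .
      qed
      moreover have "b \<otimes> (\<one> \<ominus> r \<otimes> s) = b \<ominus> (b \<otimes> r) \<otimes> s"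
        using bc r(1) sc by algebra
      ultimately have eq: "b = (b \<otimes> r) \<otimes> s" using eq_diff0[of b "(b \<otimes> r) \<otimes> s"] bc r(1) sc by simp
      obtain k m where km: "b \<otimes> r = k \<oplus> m" "k \<in> S" "m \<in> M"
        using maximal_subring_sum_ideal[OF S i[OF M] no[OF M], of "b \<otimes> r"] bc r(1) by auto
      have c: "k \<in> carrier R" "m \<in> carrier R" using km Sc idealD(2)[OF i[OF M]] by auto
      have "m \<otimes> s = \<zero>"
        by (rule zero[OF M]) (use idealD(5)[OF Ii c(2) s(2)] idealD(6)[OF i[OF M] sc km(3)] in auto)
      then have "b = k \<otimes> s" using eq unfolding km(1) using c sc by (simp add: l_distr)
      then show "b \<in> S" using subringE(6)[OF Ss(1) km(2) s(1)] by simp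
    qed
    \<comment> \<open>The conductor, the largest ideal of \<open>R\<close> inside \<open>S\<close>.
      It contains every \<open>?I M\<close>; if proper, it lies in some maximal \<open>N\<close>,
      although \<open>?I N\<close> meets \<open>N\<close> only in zero.\<close>
    define A where "A = {x \<in> carrier R. \<forall>r\<in>carrier R. r \<otimes> x \<in> S}"
    have A: "ideal A R" unfolding ideal_iff_submod A_def
      using subringE(2,7)[OF Ss(1)] by (intro submodI) (auto simp: r_distr m_assoc[symmetric])
    have IA: "?I M \<subseteq> A" if "maximalideal M R" for M
      using sub[OF that] idealD(2,5)[OF Ii] unfolding A_def by blast
    show False
    proof (cases "\<one> \<in> A")
      case True
      have "r \<in> S" if "r \<in> carrier R" for r using True that unfolding A_def by force
      then show False using Ss(2) Sc by blast
    next
      case False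
      then obtain N where N: "maximalideal N R" "A \<subseteq> N" using exists_maximalideal[OF A] by blast
      obtain s where "s \<in> ?I N" "s \<noteq> \<zero>" using meet[OF N(1)] by blast
      then show False using zero[OF N(1)] IA[OF N(1)] N(2) by blast
    qed
  qed
  then obtain M where M: "maximalideal M R" "S \<inter> ?I M \<subseteq> {\<zero>}" by blast
  \<comment> \<open>Otherwise \<open>?I M\<close> would be zero. But choosing an element outside
    \<open>M\<close> from each of the finitely many other maximal ideals, and multiplying, gives an
    element of \<open>?I M\<close> outside \<open>M\<close>.\<close>
  have "\<not> ?I M \<subseteq> S"
  proof
    assume "?I M \<subseteq> S"
    then have z: "?I M \<subseteq> {\<zero>}" using M(2) by blast
    have "\<exists>x\<in>carrier R. x \<notin> M \<and> (\<forall>N\<in>{N. maximalideal N R} - {M}. x \<in> N)"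
    proof (rule prod_avoiding_prime)
      show "finite ({N. maximalideal N R} - {M})" using fin unfolding semilocal_def by simp
      show "primeideal M R" using maximalideal_prime[OF M(1)] .
      fix N assume N: "N \<in> {N. maximalideal N R} - {M}"
      then show "ideal N R \<and> (\<exists>x\<in>N. x \<notin> M)" using i maximalideal_subset_eq[OF _ M(1), of N] by blast
    qed
    then obtain x where x: "x \<in> carrier R" "x \<notin> M" "\<forall>N\<in>{N. maximalideal N R} - {M}. x \<in> N" by blast
    then have "x \<in> ?I M" unfolding other_maximal_def by blast
    then have "x = \<zero>" using z by blast
    then show False using x(2) idealD(3)[OF i[OF M(1)]] by simp
  qed
  note split = maximal_subring_sum_ideal[OF S Ii this]
  interpret S: cring "R\<lparr>carrier := S\<rparr>" using subring_cring[OF Ss(1)] .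
  interpret h: ring_hom_ring R "R Quot ?I M" "(+>) (?I M)" using quot_hom(2)[OF Ii] .
  have "(+>) (?I M) \<in> ring_hom (R\<lparr>carrier := S\<rparr>) (R Quot ?I M)"
    using Sc h.hom_mult h.hom_add h.hom_one h.hom_closed by (intro ring_hom_memI) (simp_all add: subset_iff)
  moreover have "bij_betw ((+>) (?I M)) S (carrier (R Quot ?I M))"
    unfolding bij_betw_def
  proof
    show "inj_on ((+>) (?I M)) S"
    proof (rule inj_onI)
      fix s t assume st: "s \<in> S" "t \<in> S" "?I M +> s = ?I M +> t"
      have c: "s \<in> carrier R" "t \<in> carrier R" using st Sc by auto
      have "s \<ominus> t \<in> S \<inter> ?I M" using quot_hom(5)[OF Ii c] st subring_minus[OF Ss(1) st(1,2)] by blast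
      then show "s = t" using M(2) eq_diff0[OF c] by blast
    qed
    show "(+>) (?I M) ` S = carrier (R Quot ?I M)"
    proof
      show "(+>) (?I M) ` S \<subseteq> carrier (R Quot ?I M)" using Sc by auto
      show "carrier (R Quot ?I M) \<subseteq> (+>) (?I M) ` S"
      proof
        fix y assume "y \<in> carrier (R Quot ?I M)"
        then obtain x where x: "x \<in> carrier R" "y = ?I M +> x" using quot_hom(3)[OF Ii, of M] by blast
        obtain s j where sj: "x = s \<oplus> j" "s \<in> S" "j \<in> ?I M" using split[OF x(1)] .
        have c: "s \<in> carrier R" "j \<in> carrier R" using sj Sc idealD(2)[OF Ii] by auto
        have "x \<ominus> s = j" unfolding sj(1) using c by algebra
        then have "y = ?I M +> s" using quot_hom(5)[OF Ii x(1) c(1)] sj(3) x(2) by simp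
        then show "y \<in> (+>) (?I M) ` S" using sj(2) by blast
      qed
    qed
  qed
  ultimately have "R\<lparr>carrier := S\<rparr> \<simeq> R Quot ?I M" unfolding is_ring_iso_def ring_iso_def by auto
  then show ?thesis using M(1) by blast
qed

text \<open>A maximal subring either contains a maximal ideal, and \<open>over\<close> leaves
  finitely many of these, or is isomorphic to the quotient by some \<open>other_maximal M\<close>,
  so that its whole class is determined by \<open>M\<close>.\<close>

lemma finitely_many_maximal_subrings_up_to_isoI:
  assumes fin: "semilocal R"
    and rad: "\<And>x. x \<in> carrier R \<Longrightarrow> (\<And>M. maximalideal M R \<Longrightarrow> x \<in> M) \<Longrightarrow> x = \<zero>"
    and over: "\<And>M. maximalideal M R \<Longrightarrow> finite {S \<in> maximal_subrings R. M \<subseteq> S}"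
  shows "finitely_many_maximal_subrings_up_to_iso R"
proof -
  let ?Max = "{M. maximalideal M R}"
  let ?C1 = "\<Union>M\<in>?Max. {S \<in> maximal_subrings R. M \<subseteq> S}"
  let ?C2 = "\<lambda>M. {S. subring S R \<and> R\<lparr>carrier := S\<rparr> \<simeq> R Quot other_maximal M}"
  have "maximal_subrings R // subring_iso_rel R \<subseteq>
    (\<lambda>S. subring_iso_rel R `` {S}) ` ?C1 \<union> ?C2 ` ?Max"
  proof
    fix C assume "C \<in> maximal_subrings R // subring_iso_rel R"
    then obtain S where S: "S \<in> maximal_subrings R" "C = subring_iso_rel R `` {S}" by (rule quotientE)
    show "C \<in> (\<lambda>S. subring_iso_rel R `` {S}) ` ?C1 \<union> ?C2 ` ?Max"
    proof (cases "S \<in> ?C1")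
      case True
      then show ?thesis using S(2) by blast
    next
      case False
      have Sm: "maximal_subring S R" using S(1) unfolding maximal_subrings_def by blast
      then have Ss: "subring S R" unfolding maximal_subring_def by blast
      obtain M where M: "maximalideal M R" "R\<lparr>carrier := S\<rparr> \<simeq> R Quot other_maximal M"
        using maximal_subring_iso_quotient[OF fin rad Sm] False S(1) by blast
      have r: "ring (R\<lparr>carrier := S'\<rparr>)" if "subring S' R" for S' using subring_is_ring[OF that] .
      have "C = ?C2 M"
      proof
        show "C \<subseteq> ?C2 M"
          unfolding S(2) subring_iso_rel_def using M(2) ring_iso_sym[OF r[OF Ss]] ring_iso_trans by blast
        show "?C2 M \<subseteq> C"
          unfolding S(2) subring_iso_rel_def using M(2) ring_iso_sym[OF r] ring_iso_trans Ss by blast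
      qed
      then show ?thesis using M(1) by blast
    qed
  qed
  moreover have "finite ?Max" using fin unfolding semilocal_def .
  moreover have "finite ?C1" using \<open>finite ?Max\<close> over by blast
  ultimately show ?thesis
    unfolding finitely_many_maximal_subrings_up_to_iso_def by (meson finite_Un finite_imageI finite_subset)
qed

section \<open>The nilradical and the residue rings\<close>

lemma nilradical_eq_Inter_primes:
  "nilradical R = {x \<in> carrier R. \<forall>P. primeideal P R \<longrightarrow> x \<in> P}"
proof
  show "nilradical R \<subseteq> {x \<in> carrier R. \<forall>P. primeideal P R \<longrightarrow> x \<in> P}"
  proof
    fix x assume "x \<in> nilradical R"
    then obtain n :: nat where x: "x \<in> carrier R" "x [^] n = \<zero>" unfolding nilradical_def by blast
    have "x \<in> P" if P: "primeideal P R" for P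
    proof -
      interpret P: primeideal P R by fact
      have "x [^] k \<in> P \<longrightarrow> x \<in> P" for k :: nat
      proof (induction k)
        case 0
        then show ?case using P.I_notcarr P.one_imp_carrier by auto
      next
        case (Suc k)
        then show ?case using P.I_prime[of "x [^] k" x] x(1) by auto
      qed
      then show ?thesis using x(2) idealD(3)[OF P.is_ideal] by metis
    qed
    then show "x \<in> {x \<in> carrier R. \<forall>P. primeideal P R \<longrightarrow> x \<in> P}" using x(1) by blast
  qed
  show "{x \<in> carrier R. \<forall>P. primeideal P R \<longrightarrow> x \<in> P} \<subseteq> nilradical R"
  proof
    fix x assume x: "x \<in> {x \<in> carrier R. \<forall>P. primeideal P R \<longrightarrow> x \<in> P}"
    then have xc: "x \<in> carrier R" by blast
    show "x \<in> nilradical R"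
    proof (rule ccontr)
      assume "x \<notin> nilradical R"
      then have d: "{\<zero>} \<inter> range (\<lambda>n::nat. x [^] n) = {}" using xc unfolding nilradical_def by force
      obtain P where P: "primeideal P R" "P \<inter> range (\<lambda>n::nat. x [^] n) = {}"
      proof (rule exists_primeideal_disjoint[OF zeroideal d])
        show "range (\<lambda>n::nat. x [^] n) \<subseteq> carrier R" using xc by auto
        show "\<one> \<in> range (\<lambda>n::nat. x [^] n)" by (rule range_eqI[of _ _ 0]) simp
        fix y z assume "y \<in> range (\<lambda>n::nat. x [^] n)" "z \<in> range (\<lambda>n::nat. x [^] n)"
        then obtain m n :: nat where "y = x [^] m" "z = x [^] n" by blast
        then have "y \<otimes> z = x [^] (m + n)" using xc by (simp add: nat_pow_mult)
        then show "y \<otimes> z \<in> range (\<lambda>n::nat. x [^] n)" by blast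
      qed
      have "x [^] (1::nat) \<notin> P" using P(2) by blast
      then show False using x P(1) xc by simp
    qed
  qed
qed

lemma ideal_nilradical: "ideal (nilradical R) R"
proof -
  have i: "\<And>P. primeideal P R \<Longrightarrow> ideal P R" using primeideal.axioms(1) .
  show ?thesis unfolding ideal_iff_submod nilradical_eq_Inter_primes
    using idealD(3-5)[OF i] by (intro submodI) auto
qed

text \<open>Primes are maximal here, so dividing by the nilradical leaves zero as the intersection
  of the maximal ideals; and the maximal subrings above a maximal ideal correspond to those of a
  residue ring R/P.\<close>

lemma quot_nilradical_maximal_subrings:
  assumes tor: "power_torsion R" and semi: "semilocal R"
    and over: "\<And>P. primeideal P R \<Longrightarrow> finite (maximal_subrings (R Quot P))"
  shows "finitely_many_maximal_subrings_up_to_iso (R Quot nilradical R)"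
proof -
  let ?n = "nilradical R"
  let ?B = "R Quot ?n"
  note ni = ideal_nilradical
  interpret h: ring_hom_cring R ?B "(+>) ?n" using quot_hom(1)[OF ni] .
  note surj = quot_hom(3)[OF ni] and ker = quot_hom(4)[OF ni] and eq = quot_hom(5)[OF ni]
  have nP: "?n \<subseteq> P" if "primeideal P R" for P using that unfolding nilradical_eq_Inter_primes by blast
  show ?thesis
  proof (rule h.S.finitely_many_maximal_subrings_up_to_isoI)
    have "{M. maximalideal M R \<and> {x \<in> carrier R. ?n +> x = \<zero>\<^bsub>?B\<^esub>} \<subseteq> M} \<subseteq> {M. maximalideal M R}" by blast
    then show "semilocal ?B"
      using h.semilocal_image[OF surj] semi finite_subset unfolding semilocal_def by blast
  next
    fix y assume y: "y \<in> carrier ?B" and all: "\<And>N. maximalideal N ?B \<Longrightarrow> y \<in> N"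
    obtain x where x: "x \<in> carrier R" "y = ?n +> x" using y surj by blast
    have "x \<in> P" if P: "primeideal P R" for P
    proof (rule ccontr)
      assume xP: "x \<notin> P"
      have Pi: "ideal P R" using primeideal.axioms(1)[OF P] .
      obtain r where r: "r \<in> carrier R" "\<one> \<ominus> r \<otimes> x \<in> P"
        using maximalideal_inverse[OF power_torsion_prime_maximal[OF tor P] x(1) xP] by blast
      let ?z = "\<one> \<ominus> r \<otimes> x"
      have zc: "?z \<in> carrier R" using r(1) x(1) by simp
      \<comment> \<open>The class of an element of \<open>P\<close>, hence not a unit, since the
        nilradical lies in \<open>P\<close>. A maximal ideal containing it also contains
        \<open>y\<close>, hence the class of (1 - r x) + r x = 1.\<close>
      define u where "u = ?n +> ?z"
      have uc: "u \<in> carrier ?B" unfolding u_def using zc by simp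
      have "\<one>\<^bsub>?B\<^esub> \<notin> PIdl\<^bsub>?B\<^esub> u"
      proof
        assume "\<one>\<^bsub>?B\<^esub> \<in> PIdl\<^bsub>?B\<^esub> u"
        then obtain v where v: "v \<in> carrier ?B" "\<one>\<^bsub>?B\<^esub> = v \<otimes>\<^bsub>?B\<^esub> u" unfolding cgenideal_def by blast
        then obtain w where w: "w \<in> carrier R" "v = ?n +> w" using surj by blast
        have "?n +> \<one> = ?n +> (w \<otimes> ?z)" using v(2) w zc unfolding u_def by simp
        then have "\<one> \<ominus> w \<otimes> ?z \<in> ?n" using eq[of \<one> "w \<otimes> ?z"] w(1) zc by simp
        then have "(\<one> \<ominus> w \<otimes> ?z) \<oplus> w \<otimes> ?z \<in> P"
          using idealD(4)[OF Pi] idealD(5)[OF Pi w(1) r(2)] nP[OF P] by blast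
        moreover have "(\<one> \<ominus> t) \<oplus> t = \<one>" if "t \<in> carrier R" for t using that by algebra
        ultimately show False
          using ideal.one_imp_carrier[OF Pi] primeideal.I_notcarr[OF P] w(1) zc by simp
      qed
      then obtain N where N: "maximalideal N ?B" "PIdl\<^bsub>?B\<^esub> u \<subseteq> N"
        using h.S.exists_maximalideal[OF h.S.cgenideal_ideal[OF uc]] by blast
      have Ni: "ideal N ?B" using maximalideal.axioms(1)[OF N(1)] .
      have "u \<in> N" using h.S.cgenideal_self[OF uc] N(2) by blast
      moreover have "(?n +> r) \<otimes>\<^bsub>?B\<^esub> y \<in> N" using h.S.idealD(5)[OF Ni _ all[OF N(1)]] r(1) by simp
      ultimately have "u \<oplus>\<^bsub>?B\<^esub> (?n +> r) \<otimes>\<^bsub>?B\<^esub> y \<in> N" using h.S.idealD(4)[OF Ni] by blast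
      moreover have "u \<oplus>\<^bsub>?B\<^esub> (?n +> r) \<otimes>\<^bsub>?B\<^esub> y = ?n +> (?z \<oplus> r \<otimes> x)"
        unfolding u_def x(2) using r(1) x(1) zc by simp
      moreover have "?z \<oplus> r \<otimes> x = \<one>" using r(1) x(1) by algebra
      ultimately show False
        using ideal.one_imp_carrier[OF Ni] maximalideal.I_notcarr[OF N(1)] by simp
    qed
    then have "x \<in> ?n" using x(1) unfolding nilradical_eq_Inter_primes by blast
    then show "y = \<zero>\<^bsub>?B\<^esub>" using ker x by blast
  next
    fix N assume N: "maximalideal N ?B"
    let ?p = "\<lambda>K. {x \<in> carrier R. ?n +> x \<in> K}"
    have P: "primeideal (?p N) R" using maximalideal_prime[OF h.vimage_maximalideal[OF surj N]] .
    have Pi: "ideal (?p N) R" using primeideal.axioms(1)[OF P] .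
    have "finite {S \<in> maximal_subrings R. ?p N \<subseteq> S}"
      using ring_hom_ring.finite_maximal_subrings_iff[OF quot_hom(2,3)[OF Pi]] over[OF P]
      unfolding quot_hom(4)[OF Pi] by blast
    moreover have b: "bij_betw ?p (maximal_subrings ?B) {M \<in> maximal_subrings R. ?n \<subseteq> M}"
      using ring_hom_ring.bij_betw_maximal_subrings[OF quot_hom(2)[OF ni] surj] unfolding ker .
    then have "?p ` {S \<in> maximal_subrings ?B. N \<subseteq> S} \<subseteq> {S \<in> maximal_subrings R. ?p N \<subseteq> S}"
      unfolding bij_betw_def by auto
    moreover have "inj_on ?p {S \<in> maximal_subrings ?B. N \<subseteq> S}"
      using b unfolding bij_betw_def by (auto intro: inj_on_subset)
    ultimately show "finite {S \<in> maximal_subrings ?B. N \<subseteq> S}"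
      by (meson finite_imageD finite_subset)
  qed
qed

text \<open>For a prime \<open>Q\<close> of \<open>R\<close> over \<open>P\<close>, K/P is
  isomorphic to the image of \<open>K\<close> in the domain R/Q. This domain is generated by
  finitely many elements over the image and inherits finiteness of maximal subrings, so the result
  for domains applies.\<close>

lemma finite_maximal_subrings_quot_prime:
  assumes tor: "power_torsion R" and fin: "finite (maximal_subrings R)"
    and K: "subring K R" and F: "finite F" "carrier R = generate_ring R (K \<union> F)"
    and P: "primeideal P (R\<lparr>carrier := K\<rparr>)"
  shows "finite (maximal_subrings ((R\<lparr>carrier := K\<rparr>) Quot P))"
proof -
  let ?K = "R\<lparr>carrier := K\<rparr>"
  have Kc: "K \<subseteq> carrier R" using subringE(1)[OF K] .
  have KFc: "K \<union> F \<subseteq> carrier R" using F(2) generate_ring.incl[of _ "K \<union> F" R] by blast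
  interpret K: cring ?K using subring_cring[OF K] .
  obtain Q where Q: "primeideal Q R" "Q \<inter> K = P" using power_torsion_prime_lift[OF tor K P] .
  have Qi: "ideal Q R" and Pi: "ideal P ?K" using primeideal.axioms(1) Q(1) P by auto
  let ?L = "R Quot Q" and ?h = "(+>) Q"
  interpret L: domain ?L using primeideal.quotient_is_domain[OF Q(1)] .
  interpret h: ring_hom_ring R ?L ?h using quot_hom(2)[OF Qi] .
  have torL: "\<exists>a b::nat. b < a \<and> y [^]\<^bsub>?L\<^esub> a = y [^]\<^bsub>?L\<^esub> b" if y: "y \<in> carrier ?L" for y
  proof -
    obtain x where x: "x \<in> carrier R" "y = ?h x" using y quot_hom(3)[OF Qi] by blast
    obtain a b :: nat where ab: "b < a" "x [^] a \<ominus> x [^] b \<in> Q" using power_torsionD[OF tor Q(1) x(1)] by blast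
    have "?h (x [^] a) = ?h (x [^] b)" using quot_hom(5)[OF Qi, of "x [^] a" "x [^] b"] ab(2) x(1) by simp
    then have "y [^]\<^bsub>?L\<^esub> a = y [^]\<^bsub>?L\<^esub> b" using h.hom_nat_pow[OF x(1)] x(2) by simp
    then show ?thesis using ab(1) by blast
  qed
  have hK: "subring (?h ` K) ?L" using h.img_is_subring[OF K] .
  have gen: "carrier ?L = generate_ring ?L (?h ` K \<union> ?h ` F)"
  proof
    have c: "?h ` K \<union> ?h ` F \<subseteq> carrier ?L" using KFc by auto
    show "generate_ring ?L (?h ` K \<union> ?h ` F) \<subseteq> carrier ?L" using L.generate_ring_incl[OF c] .
    let ?G = "generate_ring ?L (?h ` K \<union> ?h ` F)"
    have s: "subring {x \<in> carrier R. ?h x \<in> ?G} R" using h.vimage_subring[OF L.generate_ring_is_subring[OF c]] .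
    have "K \<union> F \<subseteq> {x \<in> carrier R. ?h x \<in> ?G}"
    proof
      fix x assume x: "x \<in> K \<union> F"
      then have "?h x \<in> ?h ` K \<union> ?h ` F" by blast
      then have "?h x \<in> ?G" by (rule generate_ring.incl)
      then show "x \<in> {x \<in> carrier R. ?h x \<in> ?G}" using x KFc by blast
    qed
    then have "generate_ring R (K \<union> F) \<subseteq> {x \<in> carrier R. ?h x \<in> ?G}"
      by (rule generate_ring_min_subring1[OF KFc s])
    then have "?h ` carrier R \<subseteq> ?G" using F(2) by auto
    then show "carrier ?L \<subseteq> ?G" unfolding quot_hom(3)[OF Qi] .
  qed
  have "finite (maximal_subrings (?L\<lparr>carrier := ?h ` K\<rparr>))"
    using L.finite_maximal_subrings_subring[OF torL hK _ gen finite_maximal_subrings_quot[OF Qi fin]] F(1) by blast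
  moreover have "ring_hom_ring ?K (?L\<lparr>carrier := ?h ` K\<rparr>) ?h"
  proof (rule ring_hom_ringI2)
    show "ring ?K" using K.ring_axioms .
    show "ring (?L\<lparr>carrier := ?h ` K\<rparr>)" using L.subring_is_ring[OF hK] .
    show "?h \<in> ring_hom ?K (?L\<lparr>carrier := ?h ` K\<rparr>)" using Kc h.hom_mult h.hom_add h.hom_one by (intro ring_hom_memI) (simp_all add: subset_iff)
  qed
  then interpret g: ring_hom_ring ?K "?L\<lparr>carrier := ?h ` K\<rparr>" ?h .
  have "{x \<in> carrier ?K. ?h x = \<zero>\<^bsub>?L\<lparr>carrier := ?h ` K\<rparr>\<^esub>} = {x \<in> carrier R. ?h x = \<zero>\<^bsub>?L\<^esub>} \<inter> K"
    using Kc by auto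
  then have "{x \<in> carrier ?K. ?h x = \<zero>\<^bsub>?L\<lparr>carrier := ?h ` K\<rparr>\<^esub>} = P" unfolding quot_hom(4)[OF Qi] using Q(2) by simp
  ultimately have "finite {M \<in> maximal_subrings ?K. P \<subseteq> M}" using g.finite_maximal_subrings_iff by simp
  then show ?thesis
    using ring_hom_ring.finite_maximal_subrings_iff[OF K.quot_hom(2,3)[OF Pi]] unfolding K.quot_hom(4)[OF Pi] by blast
qed

end

theorem theorem3p9:
  fixes T :: "('a, 'b) ring_scheme" and R :: "'a set" and \<alpha> :: "nat \<Rightarrow> 'a" and n :: nat
  assumes "cring T" and "\<one>\<^bsub>T\<^esub> \<noteq> \<zero>\<^bsub>T\<^esub>"
    and "subring R T"
    and "\<alpha> ` {1..n} \<subseteq> carrier T"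
    and "carrier T = generate_ring T (R \<union> \<alpha> ` {1..n})"
    and "finite (maximal_subrings T)"
  shows "(zero_dimensional (T\<lparr>carrier := R\<rparr>) \<longleftrightarrow> zero_dimensional T) \<and>
    (semilocal (T\<lparr>carrier := R\<rparr>) \<longleftrightarrow> semilocal T) \<and>
    (artinian (T\<lparr>carrier := R\<rparr>) \<longleftrightarrow> artinian T) \<and>
    (zero_dimensional (T\<lparr>carrier := R\<rparr>) \<or> semilocal (T\<lparr>carrier := R\<rparr>) \<or> artinian (T\<lparr>carrier := R\<rparr>) \<longrightarrow>
       fg_module_over R T \<and>
       (\<forall>P. primeideal P (T\<lparr>carrier := R\<rparr>) \<longrightarrow>
          finite (maximal_subrings ((T\<lparr>carrier := R\<rparr>) Quot P)))) \<and>
    (semilocal (T\<lparr>carrier := R\<rparr>) \<or> artinian (T\<lparr>carrier := R\<rparr>) \<longrightarrow>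
       finitely_many_maximal_subrings_up_to_iso
         ((T\<lparr>carrier := R\<rparr>) Quot nilradical (T\<lparr>carrier := R\<rparr>)))"
proof -
  interpret T: cring T by fact
  let ?R = "T\<lparr>carrier := R\<rparr>" and ?F = "\<alpha> ` {1..n}"
  note R = \<open>subring R T\<close> and gen = \<open>carrier T = generate_ring T (R \<union> ?F)\<close> and fin = \<open>finite (maximal_subrings T)\<close>
  have F: "finite ?F" by simp
  interpret R: cring ?R using T.subring_cring[OF R] .
  have semi_R: "semilocal ?R" if "artinian ?R" using R.artinian_semilocal that .
  have semi_T: "semilocal T" if "semilocal ?R"
    using T.semilocal_of_semilocal_subring[OF fin R F gen that] .
  have tor_T: "power_torsion T" if "zero_dimensional T \<or> semilocal T \<or> artinian T"
    using that T.power_torsion_of_zero_dimensional[OF fin] T.power_torsion_semilocal[OF fin] T.artinian_semilocal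
    by blast
  \<comment> \<open>An artinian ring is semilocal and semilocality passes up to \<open>T\<close>, so
    the artinian case joins the semilocal one.\<close>
  have tor_R: "power_torsion T" if "zero_dimensional ?R \<or> semilocal ?R \<or> artinian ?R"
    using that T.power_torsion_of_zero_dimensional_subring[OF fin R F gen] semi_R semi_T tor_T by blast
  \<comment> \<open>Apart from the passage of semilocality from \<open>R\<close> up to
    \<open>T\<close>, every conclusion follows from power torsion of \<open>T\<close>; the
    equivalences then only require power torsion to be derived from either side.\<close>
  have tor: "zero_dimensional T \<and> zero_dimensional ?R \<and> (semilocal T \<longrightarrow> semilocal ?R) \<and>
      (artinian ?R \<longleftrightarrow> artinian T) \<and> fg_module_over R T \<and>
      (\<forall>P. primeideal P ?R \<longrightarrow> finite (maximal_subrings (?R Quot P))) \<and>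
      (semilocal ?R \<longrightarrow> finitely_many_maximal_subrings_up_to_iso (?R Quot nilradical ?R))"
    if tor: "power_torsion T"
  proof -
    have torR: "power_torsion ?R" using T.power_torsion_subring[OF tor R] .
    obtain us where us: "set us \<subseteq> carrier T" "T.Span R us = carrier T"
      using T.power_torsion_finite_module[OF R tor F gen] by blast
    have max: "maximalideal (M \<inter> R) ?R" if "maximalideal M T" for M
      using R.power_torsion_prime_maximal[OF torR T.primeideal_restrict[OF T.maximalideal_prime[OF that] R]] .
    have quot: "finite (maximal_subrings (?R Quot P))" if "primeideal P ?R" for P
      using T.finite_maximal_subrings_quot_prime[OF tor fin R F gen that] .
    have "artinian ?R \<longleftrightarrow> artinian T"
      using T.artinian_of_finite_module[OF R _ us] T.artinian_subring_of_finite_module[OF R _ us max] by blast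
    moreover have "fg_module_over R T" unfolding fg_module_over_def using us by blast
    moreover have "semilocal ?R \<longrightarrow> finitely_many_maximal_subrings_up_to_iso (?R Quot nilradical ?R)"
      using R.quot_nilradical_maximal_subrings[OF torR _ quot] by blast
    ultimately show ?thesis
      using T.power_torsion_zero_dimensional[OF tor] R.power_torsion_zero_dimensional[OF torR]
        T.power_torsion_semilocal_subring[OF tor R] quot by blast
  qed
  have "zero_dimensional ?R \<longleftrightarrow> zero_dimensional T" using tor tor_T tor_R by blast
  moreover have "semilocal ?R \<longleftrightarrow> semilocal T" using tor tor_T semi_T by blast
  moreover have "artinian ?R \<longleftrightarrow> artinian T" using tor tor_T tor_R by blast
  moreover have "fg_module_over R T \<and> (\<forall>P. primeideal P ?R \<longrightarrow> finite (maximal_subrings (?R Quot P)))"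
    if "zero_dimensional ?R \<or> semilocal ?R \<or> artinian ?R"
    using tor[OF tor_R[OF that]] by blast
  moreover have "finitely_many_maximal_subrings_up_to_iso (?R Quot nilradical ?R)"
    if "semilocal ?R \<or> artinian ?R"
    using tor[OF tor_R] semi_R that by blast
  ultimately show ?thesis by (intro conjI impI) blast+
qed

end
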